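(* Let $\Gamma$ be a valued structure with an oligomorphic automorphism group and a finite signature. Suppose that $\Delta$ is a valued structure with a finite signature over the same domain $C$ such that every cost function of $\Delta$ is from $\langle\Gamma\rangle$. Then there is a polynomial-time reduction from $\mathrm{VCSP}(\Delta)$ to $\mathrm{VCSP}(\Gamma)$.
   Context: A valued relation of arity $k$ over a set $C$ is a function $R\colon C^k\to\mathbb{Q}\cup\{\infty\}$, where $a<\infty$ for $a\in\mathbb{Q}$, $a+\infty=\infty+a=\infty$ for $a\in\mathbb{Q}\cup\{\infty\}$, $0\cdot\infty=0$, and $a\cdot\infty=\infty$ for $a>0$. A valued relation with values in $\{0,\infty\}$ is identified with the classical relation $\{a\in C^k\mid R(a)=0\}$. A valued $\tau$-structure $\Gamma$ consists of a countable domain $C$ and a valued relation $R^\Gamma$ over $C$ of arity $k$ for every $R\in\tau$ of arity $k$; these valued relations are also called the cost functions of $\Gamma$. An atomic $\tau$-expression is $R(x_1,\dots,x_k)$ with $R\in\tau\cup\{R_=,R_\emptyset\}$ and not necessarily distinct variables, where $R_=(x,y)=0$ if $x=y$ and $\infty$ otherwise, and $R_\emptyset(x)=\infty$ for all $x$. A $\tau$-expression $\phi(x_1,\dots,x_n)$ is a finite sum of atomic $\tau$-expressions (repetitions allowed); it defines $\phi^\Gamma\colon C^n\to\mathbb{Q}\cup\{\infty\}$. For $\Gamma$ with finite signature $\tau$, $\mathrm{VCSP}(\Gamma)$ is the problem of deciding, given a $\tau$-expression $\phi(x_1,\dots,x_n)$ and $u\in\mathbb{Q}$, whether there is $a\in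 C^n$ with $\phi^\Gamma(a)\le u$. An automorphism of $\Gamma$ is a permutation $\alpha$ of $C$ with $R^\Gamma(\alpha(a))=R^\Gamma(a)$ for all $R\in\tau$ and all tuples $a$; a permutation group on a countable set is oligomorphic if it has finitely many orbits of $k$-tuples for every $k\in\mathbb{N}$. $\langle\Gamma\rangle$ is the smallest set of valued relations over $C$ that contains the valued relations of $\Gamma$ and is closed under: forming sums of atomic expressions (where $R_=$ and $R_\emptyset$ may be used); projecting ($R'(a)=\inf_{b\in C^n}R(a,b)$); non-negative scaling ($aR$ with $a\in\mathbb{Q}_{\ge0}$); shifting ($R+a$ with $a\in\mathbb{Q}$); $\mathrm{Feas}(R)=\{a\mid R(a)<\infty\}$; and $\mathrm{Opt}(R)=\{a\in\mathrm{Feas}(R)\mid R(a)\le R(b)\text{ for all }b\}$. *)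

theory Defs
  imports
    "HOL-Library.Extended_Real"
    "HOL-Library.FuncSet"
    "HOL-Computational_Algebra.Polynomial"
begin

section \<open>Valued relations and valued structures\<close>

abbreviation tuples :: "nat \<Rightarrow> 'c list set" where
  "tuples k \<equiv> {a. length a = k}"

text \<open>
  \<open>\<rat> \<union> {\<infinity>}\<close> is taken as a subset of the extended reals, whose addition, order and
  multiplication satisfy the stated conventions; in particular \<open>0 * \<infinity> = 0\<close> there.
\<close>

definition rat_inf :: "ereal set" where
  "rat_inf = range (\<lambda>q. ereal (of_rat q)) \<union> {\<infinity>}"

text \<open>
  Valued relations of arity \<open>k\<close> are extensional on the \<open>k\<close>-tuples, so that two of them are
  equal as functions iff they agree on all \<open>k\<close>-tuples.
\<close>

definition valued_relations :: "nat \<Rightarrow> ('c list \<Rightarrow> ereal) set" where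
  "valued_relations k = tuples k \<rightarrow>\<^sub>E rat_inf"

text \<open>The domain is the type \<open>'c\<close>; relation symbols are natural numbers.\<close>

record 'c vstruct =
  symbols :: "nat set"
  arity :: "nat \<Rightarrow> nat"
  cost :: "nat \<Rightarrow> 'c list \<Rightarrow> ereal"

definition valued_structure :: "'c::countable vstruct \<Rightarrow> bool" where
  "valued_structure \<Gamma> \<longleftrightarrow> (\<forall>r\<in>symbols \<Gamma>. cost \<Gamma> r \<in> valued_relations (arity \<Gamma> r))"

definition Aut :: "'c vstruct \<Rightarrow> ('c \<Rightarrow> 'c) set" where
  "Aut \<Gamma> = {\<alpha>. bij \<alpha> \<and>
     (\<forall>r\<in>symbols \<Gamma>. \<forall>a\<in>tuples (arity \<Gamma> r). cost \<Gamma> r (map \<alpha> a) = cost \<Gamma> r a)}"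

definition oligomorphic :: "('c \<Rightarrow> 'c) set \<Rightarrow> bool" where
  "oligomorphic G \<longleftrightarrow> (\<forall>k. finite ((\<lambda>a. {map \<alpha> a | \<alpha>. \<alpha> \<in> G}) ` tuples k))"


section \<open>Expressions\<close>

text \<open>
  The variables of an expression \<open>\<phi>(x\<^sub>1, \<dots>, x\<^sub>n)\<close> are the numbers below \<open>n\<close>.  The type
  parameter is the type of relation symbols; it is \<open>nat\<close> for the expressions over a structure,
  whereas in the definition of \<open>wclone\<close> the relations serve as their own symbols.
\<close>

datatype (atom_rels: 'r) atom =
    Rel 'r "nat list"
  | Equal nat nat
  | Empty nat

fun atom_vars :: "'r atom \<Rightarrow> nat set" where
  "atom_vars (Rel r vs) = set vs"
| "atom_vars (Equal i j) = {i, j}"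
| "atom_vars (Empty i) = {i}"

fun atom_arity_ok :: "('r \<Rightarrow> nat) \<Rightarrow> 'r atom \<Rightarrow> bool" where
  "atom_arity_ok ar (Rel r vs) \<longleftrightarrow> length vs = ar r"
| "atom_arity_ok ar (Equal i j) \<longleftrightarrow> True"
| "atom_arity_ok ar (Empty i) \<longleftrightarrow> True"

fun atom_val :: "('r \<Rightarrow> 'c list \<Rightarrow> ereal) \<Rightarrow> 'c list \<Rightarrow> 'r atom \<Rightarrow> ereal" where
  "atom_val I a (Rel r vs) = I r (map (\<lambda>i. a ! i) vs)"
| "atom_val I a (Equal i j) = (if a ! i = a ! j then 0 else \<infinity>)"
| "atom_val I a (Empty i) = \<infinity>"

definition expr_val :: "('r \<Rightarrow> 'c list \<Rightarrow> ereal) \<Rightarrow> 'r atom list \<Rightarrow> 'c list \<Rightarrow> ereal" where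
  "expr_val I \<phi> a = (\<Sum>A\<leftarrow>\<phi>. atom_val I a A)"


section \<open>The closure of a valued structure\<close>

definition crisp :: "nat \<Rightarrow> 'c list set \<Rightarrow> 'c list \<Rightarrow> ereal" where
  "crisp k S = (\<lambda>a\<in>tuples k. if a \<in> S then 0 else \<infinity>)"

definition Feas :: "nat \<Rightarrow> ('c list \<Rightarrow> ereal) \<Rightarrow> 'c list set" where
  "Feas k R = {a\<in>tuples k. R a < \<infinity>}"

definition Opt :: "nat \<Rightarrow> ('c list \<Rightarrow> ereal) \<Rightarrow> 'c list set" where
  "Opt k R = {a\<in>Feas k R. \<forall>b\<in>tuples k. R a \<le> R b}"

text \<open>
  \<open>(k, R) \<in> wclone \<Gamma>\<close> means that the relation \<open>R\<close> of arity \<open>k\<close> belongs to \<open>\<langle>\<Gamma>\<rangle>\<close>.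
  An infimum of values in \<open>\<rat> \<union> {\<infinity>}\<close> may be irrational or \<open>-\<infinity>\<close>; a projection counts only
  if it is again a valued relation.
\<close>

inductive_set wclone :: "'c vstruct \<Rightarrow> (nat \<times> ('c list \<Rightarrow> ereal)) set"
  for \<Gamma> :: "'c vstruct" where
  base: "r \<in> symbols \<Gamma> \<Longrightarrow> (arity \<Gamma> r, cost \<Gamma> r) \<in> wclone \<Gamma>"
| sum: "\<lbrakk>\<forall>A\<in>set \<phi>. atom_arity_ok fst A \<and> atom_vars A \<subseteq> {..<n} \<and> (\<forall>R\<in>atom_rels A. R \<in> wclone \<Gamma>)\<rbrakk>
    \<Longrightarrow> (n, \<lambda>a\<in>tuples n. expr_val snd \<phi> a) \<in> wclone \<Gamma>"
| project: "\<lbrakk>(k + n, R) \<in> wclone \<Gamma>; R' = (\<lambda>a\<in>tuples k. INF b\<in>tuples n. R (a @ b));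
      R' \<in> valued_relations k\<rbrakk> \<Longrightarrow> (k, R') \<in> wclone \<Gamma>"
| scale: "\<lbrakk>(k, R) \<in> wclone \<Gamma>; (q::rat) \<ge> 0\<rbrakk>
    \<Longrightarrow> (k, \<lambda>a\<in>tuples k. ereal (of_rat q) * R a) \<in> wclone \<Gamma>"
| shift: "(k, R) \<in> wclone \<Gamma> \<Longrightarrow> (k, \<lambda>a\<in>tuples k. R a + ereal (of_rat (q::rat))) \<in> wclone \<Gamma>"
| feas: "(k, R) \<in> wclone \<Gamma> \<Longrightarrow> (k, crisp k (Feas k R)) \<in> wclone \<Gamma>"
| opt: "(k, R) \<in> wclone \<Gamma> \<Longrightarrow> (k, crisp k (Opt k R)) \<in> wclone \<Gamma>"


section \<open>Polynomial-time reductions\<close>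

text \<open>
  Deterministic multi-tape Turing machines with two-way infinite tapes.  States and tape symbols
  are natural numbers; 0 is both the start state and the blank.  The program is a finite partial
  function, hence mentions only finitely many states and symbols, and the machine halts where
  it is undefined.
\<close>

datatype dir = ToLeft | Stay | ToRight

fun offset :: "dir \<Rightarrow> int" where
  "offset ToLeft = -1"
| "offset Stay = 0"
| "offset ToRight = 1"

type_synonym tape = "(int \<Rightarrow> nat) \<times> int"
type_synonym config = "nat \<times> tape list"

record tm =
  num_tapes :: nat
  program :: "nat \<times> nat list \<Rightarrow> (nat \<times> (nat \<times> dir) list) option"

definition turing_machine :: "tm \<Rightarrow> bool" where
  "turing_machine M \<longleftrightarrow> num_tapes M > 0 \<and> finite (dom (program M)) \<and>
     (\<forall>q rs q' as. program M (q, rs) = Some (q', as) \<longrightarrow>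
        length rs = num_tapes M \<and> length as = num_tapes M)"

fun read_tape :: "tape \<Rightarrow> nat" where
  "read_tape (c, h) = c h"

fun act_tape :: "nat \<times> dir \<Rightarrow> tape \<Rightarrow> tape" where
  "act_tape (s, d) (c, h) = (c(h := s), h + offset d)"

definition steps :: "tm \<Rightarrow> (config \<times> config) set" where
  "steps M = {((q, ts), (q', map2 act_tape as ts)) | q ts q' as.
     program M (q, map read_tape ts) = Some (q', as)}"

definition halted :: "tm \<Rightarrow> config \<Rightarrow> bool" where
  "halted M cfg \<longleftrightarrow> program M (fst cfg, map read_tape (snd cfg)) = None"

type_synonym word = "nat list"

definition word_tape :: "word \<Rightarrow> int \<Rightarrow> nat" where
  "word_tape w i = (if 0 \<le> i \<and> i < int (length w) then w ! nat i else 0)"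

definition init_config :: "tm \<Rightarrow> word \<Rightarrow> config" where
  "init_config M w = (0, (word_tape w, 0) # replicate (num_tapes M - 1) (word_tape [], 0))"

text \<open>The input is on the first tape, the output on the last one.\<close>

definition poly_time_computable_on :: "word set \<Rightarrow> (word \<Rightarrow> word) \<Rightarrow> bool" where
  "poly_time_computable_on X f \<longleftrightarrow> (\<exists>M (p :: nat poly). turing_machine M \<and>
     (\<forall>w\<in>X. \<exists>t cfg. t \<le> poly p (length w) \<and> (init_config M w, cfg) \<in> steps M ^^ t \<and>
        halted M cfg \<and> fst (last (snd cfg)) = word_tape (f w)))"

text \<open>A decision problem is given by its set of instances and its set of yes-instances.\<close>

type_synonym problem = "word set \<times> word set"

definition poly_time_reduction :: "(word \<Rightarrow> word) \<Rightarrow> problem \<Rightarrow> problem \<Rightarrow> bool" where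
  "poly_time_reduction f P Q \<longleftrightarrow> poly_time_computable_on (fst P) f \<and>
     (\<forall>w\<in>fst P. f w \<in> fst Q \<and> (w \<in> snd P \<longleftrightarrow> f w \<in> snd Q))"


section \<open>Valued constraint satisfaction problems\<close>

text \<open>
  Instances are words over the letters \<open>1, \<dots>, 8\<close>.  Numbers are written in binary, least
  significant digit first, with letters 1 and 2 for the digits 0 and 1.  Letter 3 is a comma,
  4, 5 and 6 open the three kinds of atoms, 7 opens the threshold, and 8 is a minus sign.  The
  threshold is a reduced fraction.
\<close>

fun bin :: "nat \<Rightarrow> word" where
  "bin n = (if n = 0 then [] else (1 + n mod 2) # bin (n div 2))"

declare bin.simps [simp del]

fun enc_atom :: "nat atom \<Rightarrow> word" where
  "enc_atom (Rel r vs) = 4 # bin r @ concat (map (\<lambda>i. 3 # bin i) vs)"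
| "enc_atom (Equal i j) = 5 # bin i @ 3 # bin j"
| "enc_atom (Empty i) = 6 # bin i"

definition enc_rat :: "rat \<Rightarrow> word" where
  "enc_rat u = (case quotient_of u of (p, q) \<Rightarrow>
     (if p < 0 then [8] else []) @ bin (nat \<bar>p\<bar>) @ 3 # bin (nat q))"

type_synonym vcsp_instance = "nat \<times> nat atom list \<times> rat"

fun enc_instance :: "vcsp_instance \<Rightarrow> word" where
  "enc_instance (n, \<phi>, u) = bin n @ concat (map enc_atom \<phi>) @ 7 # enc_rat u"

definition vcsp_instances :: "'c vstruct \<Rightarrow> vcsp_instance set" where
  "vcsp_instances \<Gamma> = {(n, \<phi>, u) | n \<phi> u. \<forall>A\<in>set \<phi>.
     atom_rels A \<subseteq> symbols \<Gamma> \<and> atom_arity_ok (arity \<Gamma>) A \<and> atom_vars A \<subseteq> {..<n}}"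

definition vcsp_yes :: "'c vstruct \<Rightarrow> vcsp_instance set" where
  "vcsp_yes \<Gamma> = {(n, \<phi>, u) | n \<phi> u. (n, \<phi>, u) \<in> vcsp_instances \<Gamma> \<and>
     (\<exists>a\<in>tuples n. expr_val (cost \<Gamma>) \<phi> a \<le> ereal (of_rat u))}"

definition VCSP :: "'c vstruct \<Rightarrow> problem" where
  "VCSP \<Gamma> = (enc_instance ` vcsp_instances \<Gamma>, enc_instance ` vcsp_yes \<Gamma>)"

text \<open>The encoding is injective, so \<open>VCSP\<close> is a problem about instances.\<close>

lemma bin_inj: "bin m = bin n \<Longrightarrow> m = n"
proof (induction m arbitrary: n rule: bin.induct)
  case (1 m)
  show ?case
  proof (cases "m = 0 \<or> n = 0")
    case True
    with 1(2) show ?thesis by (auto simp: bin.simps[of m] bin.simps[of n] split: if_splits)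
  next
    case False
    with 1(2) have "m mod 2 = n mod 2" "bin (m div 2) = bin (n div 2)"
      by (auto simp: bin.simps[of m] bin.simps[of n])
    with 1(1) False have "m div 2 = n div 2" by blast
    with \<open>m mod 2 = n mod 2\<close> show ?thesis by (metis div_mult_mod_eq)
  qed
qed

lemma bin_letters: "l \<in> set (bin n) \<Longrightarrow> l \<le> 2"
proof (induction n rule: bin.induct)
  case (1 n)
  then show ?case by (subst (asm) (2) bin.simps) (auto split: if_splits)
qed

definition stop :: "word \<Rightarrow> bool" where
  "stop w \<longleftrightarrow> (case w of [] \<Rightarrow> True | l # _ \<Rightarrow> l > 2)"

lemma stop_simps [simp]: "stop []" "stop (l # w) \<longleftrightarrow> l > 2"
  by (auto simp: stop_def)

lemma bin_append_inj:
  assumes "bin m @ v = bin n @ w" "stop v" "stop w"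
  shows "m = n \<and> v = w"
proof -
  have tw: "takeWhile (\<lambda>l. l \<le> 2) (bin k @ x) = bin k" if "stop x" for k x
    using that by (subst takeWhile_append2) (auto simp: bin_letters stop_def split: list.splits)
  from tw[of v m] tw[of w n] assms have "bin m = bin n" by simp
  with assms bin_inj show ?thesis by fastforce
qed

lemma stop_hd: "v = [] \<or> hd v > 3 \<Longrightarrow> stop v"
  by (cases v) auto

lemma stop_vars: "v = [] \<or> hd v > 3 \<Longrightarrow> stop (concat (map (\<lambda>i. 3 # bin i) vs) @ v)"
  by (cases vs) (auto simp: stop_hd)

lemma enc_vars_inj:
  assumes "concat (map (\<lambda>i. 3 # bin i) vs) @ v = concat (map (\<lambda>i. 3 # bin i) ws) @ w"
    and v: "v = [] \<or> hd v > 3" and w: "w = [] \<or> hd w > 3"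
  shows "vs = ws \<and> v = w"
  using assms(1)
proof (induction vs arbitrary: ws)
  case Nil
  with v show ?case by (cases ws) auto
next
  case (Cons i vs)
  show ?case
  proof (cases ws)
    case Nil
    with Cons.prems w show ?thesis by auto
  next
    case ws: (Cons j ws')
    have "bin i @ (concat (map (\<lambda>i. 3 # bin i) vs) @ v)
        = bin j @ (concat (map (\<lambda>i. 3 # bin i) ws') @ w)"
      using Cons.prems ws by simp
    from bin_append_inj[OF this stop_vars[OF v] stop_vars[OF w]]
    have "i = j"
      and rest: "concat (map (\<lambda>i. 3 # bin i) vs) @ v = concat (map (\<lambda>i. 3 # bin i) ws') @ w"
      by blast+
    with Cons.IH[OF rest] ws show ?thesis by blast
  qed
qed

lemma enc_atom_inj:
  assumes eq: "enc_atom A @ v = enc_atom B @ w"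
    and v: "v = [] \<or> hd v > 3" and w: "w = [] \<or> hd w > 3"
  shows "A = B \<and> v = w"
proof (cases A)
  case A: (Rel r vs)
  with eq obtain r' vs' where B: "B = Rel r' vs'" by (cases B) auto
  have "bin r @ (concat (map (\<lambda>i. 3 # bin i) vs) @ v)
      = bin r' @ (concat (map (\<lambda>i. 3 # bin i) vs') @ w)"
    using eq A B by simp
  from bin_append_inj[OF this stop_vars[OF v] stop_vars[OF w]]
  have "r = r'"
    and vs: "concat (map (\<lambda>i. 3 # bin i) vs) @ v = concat (map (\<lambda>i. 3 # bin i) vs') @ w"
    by blast+
  with enc_vars_inj[OF vs v w] A B show ?thesis by blast
next
  case A: (Equal i j)
  with eq obtain i' j' where B: "B = Equal i' j'" by (cases B) auto
  have "bin i @ (3 # bin j @ v) = bin i' @ (3 # bin j' @ w)"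
    using eq A B by simp
  from bin_append_inj[OF this] have "i = i'" and j: "bin j @ v = bin j' @ w"
    by simp_all
  with bin_append_inj[OF j stop_hd[OF v] stop_hd[OF w]] A B show ?thesis by simp
next
  case A: (Empty i)
  with eq obtain i' where B: "B = Empty i'" by (cases B) auto
  have "bin i @ v = bin i' @ w"
    using eq A B by simp
  from bin_append_inj[OF this stop_hd[OF v] stop_hd[OF w]] A B
  show ?thesis by simp
qed

lemma hd_atoms: "hd (concat (map enc_atom \<phi>) @ 7 # v) > 3"
proof (cases \<phi>)
  case (Cons A \<psi>)
  then show ?thesis by (cases A) auto
qed simp

lemma enc_atoms_inj:
  assumes "concat (map enc_atom \<phi>) @ 7 # v = concat (map enc_atom \<psi>) @ 7 # w"
  shows "\<phi> = \<psi> \<and> v = w"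
  using assms
proof (induction \<phi> arbitrary: \<psi>)
  case \<phi>: Nil
  show ?case
  proof (cases \<psi>)
    case (Cons B \<psi>')
    with \<phi> show ?thesis by (cases B) auto
  qed (use \<phi> in simp)
next
  case (Cons A \<phi>)
  show ?case
  proof (cases \<psi>)
    case Nil
    with Cons.prems show ?thesis by (cases A) auto
  next
    case \<psi>: (Cons B \<psi>')
    have "enc_atom A @ (concat (map enc_atom \<phi>) @ 7 # v)
        = enc_atom B @ (concat (map enc_atom \<psi>') @ 7 # w)"
      using Cons.prems \<psi> by simp
    from enc_atom_inj[OF this disjI2[OF hd_atoms] disjI2[OF hd_atoms]]
    have "A = B"
      and rest: "concat (map enc_atom \<phi>) @ 7 # v = concat (map enc_atom \<psi>') @ 7 # w"
      by blast+
    with Cons.IH[OF rest] \<psi> show ?thesis by blast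
  qed
qed

lemma enc_rat_inj:
  assumes eq: "enc_rat u = enc_rat v"
  shows "u = v"
proof -
  obtain p q where u: "quotient_of u = (p, q)" by (cases "quotient_of u")
  obtain p' q' where v: "quotient_of v = (p', q')" by (cases "quotient_of v")
  have pos: "q > 0" "q' > 0" using u v quotient_of_denom_pos by auto
  have no8: "8 # x \<noteq> bin k @ 3 # y" for k x y
    using bin_letters[of 8 k] by (cases "bin k") auto
  have sgn: "p < 0 \<longleftrightarrow> p' < 0"
    using eq no8 no8[symmetric] unfolding enc_rat_def u v by (auto split: if_splits)
  with eq have "bin (nat \<bar>p\<bar>) @ (3 # bin (nat q)) = bin (nat \<bar>p'\<bar>) @ (3 # bin (nat q'))"
    unfolding enc_rat_def u v by (auto split: if_splits)
  from bin_append_inj[OF this] have "nat \<bar>p\<bar> = nat \<bar>p'\<bar>" "nat q = nat q'"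
    using bin_inj[of "nat q" "nat q'"] by simp_all
  with sgn pos have "p = p'" "q = q'" by linarith+
  with u v show "u = v" by (simp add: quotient_of_inject)
qed

lemma inj_enc_instance: "inj enc_instance"
proof (rule injI)
  fix x y :: vcsp_instance
  assume eq: "enc_instance x = enc_instance y"
  obtain n \<phi> u where x: "x = (n, \<phi>, u)" by (cases x)
  obtain m \<psi> v where y: "y = (m, \<psi>, v)" by (cases y)
  have "bin n @ (concat (map enc_atom \<phi>) @ 7 # enc_rat u)
      = bin m @ (concat (map enc_atom \<psi>) @ 7 # enc_rat v)"
    using eq x y by simp
  from bin_append_inj[OF this] have "n = m"
    "concat (map enc_atom \<phi>) @ 7 # enc_rat u = concat (map enc_atom \<psi>) @ 7 # enc_rat v"
    by (simp_all add: stop_hd hd_atoms)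
  with enc_atoms_inj[OF this(2)] enc_rat_inj x y show "x = y" by simp
qed

end

theory Submission
  imports Defs
begin

text \<open>
  By oligomorphicity, the relations in \<open>\<langle>\<Gamma>\<rangle>\<close> take finitely many values, so infima are attained and the
  finite values have a common denominator.  By induction on the closure, every relation \<open>R\<close> in
  \<open>\<langle>\<Gamma>\<rangle>\<close> has a gadget: finitely many \<open>\<Gamma>\<close>-expressions \<open>e\<close> with exponents \<open>p\<close> and integers \<open>z\<close> such
  that for large \<open>N\<close> the minimum over the auxiliary variables of the sum of all \<open>N\<^sup>p (e - z)\<close> is
  \<open>s N\<^sup>h\<^sup>+\<^sup>1 R + O(N\<^sup>h)\<close> where \<open>R\<close> is finite, and at least of order \<open>N\<^sup>h\<^sup>+\<^sup>2\<close> elsewhere.  Thus \<open>N\<close> acts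
  as an infinitely large number.  Replacing \<open>N\<close> by \<open>N\<^sup>2\<close> makes room between the
  orders of magnitude; this is what allows \<open>Opt\<close>, where the current level turns into a hard constraint,
  and \<open>Feas\<close>, where it turns into an error.

  The reduction takes \<open>N\<close> linear in the length of the instance, writes \<open>N\<^sup>p\<close> copies of each \<open>e\<close> for every
  atom, and collects the integers \<open>z\<close> in the threshold.  Since \<open>s\<close> times any finite cost is an integer,
  the given threshold \<open>u\<close> only matters through \<open>\<lfloor>s u\<rfloor>\<close>, clamped to the range between \<open>-N\<close> and \<open>N\<close>.  This
  makes all numbers except the names of variables small enough for unary arithmetic; the division
  is done by repeated binary subtraction.
\<close>

section \<open>A stack language and its compilation to Turing machines\<close>

text \<open>An instance offers only one sum of atoms and one threshold, so \<open>Feas\<close> and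
  \<open>Opt\<close> cannot be applied to a single summand. Infima are harmless, because the
  question minimises over auxiliary variables anyway. \<open>Opt\<close> has to become a penalty: a
  non-optimal tuple costs at least one unit \<open>1/s\<close> too much, and this unit must outweigh
  all that the rest of the instance can gain. That gain is proportional to the number of atoms, so
  no fixed weight suffices; nested uses of \<open>Opt\<close> then call for several powers of
  \<open>N\<close>. Their exponents depend only on the relation, so \<open>N^p\<close> copies with
  \<open>N\<close> linear in the input stay polynomial. Likewise nothing can be divided by a
  denominator; instead everything is multiplied by it, which is the role of \<open>s\<close>.
  Clamping the threshold is harmless because a finite total cost times \<open>s\<close> is an
  integer of absolute value below \<open>N\<close>.\<close>

definition head0 :: "word \<Rightarrow> nat" where
  "head0 w = (if w = [] then 0 else hd w)"

lemma head0_simps [simp]: "head0 [] = 0" "head0 (a # w) = a"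
  by (auto simp: head0_def)

text \<open>Every register is a stack, so that one tape with its head on the top letter can hold it.
  Tests inspect the top letter only.\<close>

datatype (regs: 'r) com =
    Skip
  | Push 'r nat
  | Cpy 'r 'r
  | Pop 'r
  | Seq "'r com" "'r com" (infixr ";;" 60)
  | Cond 'r "nat set" "'r com" "'r com"
  | While 'r "nat set" "'r com"

lemma finite_regs: "finite (regs c)"
  by (induction c) auto

fun letters :: "'r com \<Rightarrow> nat set" where
  "letters (Push r a) = {a}"
| "letters (c ;; d) = letters c \<union> letters d"
| "letters (Cond r S c d) = letters c \<union> letters d"
| "letters (While r S c) = letters c"
| "letters _ = {}"

type_synonym 'r store = "'r \<Rightarrow> word"

text \<open>\<open>exec_mono\<close> makes the time an upper bound, so that running times can be
  rounded up freely. The surcharge of 2 pays for the branch and the jump that \<open>comp\<close>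
  inserts.\<close>

inductive exec :: "'r com \<Rightarrow> 'r store \<Rightarrow> nat \<Rightarrow> 'r store \<Rightarrow> bool" where
  exec_Skip: "exec Skip s 0 s"
| exec_Push: "exec (Push r a) s 1 (s(r := a # s r))"
| exec_Cpy: "\<lbrakk>r \<noteq> q; s r \<noteq> []\<rbrakk> \<Longrightarrow> exec (Cpy r q) s 1 (s(q := hd (s r) # s q))"
| exec_Pop: "s r \<noteq> [] \<Longrightarrow> exec (Pop r) s 1 (s(r := tl (s r)))"
| exec_Seq: "\<lbrakk>exec c s t s'; exec d s' t' s''\<rbrakk> \<Longrightarrow> exec (c ;; d) s (t + t') s''"
| exec_CondT: "\<lbrakk>head0 (s r) \<in> S; exec c s t s'\<rbrakk> \<Longrightarrow> exec (Cond r S c d) s (t + 2) s'"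
| exec_CondF: "\<lbrakk>head0 (s r) \<notin> S; exec d s t s'\<rbrakk> \<Longrightarrow> exec (Cond r S c d) s (t + 2) s'"
| exec_WhileF: "head0 (s r) \<notin> S \<Longrightarrow> exec (While r S c) s 1 s"
| exec_WhileT: "\<lbrakk>head0 (s r) \<in> S; exec c s t s'; exec (While r S c) s' t' s''\<rbrakk>
    \<Longrightarrow> exec (While r S c) s (t + t' + 2) s''"
| exec_mono: "\<lbrakk>exec c s t s'; t \<le> t'\<rbrakk> \<Longrightarrow> exec c s t' s'"

section \<open>Instructions with jumps, and the compilation of commands into them\<close>

datatype 'r instr =
    IPush 'r nat
  | ICpy 'r 'r
  | IPop 'r
  | IOut 'r
  | IBr 'r "nat set" nat

type_synonym 'r iconfig = "nat \<times> 'r store \<times> word"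

inductive istep :: "'r instr list \<Rightarrow> 'r iconfig \<Rightarrow> 'r iconfig \<Rightarrow> bool" for P where
  istep_Push: "\<lbrakk>i < length P; P ! i = IPush r a\<rbrakk> \<Longrightarrow> istep P (i, s, w) (Suc i, s(r := a # s r), w)"
| istep_Cpy: "\<lbrakk>i < length P; P ! i = ICpy r q; r \<noteq> q; s r \<noteq> []\<rbrakk>
    \<Longrightarrow> istep P (i, s, w) (Suc i, s(q := hd (s r) # s q), w)"
| istep_Pop: "\<lbrakk>i < length P; P ! i = IPop r; s r \<noteq> []\<rbrakk>
    \<Longrightarrow> istep P (i, s, w) (Suc i, s(r := tl (s r)), w)"
| istep_Out: "\<lbrakk>i < length P; P ! i = IOut r; s r \<noteq> []\<rbrakk>
    \<Longrightarrow> istep P (i, s, w) (Suc i, s, w @ [hd (s r)])"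
| istep_Br: "\<lbrakk>i < length P; P ! i = IBr r S j\<rbrakk>
    \<Longrightarrow> istep P (i, s, w) (if head0 (s r) \<in> S then Suc i else j, s, w)"

definition reach :: "'r instr list \<Rightarrow> nat \<Rightarrow> 'r iconfig \<Rightarrow> 'r iconfig \<Rightarrow> bool" where
  "reach P t x y \<longleftrightarrow> (\<exists>n\<le>t. (istep P ^^ n) x y)"

lemma reach_refl: "reach P t x x"
  unfolding reach_def by (rule exI[of _ 0]) auto

lemma reach_step: "istep P x y \<Longrightarrow> reach P 1 x y"
  unfolding reach_def by (rule exI[of _ 1]) (auto simp del: One_nat_def)

lemma reach_trans: "reach P t x y \<Longrightarrow> reach P t' y z \<Longrightarrow> reach P (t + t') x z"
  unfolding reach_def
  by (meson add_mono_thms_linordered_semiring(1) relpowp_trans)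

lemma reach_mono: "reach P t x y \<Longrightarrow> t \<le> t' \<Longrightarrow> reach P t' x y"
  unfolding reach_def by (meson order_trans)

fun size_com :: "'r com \<Rightarrow> nat" where
  "size_com Skip = 0"
| "size_com (c ;; d) = size_com c + size_com d"
| "size_com (Cond r S c d) = size_com c + size_com d + 2"
| "size_com (While r S c) = size_com c + 2"
| "size_com _ = 1"

text \<open>Jumps are absolute, so the address \<open>i\<close> of the first instruction is a
  parameter. \<open>IBr r {} j\<close> jumps unconditionally, as no letter lies in the empty
  set.\<close>

fun comp :: "nat \<Rightarrow> 'r com \<Rightarrow> 'r instr list" where
  "comp i Skip = []"
| "comp i (Push r a) = [IPush r a]"
| "comp i (Cpy r q) = [ICpy r q]"
| "comp i (Pop r) = [IPop r]"
| "comp i (c ;; d) = comp i c @ comp (i + size_com c) d"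
| "comp i (Cond r S c d) = IBr r S (i + size_com c + 2) # comp (Suc i) c
     @ IBr r {} (i + size_com c + size_com d + 2) # comp (i + size_com c + 2) d"
| "comp i (While r S c) = IBr r S (i + size_com c + 2) # comp (Suc i) c @ [IBr r {} i]"

lemma length_comp [simp]: "length (comp i c) = size_com c"
  by (induction c arbitrary: i) auto

fun code_at :: "'r instr list \<Rightarrow> nat \<Rightarrow> 'r instr list \<Rightarrow> bool" where
  "code_at P i [] \<longleftrightarrow> True"
| "code_at P i (x # xs) \<longleftrightarrow> i < length P \<and> P ! i = x \<and> code_at P (Suc i) xs"

lemma code_at_append [simp]:
  "code_at P i (xs @ ys) \<longleftrightarrow> code_at P i xs \<and> code_at P (i + length xs) ys"
  by (induction xs arbitrary: i) auto

lemma code_at_self: "code_at (xs @ ys @ zs) (length xs) ys"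
proof (induction ys arbitrary: xs)
  case (Cons y ys)
  from Cons.IH[of "xs @ [y]"] show ?case by (simp add: nth_append)
qed simp

lemma istep_BrT: "\<lbrakk>i < length P; P ! i = IBr r S j; head0 (s r) \<in> S\<rbrakk> \<Longrightarrow> istep P (i, s, w) (Suc i, s, w)"
  using istep_Br[of i P r S j s w] by simp

lemma istep_BrF: "\<lbrakk>i < length P; P ! i = IBr r S j; head0 (s r) \<notin> S\<rbrakk> \<Longrightarrow> istep P (i, s, w) (j, s, w)"
  using istep_Br[of i P r S j s w] by simp

lemma comp_correct:
  "exec c s t s' \<Longrightarrow> code_at P i (comp i c) \<Longrightarrow> reach P t (i, s, w) (i + size_com c, s', w)"
proof (induction arbitrary: i rule: exec.induct)
  case (exec_Skip s)
  then show ?case by (simp add: reach_refl)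
next
  case (exec_Push r a s)
  then show ?case using reach_step[OF istep_Push[of i P r a s w]] by (simp add: fun_upd_def)
next
  case (exec_Cpy r q s)
  then show ?case using reach_step[OF istep_Cpy[of i P r q s w]] by (simp add: fun_upd_def)
next
  case (exec_Pop s r)
  then show ?case using reach_step[OF istep_Pop[of i P r s w]] by (simp add: fun_upd_def)
next
  case (exec_Seq c s t s' d t' s'')
  have "reach P t (i, s, w) (i + size_com c, s', w)"
    "reach P t' (i + size_com c, s', w) (i + size_com c + size_com d, s'', w)"
    using exec_Seq by auto
  from reach_trans[OF this] show ?case by (simp add: add.assoc)
next
  case (exec_CondT s r S c t s' d)
  have "istep P (i, s, w) (Suc i, s, w)"
    using exec_CondT by (auto intro: istep_BrT)
  moreover have "reach P t (Suc i, s, w) (Suc i + size_com c, s', w)"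
    using exec_CondT.IH[of "Suc i"] exec_CondT.prems by simp
  moreover have "istep P (Suc i + size_com c, s', w) (i + size_com (Cond r S c d), s', w)"
    using exec_CondT.prems by (auto intro!: istep_BrF)
  ultimately have "reach P (1 + t + 1) (i, s, w) (i + size_com (Cond r S c d), s', w)"
    by (meson reach_step reach_trans)
  then show ?case by (rule reach_mono) simp
next
  case (exec_CondF s r S d t s' c)
  have "istep P (i, s, w) (i + size_com c + 2, s, w)"
    using exec_CondF by (auto intro: istep_BrF)
  moreover have "reach P t (i + size_com c + 2, s, w) (i + size_com c + 2 + size_com d, s', w)"
    using exec_CondF.IH[of "i + size_com c + 2"] exec_CondF.prems by simp
  ultimately have "reach P (1 + t) (i, s, w) (i + size_com c + 2 + size_com d, s', w)"
    by (meson reach_step reach_trans)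
  then have "reach P (t + 2) (i, s, w) (i + size_com c + 2 + size_com d, s', w)"
    by (rule reach_mono) simp
  then show ?case by (simp add: algebra_simps)
next
  case (exec_WhileF s r S c)
  then show ?case by (auto intro!: reach_step istep_BrF simp del: One_nat_def)
next
  case (exec_WhileT s r S c t s' t' s'')
  have "istep P (i, s, w) (Suc i, s, w)"
    using exec_WhileT by (auto intro: istep_BrT)
  moreover have "reach P t (Suc i, s, w) (Suc i + size_com c, s', w)"
    using exec_WhileT.IH(1)[of "Suc i"] exec_WhileT.prems by simp
  moreover have "istep P (Suc i + size_com c, s', w) (i, s', w)"
    using exec_WhileT.prems by (auto intro!: istep_BrF)
  moreover have "reach P t' (i, s', w) (i + size_com (While r S c), s'', w)"
    using exec_WhileT.IH(2)[of i] exec_WhileT.prems by simp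
  ultimately have "reach P (1 + t + 1 + t') (i, s, w) (i + size_com (While r S c), s'', w)"
    by (meson reach_step reach_trans)
  then show ?case by (rule reach_mono) simp
next
  case (exec_mono c s t s' t')
  then show ?case by (meson reach_mono)
qed

text \<open>A stack grows to the left, whereas the output has to start in cell 0. Therefore the
  result is finally written letter by letter on a separate tape whose head moves to the
  right.\<close>

definition out_prog :: "'r com \<Rightarrow> 'r \<Rightarrow> 'r instr list" where
  "out_prog c r = comp 0 c @ [IBr r {1..8} (size_com c + 4), IOut r, IPop r, IBr r {} (size_com c)]"

lemma out_prog_correct:
  assumes "exec c s t s'" and "set (s' r) \<subseteq> {1..8}"
  shows "\<exists>s''. reach (out_prog c r) (t + 4 * length (s' r) + 1) (0, s, [])
    (length (out_prog c r), s'', s' r)"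
proof -
  let ?P = "out_prog c r" and ?m = "size_com c"
  have len: "length ?P = ?m + 4" by (simp add: out_prog_def)
  have P: "?P ! ?m = IBr r {1..8} (?m + 4)" "?P ! Suc ?m = IOut r"
    "?P ! Suc (Suc ?m) = IPop r" "?P ! Suc (Suc (Suc ?m)) = IBr r {} ?m"
    unfolding out_prog_def by (simp_all add: nth_append)
  have loop: "\<exists>s''. reach ?P (4 * length x + 1) (?m, s, w) (?m + 4, s'', w @ x)"
    if "s r = x" "set x \<subseteq> {1..8}" for s w x
    using that
  proof (induction x arbitrary: s w)
    case Nil
    have "istep ?P (?m, s, w) (?m + 4, s, w)"
      by (rule istep_BrF) (use P len Nil in auto)
    then show ?case using reach_step by fastforce
  next
    case (Cons a x)
    have "istep ?P (?m, s, w) (Suc ?m, s, w)"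
      by (rule istep_BrT) (use P len Cons in auto)
    moreover have "istep ?P (Suc ?m, s, w) (Suc (Suc ?m), s, w @ [a])"
      using istep_Out[of "Suc ?m" ?P r s w] P len Cons by auto
    moreover have "istep ?P (Suc (Suc ?m), s, w @ [a]) (Suc (Suc (Suc ?m)), s(r := x), w @ [a])"
      using istep_Pop[of "Suc (Suc ?m)" ?P r s "w @ [a]"] P len Cons by auto
    moreover have "istep ?P (Suc (Suc (Suc ?m)), s(r := x), w @ [a]) (?m, s(r := x), w @ [a])"
      by (rule istep_BrF) (use P len in auto)
    ultimately have 1: "reach ?P (1 + 1 + 1 + 1) (?m, s, w) (?m, s(r := x), w @ [a])"
      by (meson reach_step reach_trans)
    from Cons.IH[of "s(r := x)" "w @ [a]"] Cons.prems
    obtain s'' where "reach ?P (4 * length x + 1) (?m, s(r := x), w @ [a]) (?m + 4, s'', (w @ [a]) @ x)"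
      by (auto simp: fun_upd_def)
    from reach_trans[OF 1 this] have "reach ?P (4 * length (a # x) + 1) (?m, s, w) (?m + 4, s'', w @ a # x)"
      by (auto elim!: reach_mono)
    then show ?case by blast
  qed
  have "code_at ?P 0 (comp 0 c)"
    using code_at_self[of "[]" "comp 0 c"] by (simp add: out_prog_def)
  from comp_correct[OF assms(1) this, of "[]"] have 1: "reach ?P t (0, s, []) (?m, s', [])" by simp
  from loop[of s' "s' r" "[]"] assms(2) obtain s''
    where "reach ?P (4 * length (s' r) + 1) (?m, s', []) (?m + 4, s'', s' r)" by auto
  from reach_trans[OF 1 this] show ?thesis unfolding len by (auto simp: add.assoc)
qed


section \<open>Simulation of instructions by a Turing machine\<close>

fun moved :: "'r instr \<Rightarrow> 'r option" where
  "moved (IPush r a) = Some r"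
| "moved (ICpy r q) = Some q"
| "moved _ = None"

locale machine =
  fixes idx :: "'r \<Rightarrow> nat" and k :: nat and P :: "'r instr list"
  assumes inj: "inj idx" and kpos: "k > 0"
    and bound: "\<And>x. x \<in> set P \<Longrightarrow> set_instr x \<subseteq> {r. idx r < k}"
    and push_ok: "\<And>r a. IPush r a \<in> set P \<Longrightarrow> a \<in> {1..8}"
begin

text \<open>Every instruction takes two machine steps: in the first one, the head of the tape that is
  pushed to moves to the left; the rest happens in the second one.\<close>

definition phase0 :: "'r instr \<Rightarrow> nat list \<Rightarrow> nat \<Rightarrow> nat \<times> dir" where
  "phase0 x rs i = (rs ! i, if Some i = map_option idx (moved x) then ToLeft else Stay)"

fun phase1 :: "'r instr \<Rightarrow> nat list \<Rightarrow> nat \<Rightarrow> nat \<times> dir" where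
  "phase1 (IPush r a) rs i = (if i = idx r then a else rs ! i, Stay)"
| "phase1 (ICpy r q) rs i = (if i = idx q then rs ! idx r else rs ! i, Stay)"
| "phase1 (IPop r) rs i = (if i = idx r then (0, ToRight) else (rs ! i, Stay))"
| "phase1 (IOut r) rs i = (if i = k then (rs ! idx r, ToRight) else (rs ! i, Stay))"
| "phase1 (IBr r S j) rs i = (rs ! i, Stay)"

fun goto :: "'r instr \<Rightarrow> nat list \<Rightarrow> nat \<Rightarrow> nat" where
  "goto (IBr r S j) rs i = (if rs ! idx r \<in> S then Suc i else j)"
| "goto _ rs i = Suc i"

text \<open>State \<open>2 * i\<close> begins instruction \<open>i\<close> and state
  \<open>2 * i + 1\<close> completes it; at \<open>2 * length P\<close> the machine halts. Admitting
  only letters up to 8 keeps the program finite.\<close>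

definition M :: tm where
  "M = \<lparr>num_tapes = Suc k, program = (\<lambda>(q, rs).
     if length rs = Suc k \<and> set rs \<subseteq> {..8} \<and> q < 2 * length P
     then Some (let x = P ! (q div 2) in
       if even q then (Suc q, map (phase0 x rs) [0..<Suc k])
       else (2 * goto x rs (q div 2), map (phase1 x rs) [0..<Suc k]))
     else None)\<rparr>"

lemma turing_machine_M: "turing_machine M"
proof -
  have "dom (program M) \<subseteq> {..<2 * length P} \<times> {rs. set rs \<subseteq> {..8} \<and> length rs = Suc k}"
    by (auto simp: M_def split: if_splits)
  moreover have "finite ({..<2 * length P} \<times> {rs :: nat list. set rs \<subseteq> {..8} \<and> length rs = Suc k})"
    by (intro finite_cartesian_product finite_lists_length_eq) auto
  ultimately have "finite (dom (program M))" by (rule finite_subset)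
  then show ?thesis unfolding turing_machine_def
    by (auto simp: M_def Let_def split: if_splits)
qed

text \<open>The head is on the top of the stack, and the stack extends to the right of it.\<close>

definition stack_tape :: "word \<Rightarrow> tape \<Rightarrow> bool" where
  "stack_tape w t \<longleftrightarrow> (\<forall>i. fst t i = word_tape w (i - snd t))"

definition out_tape :: "word \<Rightarrow> tape \<Rightarrow> bool" where
  "out_tape w t \<longleftrightarrow> fst t = word_tape w \<and> snd t = int (length w)"

text \<open>Tapes may have an index that belongs to no register. They stay blank, which is the
  representation of an empty stack.\<close>

definition flat :: "'r store \<Rightarrow> nat \<Rightarrow> word" where
  "flat s i = (if i \<in> range idx then s (inv idx i) else [])"

lemma flat_idx [simp]: "flat s (idx r) = s r"
  using inj by (simp add: flat_def)

lemma flat_upd: "flat (s(r := x)) = (flat s)(idx r := x)"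
  using inj by (auto simp: flat_def fun_eq_iff inv_f_eq)

definition crel :: "'r store \<Rightarrow> word \<Rightarrow> tape list \<Rightarrow> bool" where
  "crel s w ts \<longleftrightarrow> length ts = Suc k \<and> (\<forall>i<k. stack_tape (flat s i) (ts ! i)) \<and> out_tape w (ts ! k)"

definition good :: "'r store \<Rightarrow> bool" where
  "good s \<longleftrightarrow> (\<forall>r. set (s r) \<subseteq> {1..8})"

text \<open>This is why \<open>head0\<close> is 0 on the empty stack: the head then stands on a
  blank.\<close>

lemma read_stack: "stack_tape w t \<Longrightarrow> read_tape t = head0 w"
  by (cases t) (auto simp: stack_tape_def word_tape_def head0_def hd_conv_nth)

lemma read_out: "out_tape w t \<Longrightarrow> read_tape t = 0"
  by (cases t) (auto simp: out_tape_def word_tape_def)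

lemma act_stay [simp]: "act_tape (read_tape t, Stay) t = t"
  by (cases t) auto

lemma act_push: "stack_tape w t \<Longrightarrow>
    stack_tape (a # w) (act_tape (a, Stay) (act_tape (read_tape t, ToLeft) t))"
proof -
  assume "stack_tape w t"
  moreover have "word_tape (a # w) (i + 1) = (if i = -1 then a else word_tape w i)" for i
    by (auto simp: word_tape_def nth_Cons' nat_add_distrib)
  from this[of "i - 1" for i] have "word_tape (a # w) i = (if i = 0 then a else word_tape w (i - 1))" for i
    by simp
  ultimately show ?thesis by (cases t) (auto simp: stack_tape_def)
qed

lemma act_pop: "stack_tape w t \<Longrightarrow> w \<noteq> [] \<Longrightarrow> stack_tape (tl w) (act_tape (0, ToRight) t)"
  by (cases t) (auto simp: stack_tape_def word_tape_def nth_tl nat_diff_distrib' Suc_nat_eq_nat_zadd1)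

lemma act_out: "out_tape w t \<Longrightarrow> out_tape (w @ [a]) (act_tape (a, ToRight) t)"
  by (cases t) (auto simp: out_tape_def word_tape_def nth_append fun_eq_iff)

lemma read_crel:
  assumes "crel s w ts" "good s"
  shows "length (map read_tape ts) = Suc k" "set (map read_tape ts) \<subseteq> {..8}"
    "\<And>i. i < k \<Longrightarrow> map read_tape ts ! i = head0 (flat s i)"
proof -
  show 1: "length (map read_tape ts) = Suc k" using assms by (simp add: crel_def)
  show 2: "map read_tape ts ! i = head0 (flat s i)" if "i < k" for i
    using that assms read_stack by (auto simp: crel_def)
  have h: "head0 (flat s i) \<le> 8" for i
    using assms(2) by (force simp: good_def flat_def head0_def dest: hd_in_set)
  have "map read_tape ts ! i \<le> 8" if "i < Suc k" for i
    using that 2[of i] h[of i] read_out[of w "ts ! k"] assms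
    by (cases "i = k") (auto simp: crel_def simp del: read_tape.simps)
  with 1 show "set (map read_tape ts) \<subseteq> {..8}" by (metis atMost_iff in_set_conv_nth subsetI)
qed

lemma step_M:
  assumes "length ts = Suc k" "set (map read_tape ts) \<subseteq> {..8}" "q < 2 * length P"
    "(q', f) = (let x = P ! (q div 2); rs = map read_tape ts in
       if even q then (Suc q, phase0 x rs) else (2 * goto x rs (q div 2), phase1 x rs))"
  shows "((q, ts), (q', map (\<lambda>i. act_tape (f i) (ts ! i)) [0..<Suc k])) \<in> steps M"
proof -
  have "program M (q, map read_tape ts) = Some (q', map f [0..<Suc k])"
    using assms by (auto simp: M_def Let_def split: if_splits)
  moreover have "map2 act_tape (map f [0..<Suc k]) ts = map (\<lambda>i. act_tape (f i) (ts ! i)) [0..<Suc k]"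
    using assms(1) by (intro nth_equalityI) (auto simp del: upt_Suc)
  ultimately show ?thesis unfolding steps_def
    by (smt (verit, ccfv_threshold) CollectI)
qed

text \<open>After the first step, only the tape that is pushed to can show another letter, namely a
  blank. The second step takes the letter to be copied or tested from a different tape and so still
  sees the right one; for this, \<open>Cpy\<close> demands two different registers.\<close>

lemma simulate:
  assumes "istep P (i, s, w) (i', s', w')" "crel s w ts" "good s"
  shows "good s' \<and> (\<exists>ts'. ((2 * i, ts), (2 * i', ts')) \<in> steps M ^^ 2 \<and> crel s' w' ts')"
proof -
  have i: "i < length P" using assms(1) by cases auto
  define x where "x = P ! i"
  have x: "x \<in> set P" using i by (simp add: x_def)
  define rs where "rs = map read_tape ts"
  define ts1 where "ts1 = map (\<lambda>j. act_tape (phase0 x rs j) (ts ! j)) [0..<Suc k]"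
  define rs1 where "rs1 = map read_tape ts1"
  define ts2 where "ts2 = map (\<lambda>j. act_tape (phase1 x rs1 j) (ts1 ! j)) [0..<Suc k]"
  note rd = read_crel[OF assms(2,3), folded rs_def]
  have rsk: "rs ! j = read_tape (ts ! j)" if "j < Suc k" for j
    using that rd(1) by (simp add: rs_def)
  have s1: "((2 * i, ts), (Suc (2 * i), ts1)) \<in> steps M"
    unfolding ts1_def
    by (rule step_M) (use rd i in \<open>auto simp: rs_def x_def Let_def\<close>)
  have mv: "j < k" if "Some j = map_option idx (moved x)" for j
    using that bound[OF x] by (cases x) auto
  have ts1: "ts1 ! j = (if Some j = map_option idx (moved x) then act_tape (rs ! j, ToLeft) (ts ! j) else ts ! j)"
    if "j < Suc k" for j
    using that rsk[OF that] by (auto simp: ts1_def phase0_def nth_append simp del: upt_Suc)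
  have rs1: "rs1 ! j = rs ! j" if "j < Suc k" "Some j \<noteq> map_option idx (moved x)" for j
    using that rsk[of j] ts1[of j] by (simp add: rs1_def ts1_def del: upt_Suc)
  have rs1_le: "set rs1 \<subseteq> {..8}"
  proof -
    have "rs1 ! j \<le> 8" if j: "j < Suc k" for j
    proof (cases "Some j = map_option idx (moved x)")
      \<comment> \<open>The cell to the left of the top of a stack is blank.\<close>
      case True
      with mv have "j < k" by auto
      with assms(2) have "stack_tape (flat s j) (ts ! j)" by (auto simp: crel_def)
      moreover have "rs1 ! j = read_tape (act_tape (rs ! j, ToLeft) (ts ! j))"
        using True ts1[OF j] j by (simp add: rs1_def ts1_def del: upt_Suc)
      ultimately have "rs1 ! j = 0"
        by (cases "ts ! j") (auto simp: stack_tape_def word_tape_def)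
      then show ?thesis by simp
    next
      case False
      with rs1[OF j] rd(1,2) j show ?thesis by (metis atMost_iff nth_mem subsetD)
    qed
    then show ?thesis by (auto simp: in_set_conv_nth rs1_def ts1_def simp del: upt_Suc)
  qed
  have s2: "((Suc (2 * i), ts1), (2 * goto x rs1 i, ts2)) \<in> steps M"
    unfolding ts2_def
    by (rule step_M) (use rs1_le i in \<open>auto simp: rs1_def x_def Let_def ts1_def simp del: upt_Suc\<close>)
  from s1 s2 have "((2 * i, ts), (2 * goto x rs1 i, ts2)) \<in> steps M ^^ 2"
    by (auto simp: numeral_2_eq_2)
  moreover have ts2: "ts2 ! j = act_tape (phase1 x rs1 j) (ts1 ! j)" if "j < Suc k" for j
    using that by (simp add: ts2_def del: upt_Suc)
  have len2: "length ts2 = Suc k" by (simp add: ts2_def)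
  have st: "stack_tape (flat s j) (ts ! j)" if "j < k" for j
    using that assms(2) by (auto simp: crel_def)
  have ot: "out_tape w (ts ! k)" using assms(2) by (auto simp: crel_def)
  have untouched: "ts2 ! j = ts ! j"
    if "j < Suc k" "Some j \<noteq> map_option idx (moved x)" "phase1 x rs1 j = (rs1 ! j, Stay)" for j
    using ts2[OF that(1)] ts1[OF that(1)] rs1[OF that(1,2)] rsk[OF that(1)] that by simp
  from assms(1) have "good s' \<and> i' = goto x rs1 i \<and> crel s' w' ts2"
  proof cases
    case (istep_Push r a)
    have r: "idx r < k" and a: "a \<in> {1..8}"
      using bound[OF x] push_ok x istep_Push by (auto simp: x_def)
    have "stack_tape (a # s r) (ts2 ! idx r)"
      using act_push[OF st[OF r], of a] ts2[of "idx r"] ts1[of "idx r"] rsk[of "idx r"] r istep_Push(5)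
      by (simp add: x_def)
    moreover have "ts2 ! j = ts ! j" if "j < Suc k" "j \<noteq> idx r" for j
      by (rule untouched) (use that istep_Push(5) in \<open>auto simp: x_def\<close>)
    ultimately show ?thesis
      using istep_Push a assms(3) st ot len2 r by (auto simp: good_def crel_def x_def flat_upd)
  next
    case (istep_Cpy r q)
    have r: "idx r < k" "idx q < k" using bound[OF x] istep_Cpy by (auto simp: x_def)
    have "idx r \<noteq> idx q" using istep_Cpy inj by (auto dest: injD)
    then have "rs1 ! idx r = hd (s r)"
      using rs1[of "idx r"] r rd(3)[of "idx r"] istep_Cpy by (simp add: x_def head0_def)
    then have "stack_tape (hd (s r) # s q) (ts2 ! idx q)"
      using act_push[OF st[OF r(2)], of "hd (s r)"] ts2[of "idx q"] ts1[of "idx q"] rsk[of "idx q"] r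
        istep_Cpy(5)
      by (simp add: x_def)
    moreover have "ts2 ! j = ts ! j" if "j < Suc k" "j \<noteq> idx q" for j
      by (rule untouched) (use that istep_Cpy(5) in \<open>auto simp: x_def\<close>)
    moreover have "hd (s r) \<in> {1..8}" using assms(3) istep_Cpy by (metis good_def hd_in_set subsetD)
    ultimately show ?thesis
      using istep_Cpy assms(3) st ot len2 r by (auto simp: good_def crel_def x_def flat_upd)
  next
    case (istep_Pop r)
    have r: "idx r < k" using bound[OF x] istep_Pop by (auto simp: x_def)
    have "stack_tape (tl (s r)) (ts2 ! idx r)"
      using act_pop[OF st[OF r]] ts2[of "idx r"] ts1[of "idx r"] r istep_Pop
      by (simp add: x_def)
    moreover have "ts2 ! j = ts ! j" if "j < Suc k" "j \<noteq> idx r" for j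
      by (rule untouched) (use that istep_Pop(5) in \<open>auto simp: x_def\<close>)
    moreover have "set (tl (s r)) \<subseteq> {1..8}" using assms(3) istep_Pop by (meson good_def list.set_sel(2) subset_iff)
    ultimately show ?thesis
      using istep_Pop assms(3) st ot len2 r by (auto simp: good_def crel_def x_def flat_upd)
  next
    case (istep_Out r)
    have r: "idx r < k" using bound[OF x] istep_Out by (auto simp: x_def)
    have "rs1 ! idx r = hd (s r)"
      using rs1[of "idx r"] r rd(3)[of "idx r"] istep_Out by (simp add: x_def head0_def)
    then have "out_tape (w @ [hd (s r)]) (ts2 ! k)"
      using act_out[OF ot, of "hd (s r)"] ts2[of k] ts1[of k] istep_Out
      by (simp add: x_def)
    moreover have "ts2 ! j = ts ! j" if "j < k" for j
      by (rule untouched) (use that istep_Out(5) in \<open>auto simp: x_def\<close>)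
    ultimately show ?thesis
      using istep_Out assms(3) st ot len2 r by (auto simp: good_def crel_def x_def)
  next
    case (istep_Br r S j)
    have r: "idx r < k" using bound[OF x] istep_Br by (auto simp: x_def)
    have "rs1 ! idx r = head0 (s r)"
      using rs1[of "idx r"] r rd(3)[of "idx r"] istep_Br by (simp add: x_def)
    moreover have "ts2 ! j = ts ! j" if "j < Suc k" for j
      by (rule untouched) (use that istep_Br in \<open>auto simp: x_def\<close>)
    ultimately show ?thesis
      using istep_Br assms(3) st ot len2 r by (auto simp: good_def crel_def x_def)
  qed
  ultimately show ?thesis by auto
qed

lemma simulates:
  assumes "(istep P ^^ n) (i, s, w) (i', s', w')" "crel s w ts" "good s"
  shows "good s' \<and> (\<exists>ts'. ((2 * i, ts), (2 * i', ts')) \<in> steps M ^^ (2 * n) \<and> crel s' w' ts')"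
  using assms(1)
proof (induction n arbitrary: i' s' w')
  case 0
  with assms show ?case by auto
next
  case (Suc n)
  from Suc.prems obtain i1 s1 w1 where 1: "(istep P ^^ n) (i, s, w) (i1, s1, w1)"
    and 2: "istep P (i1, s1, w1) (i', s', w')"
    by (metis prod_cases3 relpowp_Suc_E)
  from Suc.IH[OF 1] obtain ts1 where "good s1" and 3: "((2 * i, ts), (2 * i1, ts1)) \<in> steps M ^^ (2 * n)"
    and "crel s1 w1 ts1" by blast
  with simulate[OF 2] obtain ts' where "good s'" and 4: "((2 * i1, ts1), (2 * i', ts')) \<in> steps M ^^ 2"
    and "crel s' w' ts'" by blast
  moreover from 3 4 have "((2 * i, ts), (2 * i', ts')) \<in> steps M ^^ (2 * n + 2)"
    unfolding relpow_add by (rule relcompI)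
  then have "((2 * i, ts), (2 * i', ts')) \<in> steps M ^^ (2 * Suc n)"
    by (simp only: mult_Suc_right add.commute)
  ultimately show ?case by blast
qed

lemma run_M:
  assumes r0: "idx r0 = 0" and w: "set v \<subseteq> {1..8}"
    and "reach P t (0, (\<lambda>_. [])(r0 := v), []) (length P, s', w)"
  shows "\<exists>t'\<le>2 * t. \<exists>cfg. (init_config M v, cfg) \<in> steps M ^^ t' \<and> halted M cfg \<and>
    fst (last (snd cfg)) = word_tape w"
proof -
  let ?s = "(\<lambda>_. [])(r0 := v) :: 'r store"
  let ?ts = "(word_tape v, 0) # replicate k (word_tape [], 0) :: tape list"
  have ic: "init_config M v = (0, ?ts)" by (simp add: init_config_def M_def)
  from assms(3) obtain n where n: "n \<le> t" "(istep P ^^ n) (0, ?s, []) (length P, s', w)"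
    by (auto simp: reach_def)
  have e: "flat (\<lambda>_. []) = (\<lambda>_. [])" by (auto simp: flat_def)
  have "crel ?s [] ?ts" unfolding crel_def flat_upd e using kpos r0
    by (auto simp: stack_tape_def out_tape_def nth_Cons' fun_eq_iff)
  moreover have "good ?s" using w by (auto simp: good_def)
  ultimately obtain ts' where ts': "((0, ?ts), (2 * length P, ts')) \<in> steps M ^^ (2 * n)" "crel s' w ts'"
    using simulates[OF n(2)] by auto
  have "last ts' = ts' ! k"
    using ts'(2) by (subst last_conv_nth) (auto simp: crel_def)
  with ts'(2) have "fst (last ts') = word_tape w" by (simp add: crel_def out_tape_def)
  moreover have "halted M (2 * length P, ts')" by (simp add: halted_def M_def)
  ultimately show ?thesis using ts' n(1) ic
    by (intro exI[of _ "2 * n"] conjI exI[of _ "(2 * length P, ts')"]) auto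
qed

end

section \<open>Polynomial bounds, and from commands to polynomial-time computability\<close>

definition poly_bounded :: "(nat \<Rightarrow> nat) \<Rightarrow> bool" where
  "poly_bounded f \<longleftrightarrow> (\<exists>p :: nat poly. \<forall>x. f x \<le> poly p x)"

lemma poly_bounded_const: "poly_bounded (\<lambda>_. c)"
  unfolding poly_bounded_def by (rule exI[of _ "[:c:]"]) simp

lemma poly_bounded_id: "poly_bounded (\<lambda>x. x)"
  unfolding poly_bounded_def by (rule exI[of _ "[:0, 1:]"]) simp

lemma poly_bounded_add: "poly_bounded f \<Longrightarrow> poly_bounded g \<Longrightarrow> poly_bounded (\<lambda>x. f x + g x)"
  unfolding poly_bounded_def by (metis add_mono poly_add)

lemma poly_bounded_mult: "poly_bounded f \<Longrightarrow> poly_bounded g \<Longrightarrow> poly_bounded (\<lambda>x. f x * g x)"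
  unfolding poly_bounded_def by (metis mult_le_mono poly_mult)

lemma poly_bounded_power: "poly_bounded f \<Longrightarrow> poly_bounded (\<lambda>x. f x ^ n)"
  by (induction n) (auto intro: poly_bounded_const poly_bounded_mult)

lemmas poly_bounded_intros = poly_bounded_const poly_bounded_id poly_bounded_add poly_bounded_mult
  poly_bounded_power

lemma set_instr_comp: "x \<in> set (comp i c) \<Longrightarrow> set_instr x \<subseteq> regs c"
proof (induction c arbitrary: i)
  case (Seq c d)
  then show ?case by simp blast
next
  case (Cond r S c d)
  then show ?case by simp (elim disjE; force)
next
  case (While r S c)
  then show ?case by simp (elim disjE; force)
qed auto

lemma IPush_comp: "IPush r a \<in> set (comp i c) \<Longrightarrow> a \<in> letters c"
  by (induction c arbitrary: i) auto

theorem poly_time_computable_by_com: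
  fixes c :: "'r::countable com" and input result :: 'r
  assumes letters: "letters c \<subseteq> {1..8}"
    and run: "\<And>w. w \<in> X \<Longrightarrow> set w \<subseteq> {1..8} \<and> set (f w) \<subseteq> {1..8} \<and>
      (\<exists>s'. exec c ((\<lambda>_. [])(input := w)) (T (length w)) s' \<and> s' result = f w)"
    and len: "\<And>w. w \<in> X \<Longrightarrow> length (f w) \<le> T (length w)"
    and T: "poly_bounded T"
  shows "poly_time_computable_on X f"
proof -
  \<comment> \<open>The input has to be on the first tape, so its register gets index 0 and all
    others are numbered from 1 on.\<close>
  define idx where "idx r = (if r = input then 0 else Suc (to_nat r))" for r :: 'r
  define k where "k = Suc (Max (idx ` (regs c \<union> {input, result})))"
  define P where "P = out_prog c result"
  have fin: "finite (idx ` (regs c \<union> {input, result}))" by (simp add: finite_regs)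
  have k: "idx r < k" if "r \<in> regs c \<union> {input, result}" for r
    unfolding k_def using that fin by (metis Max_ge imageI le_imp_less_Suc)
  interpret machine idx k P
  proof
    show "inj idx" by (auto simp: idx_def inj_def)
    show "k > 0" by (simp add: k_def)
    show "set_instr x \<subseteq> {r. idx r < k}" if "x \<in> set P" for x
      using that k set_instr_comp unfolding P_def out_prog_def by fastforce
    show "a \<in> {1..8}" if "IPush r a \<in> set P" for r a
      using that letters IPush_comp unfolding P_def out_prog_def by force
  qed
  from T have "poly_bounded (\<lambda>x. 2 * (T x + 4 * T x + 1))"
    by (intro poly_bounded_intros)
  then obtain p :: "nat poly" where p: "2 * (T x + 4 * T x + 1) \<le> poly p x" for x
    by (auto simp: poly_bounded_def)
  show ?thesis unfolding poly_time_computable_on_def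
  proof (intro exI[of _ M] exI[of _ p] conjI ballI turing_machine_M)
    fix w assume w: "w \<in> X"
    with run obtain s' where w8: "set w \<subseteq> {1..8}" and "set (f w) \<subseteq> {1..8}"
      and e: "exec c ((\<lambda>_. [])(input := w)) (T (length w)) s'" and s': "s' result = f w" by metis
    with out_prog_correct[OF e, of result] obtain s''
      where r: "reach P (T (length w) + 4 * length (f w) + 1) (0, (\<lambda>_. [])(input := w), []) (length P, s'', f w)"
      by (auto simp: P_def)
    have "idx input = 0" by (simp add: idx_def)
    from run_M[OF this w8 r] obtain t' cfg where
      t': "t' \<le> 2 * (T (length w) + 4 * length (f w) + 1)" and
      cfg: "(init_config M w, cfg) \<in> steps M ^^ t'" "halted M cfg" "fst (last (snd cfg)) = word_tape (f w)"
      by blast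
    have "t' \<le> 2 * (T (length w) + 4 * T (length w) + 1)"
      using t' len[OF w] by simp
    also note p
    finally have "t' \<le> poly p (length w)" .
    with cfg show "\<exists>t cfg. t \<le> poly p (length w) \<and> (init_config M w, cfg) \<in> steps M ^^ t \<and>
        halted M cfg \<and> fst (last (snd cfg)) = word_tape (f w)" by blast
  qed
qed

section \<open>Gadgets\<close>

type_synonym gadget = "(nat \<times> nat atom list \<times> int) list"

definition gval :: "'c vstruct \<Rightarrow> gadget \<Rightarrow> nat \<Rightarrow> 'c list \<Rightarrow> ereal" where
  "gval \<Gamma> ts N x = (\<Sum>(p, e, z)\<leftarrow>ts. ereal (real N ^ p) * (expr_val (cost \<Gamma>) e x + ereal (- of_int z)))"

definition wf_atom :: "'c vstruct \<Rightarrow> nat \<Rightarrow> nat atom \<Rightarrow> bool" where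
  "wf_atom \<Gamma> n A \<longleftrightarrow> atom_rels A \<subseteq> symbols \<Gamma> \<and> atom_arity_ok (arity \<Gamma>) A \<and> atom_vars A \<subseteq> {..<n}"

definition wf_gadget :: "'c vstruct \<Rightarrow> nat \<Rightarrow> gadget \<Rightarrow> bool" where
  "wf_gadget \<Gamma> n ts \<longleftrightarrow> (\<forall>(p, e, z)\<in>set ts. \<forall>A\<in>set e. wf_atom \<Gamma> n A)"

fun rename_atom :: "(nat \<Rightarrow> nat) \<Rightarrow> nat atom \<Rightarrow> nat atom" where
  "rename_atom \<sigma> (Rel r vs) = Rel r (map \<sigma> vs)"
| "rename_atom \<sigma> (Equal i j) = Equal (\<sigma> i) (\<sigma> j)"
| "rename_atom \<sigma> (Empty i) = Empty (\<sigma> i)"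

definition rename :: "(nat \<Rightarrow> nat) \<Rightarrow> gadget \<Rightarrow> gadget" where
  "rename \<sigma> ts = map (\<lambda>(p, e, z). (p, map (rename_atom \<sigma>) e, z)) ts"

definition raise :: "nat \<Rightarrow> gadget \<Rightarrow> gadget" where
  "raise c ts = map (\<lambda>(p, e, z). (p + c, e, z)) ts"

definition square :: "gadget \<Rightarrow> gadget" where
  "square ts = map (\<lambda>(p, e, z). (2 * p, e, z)) ts"

definition repeat :: "nat \<Rightarrow> gadget \<Rightarrow> gadget" where
  "repeat m ts = concat (replicate m ts)"

lemma gval_Nil [simp]: "gval \<Gamma> [] N x = 0"
  by (simp add: gval_def)

lemma gval_append [simp]: "gval \<Gamma> (ts @ ts') N x = gval \<Gamma> ts N x + gval \<Gamma> ts' N x"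
  by (simp add: gval_def)

lemma gval_const [simp]: "gval \<Gamma> [(p, [], z)] N x = ereal (- (real N ^ p * of_int z))"
  by (simp add: gval_def expr_val_def)

lemma gval_Cons:
  "gval \<Gamma> ((p, e, z) # ts) N x =
    ereal (real N ^ p) * (expr_val (cost \<Gamma>) e x + ereal (- of_int z)) + gval \<Gamma> ts N x"
  by (simp add: gval_def)

lemma gval_raise [simp]: "gval \<Gamma> (raise c ts) N x = ereal (real N ^ c) * gval \<Gamma> ts N x"
proof (induction ts)
  case Nil
  then show ?case by (simp add: raise_def)
next
  case (Cons t ts)
  obtain p e z where t: "t = (p, e, z)" by (cases t)
  let ?x = "expr_val (cost \<Gamma>) e x + ereal (- of_int z)"
  have "ereal (real N ^ (p + c)) = ereal (real N ^ c) * ereal (real N ^ p)"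
    by (simp add: power_add)
  then have "gval \<Gamma> (raise c (t # ts)) N x
      = ereal (real N ^ c) * (ereal (real N ^ p) * ?x) + ereal (real N ^ c) * gval \<Gamma> ts N x"
    using Cons.IH unfolding t raise_def by (simp only: list.map prod.case gval_Cons mult.assoc)
  also have "\<dots> = ereal (real N ^ c) * (ereal (real N ^ p) * ?x + gval \<Gamma> ts N x)"
    by (rule ereal_pos_distrib[symmetric]) auto
  finally show ?case unfolding t gval_Cons .
qed

lemma gval_square [simp]: "gval \<Gamma> (square ts) N x = gval \<Gamma> ts (N ^ 2) x"
  unfolding gval_def square_def by (induction ts) (auto simp: power_mult)

lemma gval_repeat [simp]: "gval \<Gamma> (repeat m ts) N x = ereal (real m) * gval \<Gamma> ts N x"
proof (induction m)
  case 0
  then show ?case by (simp add: repeat_def)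
next
  case (Suc m)
  have "ereal (real (Suc m)) = 1 + ereal (real m)" by simp
  then have "ereal (real (Suc m)) * gval \<Gamma> ts N x = gval \<Gamma> ts N x + ereal (real m) * gval \<Gamma> ts N x"
    by (simp only:) (subst ereal_left_distrib, auto)
  with Suc show ?case by (simp add: repeat_def)
qed

lemma wf_gadget_simps [simp]:
  "wf_gadget \<Gamma> n []"
  "wf_gadget \<Gamma> n (ts @ ts') \<longleftrightarrow> wf_gadget \<Gamma> n ts \<and> wf_gadget \<Gamma> n ts'"
  "wf_gadget \<Gamma> n [(p, e, z)] \<longleftrightarrow> (\<forall>A\<in>set e. wf_atom \<Gamma> n A)"
  unfolding wf_gadget_def set_append ball_Un by auto

lemma wf_gadget_raise [simp]: "wf_gadget \<Gamma> n ts \<Longrightarrow> wf_gadget \<Gamma> n (raise c ts)"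
  by (auto simp: wf_gadget_def raise_def)

lemma wf_gadget_square [simp]: "wf_gadget \<Gamma> n ts \<Longrightarrow> wf_gadget \<Gamma> n (square ts)"
  by (auto simp: wf_gadget_def square_def)

lemma wf_gadget_repeat [simp]: "wf_gadget \<Gamma> n ts \<Longrightarrow> wf_gadget \<Gamma> n (repeat m ts)"
  by (induction m) (auto simp: repeat_def)

lemma wf_rename_atom: "wf_atom \<Gamma> n A \<Longrightarrow> (\<And>i. i < n \<Longrightarrow> \<sigma> i < n') \<Longrightarrow> wf_atom \<Gamma> n' (rename_atom \<sigma> A)"
  by (cases A) (auto simp: wf_atom_def)

lemma wf_gadget_rename: "wf_gadget \<Gamma> n ts \<Longrightarrow> (\<And>i. i < n \<Longrightarrow> \<sigma> i < n') \<Longrightarrow> wf_gadget \<Gamma> n' (rename \<sigma> ts)"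
  by (fastforce simp: wf_gadget_def rename_def intro: wf_rename_atom)

lemma atom_val_rename:
  "(\<And>i. i \<in> atom_vars A \<Longrightarrow> y ! \<sigma> i = x ! i) \<Longrightarrow> atom_val I y (rename_atom \<sigma> A) = atom_val I x A"
  by (cases A) (auto simp: comp_def intro!: arg_cong[of _ _ "I _"])

lemma expr_val_rename:
  assumes "\<And>A i. A \<in> set e \<Longrightarrow> i \<in> atom_vars A \<Longrightarrow> y ! \<sigma> i = x ! i"
  shows "expr_val I (map (rename_atom \<sigma>) e) y = expr_val I e x"
  using assms unfolding expr_val_def by (auto simp: comp_def intro!: arg_cong[of _ _ sum_list] atom_val_rename)

lemma gval_rename:
  assumes "wf_gadget \<Gamma> n ts" "\<And>i. i < n \<Longrightarrow> y ! \<sigma> i = x ! i"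
  shows "gval \<Gamma> (rename \<sigma> ts) N y = gval \<Gamma> ts N x"
proof -
  have "expr_val (cost \<Gamma>) (map (rename_atom \<sigma>) e) y = expr_val (cost \<Gamma>) e x" if "(p, e, z) \<in> set ts" for p e z
    by (rule expr_val_rename) (use assms that in \<open>fastforce simp: wf_gadget_def wf_atom_def\<close>)
  then show ?thesis unfolding gval_def rename_def
    by (auto simp: comp_def case_prod_unfold intro!: arg_cong[of _ _ sum_list])
qed

lemma rename_atom_id: "rename_atom (\<lambda>i. i) A = A"
  by (cases A) auto

lemma rename_id: "rename (\<lambda>i. i) ts = ts"
  by (simp add: rename_def rename_atom_id map_idI case_prod_unfold)

text \<open>At infinity this is less than \<open>N ^ (h + 2)\<close>: the loss of
  \<open>B * N ^ (h + 1)\<close> leaves room for other summands, whose finite costs may be negative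
  and are of order \<open>N ^ (h + 1)\<close>.\<close>

definition lower :: "nat \<Rightarrow> nat \<Rightarrow> nat \<Rightarrow> nat \<Rightarrow> ereal \<Rightarrow> real" where
  "lower s h B N x = (if x = \<infinity> then real N ^ (h + 2) - real B * real N ^ (h + 1)
     else real s * real N ^ (h + 1) * real_of_ereal x)"

text \<open>
  For large \<open>N\<close>, the value of the gadget, minimised over its \<open>l\<close> auxiliary variables, orders the
  tuples lexicographically: what matters first is whether the tuple is feasible, then its cost.
  The summands of order \<open>N ^ h\<close> are an error that no longer matters.
\<close>

definition approx :: "'c vstruct \<Rightarrow> nat \<Rightarrow> ('c list \<Rightarrow> ereal) \<Rightarrow> nat \<Rightarrow> gadget \<Rightarrow> nat \<Rightarrow> nat \<Rightarrow> nat \<Rightarrow> bool" where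
  "approx \<Gamma> k R l ts s h B \<longleftrightarrow> s > 0 \<and> B > 0 \<and> wf_gadget \<Gamma> (k + l) ts \<and>
     (\<forall>a\<in>tuples k. R a = \<infinity> \<or> (\<exists>j::int. R a = ereal (of_int j / real s))) \<and>
     (\<forall>N\<ge>B. \<forall>a\<in>tuples k.
        (\<forall>b\<in>tuples l. ereal (lower s h B N (R a)) \<le> gval \<Gamma> ts N (a @ b)) \<and>
        (R a \<noteq> \<infinity> \<longrightarrow> (\<exists>b\<in>tuples l. gval \<Gamma> ts N (a @ b) \<le> ereal (lower s h B N (R a) + real B * real N ^ h))))"

lemma approxI:
  assumes "s > 0" "B > 0" "wf_gadget \<Gamma> (k + l) ts"
    and "\<And>a. length a = k \<Longrightarrow> R a \<noteq> \<infinity> \<Longrightarrow> \<exists>j::int. R a = ereal (of_int j / real s)"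
    and "\<And>N a b. \<lbrakk>N \<ge> B; N \<ge> 1; length a = k; length b = l\<rbrakk> \<Longrightarrow> ereal (lower s h B N (R a)) \<le> gval \<Gamma> ts N (a @ b)"
    and "\<And>N a. \<lbrakk>N \<ge> B; N \<ge> 1; length a = k; R a \<noteq> \<infinity>\<rbrakk>
      \<Longrightarrow> \<exists>b\<in>tuples l. gval \<Gamma> ts N (a @ b) \<le> ereal (lower s h B N (R a) + real B * real N ^ h)"
  shows "approx \<Gamma> k R l ts s h B"
  using assms unfolding approx_def by auto

lemma approxD:
  assumes "approx \<Gamma> k R l ts s h B"
  shows "s > 0" "B > 0" "wf_gadget \<Gamma> (k + l) ts"
    and "\<And>a. length a = k \<Longrightarrow> R a \<noteq> \<infinity> \<Longrightarrow> \<exists>j::int. R a = ereal (of_int j / real s)"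
    and "\<And>N a b. \<lbrakk>N \<ge> B; length a = k; length b = l\<rbrakk> \<Longrightarrow> ereal (lower s h B N (R a)) \<le> gval \<Gamma> ts N (a @ b)"
    and "\<And>N a. \<lbrakk>N \<ge> B; length a = k; R a \<noteq> \<infinity>\<rbrakk>
      \<Longrightarrow> \<exists>b\<in>tuples l. gval \<Gamma> ts N (a @ b) \<le> ereal (lower s h B N (R a) + real B * real N ^ h)"
  using assms unfolding approx_def by auto

lemma lower_inf: "lower s h B N \<infinity> = real N ^ (h + 2) - real B * real N ^ (h + 1)"
  by (simp add: lower_def)

lemma lower_fin [simp]: "lower s h B N (ereal x) = real s * real N ^ (h + 1) * x"
  by (simp add: lower_def)

lemma lower_mono: "B \<le> B' \<Longrightarrow> lower s h B' N x \<le> lower s h B N x"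
  by (auto simp: lower_def intro!: mult_right_mono)

text \<open>A larger constant weakens both estimates and the range of \<open>N\<close>. Thus
  finitely many gadgets can share one constant.\<close>

lemma approx_mono:
  assumes "approx \<Gamma> k R l ts s h B" "B \<le> B'"
  shows "approx \<Gamma> k R l ts s h B'"
proof (rule approxI)
  note D = approxD[OF assms(1)]
  show "s > 0" "B' > 0" "wf_gadget \<Gamma> (k + l) ts" using D assms(2) by auto
  show "\<exists>j::int. R a = ereal (of_int j / real s)" if "length a = k" "R a \<noteq> \<infinity>" for a
    using D(4) that by blast
  fix N and a :: "'a list" assume N: "N \<ge> B'" and a: "length a = k"
  show "ereal (lower s h B' N (R a)) \<le> gval \<Gamma> ts N (a @ b)" if "length b = l" for b
    using D(5)[of N a b] lower_mono[OF assms(2), of s h N "R a"] N a that assms(2)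
    by (meson ereal_less_eq(3) order_trans)
  assume fin: "R a \<noteq> \<infinity>"
  with D(6)[of N a] N a assms(2) obtain b where b: "b \<in> tuples l"
    "gval \<Gamma> ts N (a @ b) \<le> ereal (lower s h B N (R a) + real B * real N ^ h)" by auto
  have "lower s h B N (R a) + real B * real N ^ h \<le> lower s h B' N (R a) + real B' * real N ^ h"
    using fin assms(2) by (auto simp: lower_def intro!: mult_right_mono)
  with b show "\<exists>b\<in>tuples l. gval \<Gamma> ts N (a @ b) \<le> ereal (lower s h B' N (R a) + real B' * real N ^ h)"
    by (meson ereal_less_eq(3) order_trans)
qed

lemma approx_cong:
  "approx \<Gamma> k R l ts s h B \<Longrightarrow> (\<And>a. length a = k \<Longrightarrow> R a = R' a) \<Longrightarrow> approx \<Gamma> k R' l ts s h B"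
  unfolding approx_def by auto

lemma power_gap:
  fixes N :: nat
  assumes "N \<ge> 1" "m \<ge> 1"
  shows "real N ^ (h + 2) - real (m * B) * real N ^ (h + 1) \<le> real m * (real N ^ (h + 2) - real B * real N ^ (h + 1))"
proof -
  have "1 * real N ^ (h + 2) \<le> real m * real N ^ (h + 2)"
    using assms by (intro mult_right_mono) auto
  then show ?thesis by (simp add: algebra_simps)
qed

lemma ereal_scale_le: "ereal x \<le> g \<Longrightarrow> 0 \<le> c \<Longrightarrow> ereal (c * x) \<le> ereal c * g"
  using ereal_mult_left_mono[of "ereal x" g "ereal c"] by simp

lemma ereal_scale_ge: "g \<le> ereal x \<Longrightarrow> 0 \<le> c \<Longrightarrow> ereal c * g \<le> ereal (c * x)"
  using ereal_mult_left_mono[of g "ereal x" "ereal c"] by simp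

section \<open>Gadgets for the operations of the closure\<close>

lemma approx_raise:
  assumes "approx \<Gamma> k R l ts s h B"
  shows "approx \<Gamma> k R l (raise c ts) s (h + c) B"
proof (rule approxI)
  note D = approxD[OF assms(1)]
  show "s > 0" "B > 0" "wf_gadget \<Gamma> (k + l) (raise c ts)" using D by auto
  show "\<exists>j::int. R a = ereal (of_int j / real s)" if "length a = k" "R a \<noteq> \<infinity>" for a
    using D(4) that by blast
  have low: "lower s (h + c) B N x = real N ^ c * lower s h B N x" for N x
    by (simp add: lower_def power_add algebra_simps)
  fix N and a :: "'a list" assume N: "N \<ge> B" and a: "length a = k"
  show "ereal (lower s (h + c) B N (R a)) \<le> gval \<Gamma> (raise c ts) N (a @ b)" if "length b = l" for b
    unfolding low gval_raise by (rule ereal_scale_le) (use D(5)[OF N a that] in auto)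
  assume fin: "R a \<noteq> \<infinity>"
  with D(6)[OF N a] obtain b where b: "b \<in> tuples l"
    "gval \<Gamma> ts N (a @ b) \<le> ereal (lower s h B N (R a) + real B * real N ^ h)" by auto
  have "real N ^ c * (lower s h B N (R a) + real B * real N ^ h)
      = lower s (h + c) B N (R a) + real B * real N ^ (h + c)"
    unfolding low by (simp add: power_add algebra_simps)
  with ereal_scale_ge[OF b(2), of "real N ^ c"]
  have "gval \<Gamma> (raise c ts) N (a @ b) \<le> ereal (lower s (h + c) B N (R a) + real B * real N ^ (h + c))"
    by simp
  with b show "\<exists>b\<in>tuples l. gval \<Gamma> (raise c ts) N (a @ b)
      \<le> ereal (lower s (h + c) B N (R a) + real B * real N ^ (h + c))" by blast
qed

text \<open>Only the numerator \<open>i\<close> changes the gadget, which is repeated. The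
  denominator goes into the scale: the same number read with scale \<open>s * j\<close> instead of
  \<open>s\<close> means a cost that is \<open>j\<close> times smaller.\<close>

lemma approx_scale:
  assumes "approx \<Gamma> k R l ts s h B" "i > 0" "j > 0"
  shows "approx \<Gamma> k (\<lambda>a. ereal (real i / real j) * R a) l (repeat i ts) (s * j) h (i * B)"
proof (rule approxI)
  note D = approxD[OF assms(1)]
  let ?R = "\<lambda>a. ereal (real i / real j) * R a"
  show "s * j > 0" "i * B > 0" "wf_gadget \<Gamma> (k + l) (repeat i ts)" using D assms by auto
  have inf: "?R a = \<infinity> \<longleftrightarrow> R a = \<infinity>" if "length a = k" for a
    using D(4)[OF that] assms by (cases "R a") auto
  show "\<exists>z::int. ?R a = ereal (of_int z / real (s * j))" if "length a = k" "?R a \<noteq> \<infinity>" for a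
  proof -
    from D(4)[of a] inf that obtain z :: int where "R a = ereal (of_int z / real s)" by auto
    then have "?R a = ereal (of_int (int i * z) / real (s * j))" by (simp add: field_simps)
    then show ?thesis by blast
  qed
  have low: "lower (s * j) h (i * B) N (?R a) = real i * lower s h B N (R a)"
    if "length a = k" "R a \<noteq> \<infinity>" for N a
  proof -
    from D(4)[OF that] obtain z :: int where "R a = ereal (of_int z / real s)" by auto
    then show ?thesis using assms D(1) by (simp add: field_simps)
  qed
  have low': "lower (s * j) h (i * B) N (?R a) \<le> real i * lower s h B N (R a)"
    if "length a = k" "N \<ge> 1" for N a
  proof (cases "R a = \<infinity>")
    case True
    with inf[OF that(1)] that assms power_gap[of N i h B] show ?thesis by (simp add: lower_def)
  qed (use low that in auto)
  fix N and a :: "'a list" assume N: "N \<ge> i * B" and N1: "N \<ge> 1" and a: "length a = k"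
  from N have NB: "N \<ge> B" using assms(2) by (metis One_nat_def Suc_leI le_trans mult.commute mult_le_mono2 nat_mult_1_right)
  show "ereal (lower (s * j) h (i * B) N (?R a)) \<le> gval \<Gamma> (repeat i ts) N (a @ b)" if "length b = l" for b
  proof -
    have "ereal (real i * lower s h B N (R a)) \<le> gval \<Gamma> (repeat i ts) N (a @ b)"
      unfolding gval_repeat by (rule ereal_scale_le) (use D(5)[OF NB a that] in auto)
    with low'[OF a N1] show ?thesis by (meson ereal_less_eq(3) order_trans)
  qed
  assume "?R a \<noteq> \<infinity>"
  with inf[OF a] have fin: "R a \<noteq> \<infinity>" by blast
  with D(6)[OF NB a] obtain b where b: "b \<in> tuples l"
    "gval \<Gamma> ts N (a @ b) \<le> ereal (lower s h B N (R a) + real B * real N ^ h)" by auto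
  from ereal_scale_ge[OF this(2), of "real i"]
  have "gval \<Gamma> (repeat i ts) N (a @ b) \<le> ereal (lower (s * j) h (i * B) N (?R a) + real (i * B) * real N ^ h)"
    by (simp only: gval_repeat low[OF a fin]) (simp add: algebra_simps)
  with b show "\<exists>b\<in>tuples l. gval \<Gamma> (repeat i ts) N (a @ b)
      \<le> ereal (lower (s * j) h (i * B) N (?R a) + real (i * B) * real N ^ h)" by blast
qed

text \<open>The factor \<open>m/m\<close> leaves the relation alone but changes the scale. Together
  with \<open>approx_raise\<close> this brings different gadgets to a common scale and
  exponent.\<close>

lemma approx_repeat:
  assumes "approx \<Gamma> k R l ts s h B" "m > 0"
  shows "approx \<Gamma> k R l (repeat m ts) (s * m) h (m * B)"
  using approx_scale[OF assms(1,2,2)] by (rule approx_cong) (use assms(2) in \<open>simp flip: one_ereal_def\<close>)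

text \<open>The shift is a term with the empty expression at the exponent of the finite costs.
  Infeasible tuples are shifted too, but by no more than \<open>|z| * N ^ (h + 1)\<close>, which the
  larger constant absorbs.\<close>

lemma approx_add_const:
  assumes "approx \<Gamma> k R l ts s h B"
  shows "approx \<Gamma> k (\<lambda>a. R a + ereal (of_int z / real s)) l (ts @ [(h + 1, [], - z)]) s h (B + nat \<bar>z\<bar>)"
proof (rule approxI)
  note D = approxD[OF assms(1)]
  let ?R = "\<lambda>a. R a + ereal (of_int z / real s)" and ?ts = "ts @ [(h + 1, [], - z)]" and ?B = "B + nat \<bar>z\<bar>"
  show "s > 0" "?B > 0" "wf_gadget \<Gamma> (k + l) ?ts" using D by auto
  have inf: "?R a = \<infinity> \<longleftrightarrow> R a = \<infinity>" for a by auto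
  show "\<exists>z::int. ?R a = ereal (of_int z / real s)" if "length a = k" "?R a \<noteq> \<infinity>" for a
  proof -
    from D(4)[of a] inf that obtain y :: int where "R a = ereal (of_int y / real s)" by auto
    then have "?R a = ereal (of_int (y + z) / real s)" by (simp add: add_divide_distrib)
    then show ?thesis by blast
  qed
  have low: "lower s h ?B N (?R a) = lower s h B N (R a) + of_int z * real N ^ (h + 1)"
    if "length a = k" "R a \<noteq> \<infinity>" for N a
  proof -
    from D(4)[OF that] obtain z :: int where "R a = ereal (of_int z / real s)" by auto
    then show ?thesis using D(1) by (simp add: field_simps)
  qed
  have low': "lower s h ?B N (?R a) \<le> lower s h B N (R a) + of_int z * real N ^ (h + 1)"
    if "length a = k" for N a
  proof (cases "R a = \<infinity>")
    case True
    have "- \<bar>real_of_int z\<bar> * real N ^ (h + 1) \<le> of_int z * real N ^ (h + 1)"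
      by (intro mult_right_mono) auto
    with True show ?thesis by (simp add: lower_def algebra_simps)
  qed (use low that in auto)
  have gv: "gval \<Gamma> ?ts N x = gval \<Gamma> ts N x + ereal (of_int z * real N ^ (h + 1))" for N x
    by (simp add: algebra_simps)
  fix N and a :: "'a list" assume N: "N \<ge> ?B" and a: "length a = k"
  from N have NB: "N \<ge> B" by simp
  show "ereal (lower s h ?B N (?R a)) \<le> gval \<Gamma> ?ts N (a @ b)" if "length b = l" for b
  proof -
    have "ereal (lower s h B N (R a) + of_int z * real N ^ (h + 1)) \<le> gval \<Gamma> ?ts N (a @ b)"
      unfolding gv plus_ereal.simps(1)[symmetric] by (intro add_mono D(5) NB a that order_refl)
    with low'[OF a] show ?thesis by (meson ereal_less_eq(3) order_trans)
  qed
  assume "?R a \<noteq> \<infinity>"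
  with inf have fin: "R a \<noteq> \<infinity>" by blast
  with D(6)[OF NB a] obtain b where b: "b \<in> tuples l"
    "gval \<Gamma> ts N (a @ b) \<le> ereal (lower s h B N (R a) + real B * real N ^ h)" by auto
  from add_mono[OF this(2), of "ereal (of_int z * real N ^ (h + 1))" "ereal (of_int z * real N ^ (h + 1))"]
  have "gval \<Gamma> ?ts N (a @ b) \<le> ereal (lower s h B N (R a) + of_int z * real N ^ (h + 1) + real B * real N ^ h)"
    unfolding gv by (simp add: algebra_simps)
  also have "\<dots> \<le> ereal (lower s h ?B N (?R a) + real ?B * real N ^ h)"
    unfolding low[OF a fin] by (auto intro!: mult_right_mono)
  finally show "\<exists>b\<in>tuples l. gval \<Gamma> ?ts N (a @ b) \<le> ereal (lower s h ?B N (?R a) + real ?B * real N ^ h)"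
    using b by blast
qed

definition bounded_by :: "nat \<Rightarrow> nat \<Rightarrow> ('c list \<Rightarrow> ereal) \<Rightarrow> bool" where
  "bounded_by k C R \<longleftrightarrow> (\<forall>a. length a = k \<longrightarrow> R a \<noteq> \<infinity> \<longrightarrow> \<bar>real_of_ereal (R a)\<bar> \<le> real C)"

lemma lower_bound:
  assumes "N \<ge> 1" "x \<noteq> \<infinity> \<Longrightarrow> \<bar>real_of_ereal x\<bar> \<le> real C"
  shows "- real (B + s * C) * real N ^ (h + 1) \<le> lower s h B N x"
proof (cases "x = \<infinity>")
  case True
  have "- real (B + s * C) * real N ^ (h + 1) \<le> - real B * real N ^ (h + 1)"
    by (intro mult_right_mono) auto
  moreover have "0 \<le> real N ^ (h + 2)" by simp
  ultimately show ?thesis unfolding lower_def if_P[OF True] by linarith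
next
  case False
  then have "- (real C) \<le> real_of_ereal x" using assms(2) unfolding abs_le_iff by linarith
  then have "real s * real N ^ (h + 1) * (- real C) \<le> real s * real N ^ (h + 1) * real_of_ereal x"
    by (intro mult_left_mono) auto
  moreover have "0 \<le> real B * real N ^ (h + 1)" by simp
  moreover have "- real (B + s * C) * real N ^ (h + 1)
      = real s * real N ^ (h + 1) * (- real C) - real B * real N ^ (h + 1)" by (simp add: algebra_simps)
  ultimately show ?thesis unfolding lower_def if_not_P[OF False] by linarith
qed

text \<open>An infeasible summand keeps its order of magnitude next to a negative one, because by
  \<open>lower_bound\<close> the latter pulls the sum down by at most
  \<open>(B + s * C) * N ^ (h + 1)\<close>.\<close>

lemma lower_add:
  assumes "N \<ge> 1" "x \<noteq> -\<infinity>" "y \<noteq> -\<infinity>"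
    "x \<noteq> \<infinity> \<Longrightarrow> \<bar>real_of_ereal x\<bar> \<le> real C" "y \<noteq> \<infinity> \<Longrightarrow> \<bar>real_of_ereal y\<bar> \<le> real C'"
  shows "lower s h (B + B' + s * C + s * C') N (x + y) \<le> lower s h B N x + lower s h B' N y"
proof -
  have b: "- real (B + s * C) * real N ^ (h + 1) \<le> lower s h B N x"
    "- real (B' + s * C') * real N ^ (h + 1) \<le> lower s h B' N y"
    by (rule lower_bound[OF assms(1,4)] lower_bound[OF assms(1,5)], assumption)+
  have nn: "0 \<le> real (s * C) * real N ^ (h + 1)" "0 \<le> real (s * C') * real N ^ (h + 1)"
    "0 \<le> real B * real N ^ (h + 1)" "0 \<le> real B' * real N ^ (h + 1)" by auto
  note expand = of_nat_add of_nat_mult distrib_right distrib_left minus_add_distrib mult_minus_left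
  consider "x = \<infinity>" | "y = \<infinity>" | "x \<noteq> \<infinity>" "y \<noteq> \<infinity>" by blast
  then show ?thesis
  proof cases
    case 1
    then have "x + y = \<infinity>" by simp
    with 1 b(2) nn show ?thesis by (simp only: lower_inf expand; linarith)
  next
    case 2
    then have "x + y = \<infinity>" by simp
    with 2 b(1) nn show ?thesis by (simp only: lower_inf expand; linarith)
  next
    case 3
    with assms(2,3) show ?thesis by (cases x; cases y) (auto simp: algebra_simps)
  qed
qed

lemma approx_not_MInf: "approx \<Gamma> k R l ts s h B \<Longrightarrow> length a = k \<Longrightarrow> R a \<noteq> -\<infinity>"
  using approxD(4) by fastforce

text \<open>The gadgets share their parameters, but the auxiliary variables are made disjoint, so
  the two minima are taken independently.\<close>

lemma approx_add:
  assumes "approx \<Gamma> k R l ts s h B" "approx \<Gamma> k R' l' ts' s h B'" "bounded_by k C R" "bounded_by k C' R'"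
  shows "approx \<Gamma> k (\<lambda>a. R a + R' a) (l + l') (ts @ rename (\<lambda>i. if i < k then i else i + l) ts') s h
    (B + B' + s * C + s * C')"
proof (rule approxI)
  note D = approxD[OF assms(1)] and D' = approxD[OF assms(2)]
  let ?\<sigma> = "\<lambda>i. if i < k then i else i + l" and ?B = "B + B' + s * C + s * C'"
  let ?ts = "ts @ rename ?\<sigma> ts'" and ?R = "\<lambda>a. R a + R' a"
  have "wf_gadget \<Gamma> (k + (l + l')) ts"
    using D(3) by (fastforce simp: wf_gadget_def wf_atom_def)
  moreover have "wf_gadget \<Gamma> (k + (l + l')) (rename ?\<sigma> ts')"
    by (rule wf_gadget_rename[OF D'(3)]) auto
  ultimately show "wf_gadget \<Gamma> (k + (l + l')) ?ts" by simp
  show "s > 0" "?B > 0" using D by auto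
  have gv: "gval \<Gamma> ?ts N (a @ b @ b') = gval \<Gamma> ts N (a @ b) + gval \<Gamma> ts' N (a @ b')"
    if "length a = k" "length b = l" for N a b b'
  proof -
    have "gval \<Gamma> (rename (\<lambda>i. i) ts) N (a @ b @ b') = gval \<Gamma> ts N (a @ b)"
      by (rule gval_rename[OF D(3)]) (use that in \<open>auto simp: nth_append\<close>)
    moreover have "gval \<Gamma> (rename ?\<sigma> ts') N (a @ b @ b') = gval \<Gamma> ts' N (a @ b')"
      by (rule gval_rename[OF D'(3)]) (use that in \<open>auto simp: nth_append\<close>)
    ultimately show ?thesis by (simp add: rename_id)
  qed
  show "\<exists>j::int. ?R a = ereal (of_int j / real s)" if "length a = k" "?R a \<noteq> \<infinity>" for a
  proof -
    from that D(4)[of a] D'(4)[of a] obtain i j :: int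
      where "R a = ereal (of_int i / real s)" "R' a = ereal (of_int j / real s)" by auto
    then have "?R a = ereal (of_int (i + j) / real s)" by (simp add: add_divide_distrib)
    then show ?thesis by blast
  qed
  fix N and a :: "'a list" assume N: "N \<ge> ?B" and N1: "N \<ge> 1" and a: "length a = k"
  from N have NB: "N \<ge> B" "N \<ge> B'" by auto
  have low: "lower s h ?B N (?R a) \<le> lower s h B N (R a) + lower s h B' N (R' a)"
    using assms(3,4) a unfolding bounded_by_def
    by (intro lower_add[OF N1 approx_not_MInf[OF assms(1) a] approx_not_MInf[OF assms(2) a]]) blast+
  show "ereal (lower s h ?B N (?R a)) \<le> gval \<Gamma> ?ts N (a @ b)" if b: "length b = l + l'" for b
  proof -
    define b1 b2 where "b1 = take l b" and "b2 = drop l b"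
    have bb: "b = b1 @ b2" "length b1 = l" "length b2 = l'" using b by (auto simp: b1_def b2_def)
    have "ereal (lower s h B N (R a) + lower s h B' N (R' a)) \<le> gval \<Gamma> ?ts N (a @ b)"
      unfolding bb(1) gv[OF a bb(2)] plus_ereal.simps(1)[symmetric]
      by (intro add_mono D(5) D'(5) NB a bb)
    with low show ?thesis by (meson ereal_less_eq(3) order_trans)
  qed
  assume "?R a \<noteq> \<infinity>"
  then have fin: "R a \<noteq> \<infinity>" "R' a \<noteq> \<infinity>" by auto
  from D(6)[OF NB(1) a fin(1)] obtain b where b: "length b = l"
    "gval \<Gamma> ts N (a @ b) \<le> ereal (lower s h B N (R a) + real B * real N ^ h)" by auto
  from D'(6)[OF NB(2) a fin(2)] obtain b' where b': "length b' = l'"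
    "gval \<Gamma> ts' N (a @ b') \<le> ereal (lower s h B' N (R' a) + real B' * real N ^ h)" by auto
  have "gval \<Gamma> ?ts N (a @ b @ b')
      \<le> ereal (lower s h B N (R a) + real B * real N ^ h + (lower s h B' N (R' a) + real B' * real N ^ h))"
    unfolding gv[OF a b(1)] using add_mono[OF b(2) b'(2)] by simp
  also have "lower s h B N (R a) + lower s h B' N (R' a) = lower s h ?B N (?R a)"
    using fin assms(1,2) approx_not_MInf[of \<Gamma> k R l ts s h B a] approx_not_MInf[of \<Gamma> k R' l' ts' s h B' a] a
    by (cases "R a"; cases "R' a") (auto simp: algebra_simps)
  then have "lower s h B N (R a) + real B * real N ^ h + (lower s h B' N (R' a) + real B' * real N ^ h)
      = lower s h ?B N (?R a) + real (B + B') * real N ^ h" by (simp add: algebra_simps)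
  also have "ereal \<dots> \<le> ereal (lower s h ?B N (?R a) + real ?B * real N ^ h)"
    by (auto intro!: mult_right_mono)
  finally show "\<exists>b\<in>tuples (l + l'). gval \<Gamma> ?ts N (a @ b) \<le> ereal (lower s h ?B N (?R a) + real ?B * real N ^ h)"
    using b(1) b'(1) by (intro bexI[of _ "b @ b'"]) auto
qed

lemma approx_subst:
  assumes "approx \<Gamma> k R l ts s h B" "length vs = k" "set vs \<subseteq> {..<n}"
  shows "approx \<Gamma> n (\<lambda>a. R (map ((!) a) vs)) l (rename (\<lambda>i. if i < k then vs ! i else n + (i - k)) ts) s h B"
proof (rule approxI)
  note D = approxD[OF assms(1)]
  let ?\<sigma> = "\<lambda>i. if i < k then vs ! i else n + (i - k)"
  have vs: "vs ! i < n" if "i < k" for i using assms that by (meson lessThan_iff nth_mem subsetD)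
  show "s > 0" "B > 0" using D by auto
  show "wf_gadget \<Gamma> (n + l) (rename ?\<sigma> ts)"
    by (rule wf_gadget_rename[OF D(3)]) (use vs in \<open>auto intro: trans_less_add1\<close>)
  have gv: "gval \<Gamma> (rename ?\<sigma> ts) N (a @ b) = gval \<Gamma> ts N (map ((!) a) vs @ b)"
    if "length a = n" "length b = l" for N a b
    by (rule gval_rename[OF D(3)]) (use that assms vs in \<open>auto simp: nth_append\<close>)
  have len: "length (map ((!) a) vs) = k" for a :: "'a list" using assms by simp
  show "\<exists>j::int. R (map ((!) a) vs) = ereal (of_int j / real s)" if "R (map ((!) a) vs) \<noteq> \<infinity>" for a
    using D(4)[OF len that] .
  fix N and a :: "'a list" assume N: "N \<ge> B" and a: "length a = n"
  show "ereal (lower s h B N (R (map ((!) a) vs))) \<le> gval \<Gamma> (rename ?\<sigma> ts) N (a @ b)" if "length b = l" for b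
    unfolding gv[OF a that] using D(5)[OF N len that] .
  assume "R (map ((!) a) vs) \<noteq> \<infinity>"
  from D(6)[OF N len this] show "\<exists>b\<in>tuples l. gval \<Gamma> (rename ?\<sigma> ts) N (a @ b)
      \<le> ereal (lower s h B N (R (map ((!) a) vs)) + real B * real N ^ h)"
    using gv[OF a] by auto
qed

lemma approx_zero: "approx \<Gamma> k (\<lambda>a. 0) 0 [] 1 0 1"
  by (rule approxI) (auto simp: lower_def zero_ereal_def intro: exI[of _ 0])

lemma gval_single [simp]: "gval \<Gamma> [(0, [A], 0)] N x = atom_val (cost \<Gamma>) x A"
  by (simp add: gval_def expr_val_def flip: one_ereal_def zero_ereal_def)

lemma approx_Equal:
  assumes "i < k" "j < k"
  shows "approx \<Gamma> k (\<lambda>a. if a ! i = a ! j then 0 else \<infinity>) 0 [(0, [Equal i j], 0)] 1 0 1"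
  by (rule approxI) (use assms in \<open>auto simp: lower_def zero_ereal_def wf_atom_def split: if_splits intro: exI[of _ 0]\<close>)

text \<open>\<open>Empty\<close> needs a variable and \<open>k\<close> may be 0; hence the one
  auxiliary variable.\<close>

lemma approx_infinity: "approx \<Gamma> k (\<lambda>a. \<infinity>) 1 [(0, [Empty k], 0)] 1 0 1"
  by (rule approxI) (auto simp: wf_atom_def)

text \<open>One factor \<open>N\<close> lifts the costs to exponent \<open>h + 1\<close> for
  \<open>h = 0\<close>, and \<open>s\<close> copies turn them into integers. The gadget is
  exact.\<close>

lemma approx_base:
  assumes "r \<in> symbols \<Gamma>" "s > 0"
    and "\<And>a. length a = arity \<Gamma> r \<Longrightarrow> cost \<Gamma> r a \<noteq> \<infinity> \<Longrightarrow> \<exists>j::int. cost \<Gamma> r a = ereal (of_int j / real s)"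
  shows "approx \<Gamma> (arity \<Gamma> r) (cost \<Gamma> r) 0 (repeat s (raise 1 [(0, [Rel r [0..<arity \<Gamma> r]], 0)])) s 0 1"
proof (rule approxI)
  let ?k = "arity \<Gamma> r"
  have gv: "gval \<Gamma> (repeat s (raise 1 [(0, [Rel r [0..<?k]], 0)])) N a = ereal (real s * real N) * cost \<Gamma> r a"
    if "length a = ?k" for N a
    using that map_nth[of a] by (simp add: mult.assoc flip: times_ereal.simps(1))
  show "wf_gadget \<Gamma> (?k + 0) (repeat s (raise 1 [(0, [Rel r [0..<?k]], 0)]))"
    by (intro wf_gadget_repeat wf_gadget_raise) (use assms(1) in \<open>auto simp: wf_atom_def\<close>)
  fix N :: nat and a :: "'a list" assume N: "N \<ge> 1" and a: "length a = ?k"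
  show "ereal (lower s 0 1 N (cost \<Gamma> r a)) \<le> gval \<Gamma> (repeat s (raise 1 [(0, [Rel r [0..<?k]], 0)])) N (a @ b)"
    if "length b = 0" for b
    using assms(3)[OF a] gv[OF a, of N] N assms(2) that by (cases "cost \<Gamma> r a") (auto simp: lower_def)
  show "\<exists>b\<in>tuples 0. gval \<Gamma> (repeat s (raise 1 [(0, [Rel r [0..<?k]], 0)])) N (a @ b)
      \<le> ereal (lower s 0 1 N (cost \<Gamma> r a) + real 1 * real N ^ 0)" if "cost \<Gamma> r a \<noteq> \<infinity>"
    using assms(3)[OF a that] gv[OF a, of N] by auto
qed (use assms in auto)

text \<open>The gadget stays the same; the projected variables merely join the auxiliary ones. This
  works because a finite range makes the infimum a minimum.\<close>

lemma approx_project: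
  assumes "approx \<Gamma> (k + n) R l ts s h B" and R': "\<And>a. length a = k \<Longrightarrow> R' a = (INF b\<in>tuples n. R (a @ b))"
    and fin: "finite (R ` tuples (k + n))" and C: "bounded_by (k + n) C R"
  shows "approx \<Gamma> k R' (n + l) ts s h (B + s * C)"
proof (rule approxI)
  note D = approxD[OF assms(1)]
  let ?B = "B + s * C"
  show "s > 0" "?B > 0" using D by auto
  show "wf_gadget \<Gamma> (k + (n + l)) ts" using D by (simp add: add.assoc)
  have attained: "\<exists>c. length c = n \<and> R' a = R (a @ c)" if "length a = k" for a
  proof -
    let ?A = "(\<lambda>b. R (a @ b)) ` tuples n"
    have "?A \<subseteq> R ` tuples (k + n)" using that by auto
    then have f: "finite ?A" using fin finite_subset by blast
    have ne: "?A \<noteq> {}" by (auto intro: Ex_list_of_length)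
    from Min_in[OF f ne] R'[OF that] Min_Inf[OF f ne] show ?thesis by auto
  qed
  have le: "R' a \<le> R (a @ c)" if "length a = k" "length c = n" for a c
    unfolding R'[OF that(1)] using that by (auto intro: INF_lower)
  show "\<exists>j::int. R' a = ereal (of_int j / real s)" if "length a = k" "R' a \<noteq> \<infinity>" for a
    using attained[OF that(1)] D(4) that by (metis length_append)
  fix N and a :: "'a list" assume N: "N \<ge> ?B" and N1: "N \<ge> 1" and a: "length a = k"
  from N have NB: "N \<ge> B" by auto
  have low: "lower s h ?B N (R' a) \<le> lower s h B N (R (a @ c))" if c: "length c = n" for c
  proof (cases "R' a = \<infinity>")
    case True
    with le[OF a c] have "R (a @ c) = \<infinity>" by simp
    with True lower_mono[of B ?B] show ?thesis by simp
  next
    case False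
    from attained[OF a] obtain d where d: "length d = n" "R' a = R (a @ d)" by auto
    with False D(4)[of "a @ d"] a obtain i :: int where i: "R' a = ereal (of_int i / real s)" by auto
    show ?thesis
    proof (cases "R (a @ c) = \<infinity>")
      \<comment> \<open>An infeasible extension must not undercut the minimum, which is at most
        \<open>C\<close>. This needs \<open>N >= B + s * C\<close>, the origin of the new
        constant.\<close>
      case True
      have "\<bar>of_int i / real s\<bar> \<le> real C"
        using C d i a unfolding bounded_by_def
        by (metis False length_append real_of_ereal.simps(1))
      then have "of_int i / real s \<le> real C" by (rule order_trans[OF abs_ge_self])
      then have "real s * (of_int i / real s) \<le> real s * real C" by (intro mult_left_mono) auto
      also have "\<dots> \<le> real N - real B" using N by (metis add.commute le_diff_eq of_nat_add of_nat_le_iff of_nat_mult)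
      finally have "real N ^ (h + 1) * (real s * (of_int i / real s)) \<le> real N ^ (h + 1) * (real N - real B)"
        by (intro mult_left_mono) auto
      with True i D(1) show ?thesis by (simp add: lower_inf algebra_simps)
    next
      case F: False
      with D(4)[of "a @ c"] a c obtain j :: int where j: "R (a @ c) = ereal (of_int j / real s)" by auto
      with le[OF a c] i have "of_int i / real s \<le> of_int j / real s" by simp
      then have "real s * real N ^ (h + 1) * (of_int i / real s) \<le> real s * real N ^ (h + 1) * (of_int j / real s)"
        by (intro mult_left_mono) auto
      with i j show ?thesis by simp
    qed
  qed
  show "ereal (lower s h ?B N (R' a)) \<le> gval \<Gamma> ts N (a @ b)" if "length b = n + l" for b
  proof -
    define c d where "c = take n b" and "d = drop n b"
    have cd: "a @ b = (a @ c) @ d" "length c = n" "length d = l" using that by (auto simp: c_def d_def)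
    have "ereal (lower s h B N (R (a @ c))) \<le> gval \<Gamma> ts N (a @ b)"
      unfolding cd(1) using D(5)[OF NB, of "a @ c" d] a cd by simp
    with low[OF cd(2)] show ?thesis by (meson ereal_less_eq(3) order_trans)
  qed
  assume fin: "R' a \<noteq> \<infinity>"
  from attained[OF a] obtain c where c: "length c = n" "R' a = R (a @ c)" by auto
  from D(6)[OF NB, of "a @ c"] c a fin obtain b where b: "length b = l"
    "gval \<Gamma> ts N (a @ c @ b) \<le> ereal (lower s h B N (R' a) + real B * real N ^ h)" by auto
  have "lower s h B N (R' a) + real B * real N ^ h \<le> lower s h ?B N (R' a) + real ?B * real N ^ h"
    using fin by (auto simp: lower_def intro!: mult_right_mono)
  with b c show "\<exists>b\<in>tuples (n + l). gval \<Gamma> ts N (a @ b) \<le> ereal (lower s h ?B N (R' a) + real ?B * real N ^ h)"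
    by (intro bexI[of _ "c @ b"]) (auto elim: order_trans)
qed

lemma of_nat_square_power: "real (N ^ 2) ^ m = real N ^ (2 * m)"
  by (simp add: power_mult)

text \<open>With \<open>N ^ 2\<close> for \<open>N\<close>, the costs have exponent
  \<open>2 * h + 2\<close> and infeasibility has \<open>2 * h + 4\<close>. For the new exponent
  \<open>2 * h + 2\<close> in place of \<open>h\<close>, these are the levels of the error and of
  infeasibility, while the level between them is empty: all feasible costs are 0. Adding
  \<open>s * C\<close> units makes the new error non-negative.\<close>

lemma approx_feas:
  assumes "approx \<Gamma> k R l ts s h B" "bounded_by k C R"
    and R': "\<And>a. length a = k \<Longrightarrow> R' a = (if R a = \<infinity> then \<infinity> else 0)"
  shows "approx \<Gamma> k R' l (square (ts @ [(h + 1, [], - int (s * C))])) 1 (2 * h + 2) (2 * s * C + B)"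
proof (rule approxI)
  note D = approxD[OF assms(1)]
  let ?ts = "square (ts @ [(h + 1, [], - int (s * C))])" and ?B = "2 * s * C + B"
  show "(1::nat) > 0" "?B > 0" "wf_gadget \<Gamma> (k + l) ?ts" using D by auto
  show "\<exists>j::int. R' a = ereal (of_int j / real 1)" if "length a = k" "R' a \<noteq> \<infinity>" for a
    using that R'[of a] by (auto intro: exI[of _ 0] split: if_splits)
  have gv: "gval \<Gamma> ?ts N x = gval \<Gamma> ts (N ^ 2) x + ereal (real (s * C) * real N ^ (2 * h + 2))" for N x
    by (simp add: power2_eq_square power_mult algebra_simps)
  fix N and a :: "'a list" assume N: "N \<ge> ?B" and N1: "N \<ge> 1" and a: "length a = k"
  have NN: "N \<le> N ^ 2" using N1 by (simp add: power2_eq_square)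
  with N have NB: "N ^ 2 \<ge> B" by linarith
  have pw: "real (N ^ 2) ^ (h + 1) = real N ^ (2 * h + 2)" "real (N ^ 2) ^ (h + 2) = real N ^ (2 * h + 4)"
    "real (N ^ 2) ^ h = real N ^ (2 * h)"
    unfolding of_nat_square_power by (rule arg_cong[of _ _ "(^) (real N)"], simp)+
  have low: "lower 1 (2 * h + 2) ?B N (R' a) \<le> lower s h B (N ^ 2) (R a) + real (s * C) * real N ^ (2 * h + 2)"
  proof (cases "R a = \<infinity>")
    case True
    have "real B * real N ^ (2 * h + 2) \<le> real ?B * real N ^ (2 * h + 3)"
      using N1 by (intro mult_mono power_increasing) auto
    moreover have "0 \<le> real (s * C) * real N ^ (2 * h + 2)" by simp
    moreover have "lower s h B (N ^ 2) (R a) = real N ^ (2 * h + 4) - real B * real N ^ (2 * h + 2)"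
      using True by (simp only: lower_inf pw)
    moreover have "lower 1 (2 * h + 2) ?B N (R' a) = real N ^ (2 * h + 4) - real ?B * real N ^ (2 * h + 3)"
      using True R'[OF a] unfolding lower_def by (simp add: numeral_eq_Suc)
    ultimately show ?thesis by linarith
  next
    case False
    with assms(2) a have "- real_of_ereal (R a) \<le> real C" unfolding bounded_by_def abs_le_iff by blast
    then have "- real C \<le> real_of_ereal (R a)" by linarith
    then have "real s * real N ^ (2 * h + 2) * (- real C) \<le> real s * real N ^ (2 * h + 2) * real_of_ereal (R a)"
      by (intro mult_left_mono) auto
    moreover have "lower s h B (N ^ 2) (R a) = real s * real N ^ (2 * h + 2) * real_of_ereal (R a)"
      using False unfolding lower_def by (simp only: pw if_False)
    moreover have "lower 1 (2 * h + 2) ?B N (R' a) = 0"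
      using False R'[OF a] by (simp add: lower_def)
    moreover have "real (s * C) * real N ^ (2 * h + 2) = - (real s * real N ^ (2 * h + 2) * (- real C))"
      by simp
    ultimately show ?thesis by linarith
  qed
  show "ereal (lower 1 (2 * h + 2) ?B N (R' a)) \<le> gval \<Gamma> ?ts N (a @ b)" if "length b = l" for b
  proof -
    have "ereal (lower s h B (N ^ 2) (R a) + real (s * C) * real N ^ (2 * h + 2)) \<le> gval \<Gamma> ?ts N (a @ b)"
      unfolding gv plus_ereal.simps(1)[symmetric] by (intro add_mono D(5) NB a that order_refl)
    with low show ?thesis by (meson ereal_less_eq(3) order_trans)
  qed
  assume "R' a \<noteq> \<infinity>"
  with R'[OF a] have fin: "R a \<noteq> \<infinity>" "R' a = 0" by (auto split: if_splits)
  from D(6)[OF NB a fin(1)] obtain b where b: "length b = l"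
    "gval \<Gamma> ts (N ^ 2) (a @ b) \<le> ereal (lower s h B (N ^ 2) (R a) + real B * real N ^ (2 * h))" by (auto simp only: pw mem_Collect_eq)
  have "real_of_ereal (R a) \<le> real C"
    using assms(2) a fin(1) unfolding bounded_by_def abs_le_iff by blast
  then have "real s * real N ^ (2 * h + 2) * real_of_ereal (R a) \<le> real s * real N ^ (2 * h + 2) * real C"
    by (intro mult_left_mono) auto
  moreover have "lower s h B (N ^ 2) (R a) = real s * real N ^ (2 * h + 2) * real_of_ereal (R a)"
    using fin unfolding lower_def by (simp only: pw if_False)
  moreover have "real B * real N ^ (2 * h) \<le> real B * real N ^ (2 * h + 2)"
    using N1 by (intro mult_left_mono power_increasing) auto
  ultimately have "lower s h B (N ^ 2) (R a) + real B * real N ^ (2 * h) + real (s * C) * real N ^ (2 * h + 2)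
      \<le> real ?B * real N ^ (2 * h + 2)" by (simp add: algebra_simps)
  then have "gval \<Gamma> ?ts N (a @ b) \<le> ereal (real ?B * real N ^ (2 * h + 2))"
    unfolding gv using add_mono[OF b(2) order_refl[of "ereal (real (s * C) * real N ^ (2 * h + 2))"]]
    by (auto elim: order_trans)
  with b fin show "\<exists>b\<in>tuples l. gval \<Gamma> ?ts N (a @ b)
      \<le> ereal (lower 1 (2 * h + 2) ?B N (R' a) + real ?B * real N ^ (2 * h + 2))"
    by (intro bexI[of _ b]) (auto simp: lower_def)
qed

text \<open>After the optimum is subtracted, an optimal tuple is left with the error, now of
  exponent \<open>2 * h\<close>, and any other tuple with at least one whole unit
  \<open>N ^ (2 * h + 2)\<close>. For the new exponent \<open>2 * h\<close> in place of
  \<open>h\<close>, this unit is exactly the level of infeasibility.\<close>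

lemma approx_opt:
  assumes "approx \<Gamma> k R l ts s h B" "length a0 = k" and a0: "R a0 = ereal (of_int j / real s)"
    and min: "\<And>a. length a = k \<Longrightarrow> R a0 \<le> R a"
    and R': "\<And>a. length a = k \<Longrightarrow> R' a = (if R a = R a0 then 0 else \<infinity>)"
  shows "approx \<Gamma> k R' l (square (ts @ [(h + 1, [], j)])) 1 (2 * h) (B + nat \<bar>j\<bar> + 1)"
proof (rule approxI)
  note D = approxD[OF assms(1)]
  let ?ts = "square (ts @ [(h + 1, [], j)])" and ?B = "B + nat \<bar>j\<bar> + 1"
  show "(1::nat) > 0" "?B > 0" "wf_gadget \<Gamma> (k + l) ?ts" using D by auto
  show "\<exists>j::int. R' a = ereal (of_int j / real 1)" if "length a = k" "R' a \<noteq> \<infinity>" for a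
    using that R'[of a] by (auto intro: exI[of _ 0] split: if_splits)
  have gv: "gval \<Gamma> ?ts N x = gval \<Gamma> ts (N ^ 2) x + ereal (- (of_int j * real N ^ (2 * h + 2)))" for N x
    by (simp add: power2_eq_square power_mult algebra_simps)
  fix N and a :: "'a list" assume N: "N \<ge> ?B" and N1: "N \<ge> 1" and a: "length a = k"
  have NN: "N \<le> N ^ 2" using N1 by (simp add: power2_eq_square)
  with N have NB: "N ^ 2 \<ge> B" by linarith
  have pw: "real (N ^ 2) ^ (h + 1) = real N ^ (2 * h + 2)" "real (N ^ 2) ^ h = real N ^ (2 * h)"
    unfolding of_nat_square_power by (rule arg_cong[of _ _ "(^) (real N)"], simp)+
  have fin_low: "lower s h B (N ^ 2) (ereal (of_int i / real s)) = of_int i * real N ^ (2 * h + 2)" for i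
    unfolding lower_fin pw using D(1) by simp
  have low: "lower 1 (2 * h) ?B N (R' a) \<le> lower s h B (N ^ 2) (R a) + - (of_int j * real N ^ (2 * h + 2))"
  proof (cases "R a = R a0")
    case True
    with fin_low[of j] a0 R'[OF a] show ?thesis by (simp add: lower_def)
  next
    case F: False
    have 1: "lower 1 (2 * h) ?B N (R' a) \<le> real N ^ (2 * h + 2)"
      using F R'[OF a] by (simp add: lower_def)
    have "(of_int j + 1) * real N ^ (2 * h + 2) \<le> lower s h B (N ^ 2) (R a)"
    proof (cases "R a = \<infinity>")
      case True
      \<comment> \<open>Infeasible tuples must reach the level \<open>j + 1\<close> as well; this is
        what \<open>|j| + 1\<close> in the new constant is for.\<close>
      have "of_int j + 1 + real B \<le> real ?B" by (simp add: of_nat_nat)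
      also have "\<dots> \<le> real (N ^ 2)" using N NN by (meson of_nat_le_iff order_trans)
      finally have "(of_int j + 1) * real (N ^ 2) ^ (h + 1) \<le> (real (N ^ 2) - real B) * real (N ^ 2) ^ (h + 1)"
        by (intro mult_right_mono) auto
      also have "\<dots> = lower s h B (N ^ 2) (R a)" using True by (simp add: lower_inf algebra_simps)
      finally show ?thesis unfolding pw .
    next
      case False
      with D(4)[OF a] obtain i :: int where i: "R a = ereal (of_int i / real s)" by blast
      \<comment> \<open>Costs are multiples of \<open>1/s\<close>, so a cost above the optimum
        exceeds it by at least one unit.\<close>
      with min[OF a] F a0 D(1) have "j < i" by (auto simp: divide_le_cancel divide_less_cancel le_less)
      then have "(of_int j + 1) * real N ^ (2 * h + 2) \<le> of_int i * real N ^ (2 * h + 2)"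
        by (intro mult_right_mono) auto
      with i fin_low show ?thesis by simp
    qed
    with 1 show ?thesis by (simp add: algebra_simps)
  qed
  show "ereal (lower 1 (2 * h) ?B N (R' a)) \<le> gval \<Gamma> ?ts N (a @ b)" if "length b = l" for b
  proof -
    have "ereal (lower s h B (N ^ 2) (R a) + - (of_int j * real N ^ (2 * h + 2))) \<le> gval \<Gamma> ?ts N (a @ b)"
      unfolding gv plus_ereal.simps(1)[symmetric] by (intro add_mono D(5) NB a that order_refl)
    with low show ?thesis by (meson ereal_less_eq(3) order_trans)
  qed
  assume "R' a \<noteq> \<infinity>"
  with R'[OF a] have eq: "R a = R a0" "R' a = 0" by (auto split: if_splits)
  then have "R a \<noteq> \<infinity>" using a0 by simp
  from D(6)[OF NB a this] obtain b where b: "length b = l"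
    "gval \<Gamma> ts (N ^ 2) (a @ b) \<le> ereal (of_int j * real N ^ (2 * h + 2) + real B * real N ^ (2 * h))"
    unfolding eq a0 fin_low pw by auto
  have "gval \<Gamma> ?ts N (a @ b) \<le> ereal (real B * real N ^ (2 * h))"
    unfolding gv using add_mono[OF b(2) order_refl[of "ereal (- (of_int j * real N ^ (2 * h + 2)))"]] by simp
  also have "\<dots> \<le> ereal (real ?B * real N ^ (2 * h))" by (auto intro!: mult_right_mono)
  finally show "\<exists>b\<in>tuples l. gval \<Gamma> ?ts N (a @ b)
      \<le> ereal (lower 1 (2 * h) ?B N (R' a) + real ?B * real N ^ (2 * h))"
    using b eq by (intro bexI[of _ b]) (auto simp: lower_def)
qed


section \<open>Common scales, sums of atoms and common denominators\<close>

definition approximable :: "'c vstruct \<Rightarrow> nat \<Rightarrow> ('c list \<Rightarrow> ereal) \<Rightarrow> bool" where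
  "approximable \<Gamma> k R \<longleftrightarrow> (\<exists>l ts s h B. approx \<Gamma> k R l ts s h B)"

lemma approximableI: "approx \<Gamma> k R l ts s h B \<Longrightarrow> approximable \<Gamma> k R"
  unfolding approximable_def by blast

lemma approximable_cong:
  "approximable \<Gamma> k R \<Longrightarrow> (\<And>a. length a = k \<Longrightarrow> R a = R' a) \<Longrightarrow> approximable \<Gamma> k R'"
  unfolding approximable_def by (meson approx_cong)

lemma bounded_by_finite:
  assumes "finite (R ` tuples k)"
  shows "\<exists>C. bounded_by k C R"
proof -
  let ?V = "(\<lambda>a. \<bar>real_of_ereal (R a)\<bar>) ` tuples k"
  have "?V = (\<lambda>x. \<bar>real_of_ereal x\<bar>) ` R ` tuples k" by (simp add: image_image)
  with assms have "finite ?V" by simp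
  then obtain M where "\<forall>x\<in>?V. x \<le> M" using bdd_above_finite unfolding bdd_above_def by blast
  moreover obtain C where "M \<le> real C" using real_arch_simple by blast
  ultimately have "bounded_by k C R" unfolding bounded_by_def by fastforce
  then show ?thesis ..
qed

text \<open>The parameters are aligned crosswise, as for fractions: each gadget is repeated by the
  scale and raised by the exponent of the other.\<close>

lemma approximable_add:
  assumes "approximable \<Gamma> k R" "approximable \<Gamma> k R'" "finite (R ` tuples k)" "finite (R' ` tuples k)"
  shows "approximable \<Gamma> k (\<lambda>a. R a + R' a)"
proof -
  from assms obtain l ts s h B l' ts' s' h' B'
    where 1: "approx \<Gamma> k R l ts s h B" and 2: "approx \<Gamma> k R' l' ts' s' h' B'"
    by (auto simp: approximable_def)
  note p = approxD(1)[OF 1] approxD(1)[OF 2]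
  have "approx \<Gamma> k R l (repeat s' (raise h' ts)) (s * s') (h + h') (s' * B)"
    by (intro approx_repeat approx_raise 1 p)
  moreover have "approx \<Gamma> k R' l' (repeat s (raise h ts')) (s * s') (h + h') (s * B')"
    using approx_repeat[OF approx_raise[OF 2, of h] p(1)] by (simp add: ac_simps)
  moreover obtain C C' where "bounded_by k C R" "bounded_by k C' R'"
    using assms bounded_by_finite by blast
  ultimately show ?thesis unfolding approximable_def by (blast intro: approx_add)
qed

lemma finite_image_pair:
  assumes "finite (f ` A)" "finite (g ` A)"
  shows "finite ((\<lambda>x. h (f x) (g x)) ` A)"
proof -
  have "(\<lambda>x. h (f x) (g x)) ` A \<subseteq> (\<lambda>(y, z). h y z) ` (f ` A \<times> g ` A)" by auto
  with assms show ?thesis by (meson finite_SigmaI finite_imageI finite_subset)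
qed

lemma approximable_expr:
  assumes "\<And>A. A \<in> set \<phi> \<Longrightarrow> atom_arity_ok fst A \<and> atom_vars A \<subseteq> {..<n} \<and>
    (\<forall>(k, R)\<in>atom_rels A. approximable \<Gamma> k R \<and> finite (R ` tuples k))"
  shows "approximable \<Gamma> n (expr_val snd \<phi>) \<and> finite (expr_val snd \<phi> ` tuples n)"
  using assms
proof (induction \<phi>)
  case Nil
  have "expr_val snd ([] :: (nat \<times> ('a list \<Rightarrow> ereal)) atom list) = (\<lambda>_. 0)" by (auto simp: expr_val_def)
  then show ?case using approximableI[OF approx_zero[of \<Gamma> n]] by (simp add: image_constant_conv)
next
  case (Cons A \<phi>)
  have A: "approximable \<Gamma> n (\<lambda>a. atom_val snd a A) \<and> finite ((\<lambda>a. atom_val snd a A) ` tuples n)"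
  proof (cases A)
    case (Rel R vs)
    obtain k S where R: "R = (k, S)" by (cases R)
    with Cons.prems[of A] Rel have k: "length vs = k" "set vs \<subseteq> {..<n}" "approximable \<Gamma> k S"
      "finite (S ` tuples k)" by auto
    have "(\<lambda>a. S (map ((!) a) vs)) ` tuples n \<subseteq> S ` tuples k" using k by auto
    moreover from k obtain l ts s h B where "approx \<Gamma> k S l ts s h B" by (auto simp: approximable_def)
    note approximableI[OF approx_subst[OF this k(1,2)]]
    ultimately show ?thesis using k(4) Rel R by (auto intro: finite_subset)
  next
    case (Equal i j)
    have "(\<lambda>a. atom_val snd a A) ` tuples n \<subseteq> {0, \<infinity>}" using Equal by auto
    then have "finite ((\<lambda>a. atom_val snd a A) ` tuples n)" by (rule finite_subset) simp
    then show ?thesis using Cons.prems[of A] Equal approximableI[OF approx_Equal[of i n j \<Gamma>]] by auto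
  next
    case (Empty i)
    then show ?thesis using approximableI[OF approx_infinity[of \<Gamma> n]] by (auto simp: image_constant_conv)
  qed
  have IH: "approximable \<Gamma> n (expr_val snd \<phi>) \<and> finite (expr_val snd \<phi> ` tuples n)"
    by (rule Cons.IH, rule Cons.prems) simp
  have "(expr_val snd (A # \<phi>) :: 'a list \<Rightarrow> ereal) = (\<lambda>a. atom_val snd a A + expr_val snd \<phi> a)"
    by (auto simp: expr_val_def)
  with A IH show ?case by (auto intro: approximable_add finite_image_pair)
qed

lemma common_denominator:
  assumes "finite V" "V \<subseteq> rat_inf"
  shows "\<exists>s>0. \<forall>v\<in>V. v \<noteq> \<infinity> \<longrightarrow> (\<exists>j::int. v = ereal (of_int j / real s))"
  using assms
proof (induction V)
  case empty
  then show ?case by (intro exI[of _ 1]) auto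
next
  case (insert v V)
  then obtain s where s: "s > 0" "\<forall>v\<in>V. v \<noteq> \<infinity> \<longrightarrow> (\<exists>j::int. v = ereal (of_int j / real s))" by auto
  show ?case
  proof (cases "v = \<infinity>")
    case True
    with s show ?thesis by auto
  next
    case False
    with insert.prems obtain q :: rat where q: "v = ereal (of_rat q)" by (auto simp: rat_inf_def)
    obtain i d where d: "quotient_of q = (i, d)" by (cases "quotient_of q")
    then have d0: "d > 0" by (rule quotient_of_denom_pos)
    have "of_rat q = (of_int i / of_int d :: real)"
      using quotient_of_div[OF d] by (simp add: of_rat_divide)
    then have v: "v = ereal (of_int (i * int s) / real (s * nat d))" using q s(1) d0 by (simp add: of_nat_nat)
    have "\<exists>j::int. w = ereal (of_int j / real (s * nat d))" if w: "w \<in> V" "w \<noteq> \<infinity>" for w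
    proof -
      from s w obtain j :: int where "w = ereal (of_int j / real s)" by blast
      then have "w = ereal (of_int (j * d) / real (s * nat d))" using d0 by (simp add: of_nat_nat)
      then show ?thesis by blast
    qed
    with v s(1) d0 show ?thesis by (intro exI[of _ "s * nat d"]) (auto simp del: of_nat_mult of_int_mult)
  qed
qed

section \<open>Invariance under automorphisms, and induction on the closure\<close>

definition invariant :: "('c \<Rightarrow> 'c) set \<Rightarrow> nat \<Rightarrow> ('c list \<Rightarrow> ereal) \<Rightarrow> bool" where
  "invariant G k R \<longleftrightarrow> (\<forall>\<alpha>\<in>G. \<forall>a. length a = k \<longrightarrow> R (map \<alpha> a) = R a)"

text \<open>An invariant function is constant on each orbit. This is the place where the definition
  of oligomorphicity enters.\<close>

lemma finite_invariant:
  assumes "oligomorphic G" "id \<in> G" "invariant G k R"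
  shows "finite (R ` tuples k)"
proof -
  let ?o = "\<lambda>a. {map \<alpha> a | \<alpha>. \<alpha> \<in> G}"
  have "R a = the_elem (R ` ?o a)" if "length a = k" for a
  proof -
    have "R ` ?o a = {R a}" using assms(2,3) that unfolding invariant_def by force
    then show ?thesis by simp
  qed
  then have "R ` tuples k \<subseteq> (\<lambda>X. the_elem (R ` X)) ` ?o ` tuples k" by (auto simp: image_image)
  with assms(1) show ?thesis unfolding oligomorphic_def by (meson finite_imageI finite_subset)
qed

lemma invariant_expr:
  assumes "\<And>A. A \<in> set \<phi> \<Longrightarrow> atom_arity_ok fst A \<and> atom_vars A \<subseteq> {..<n} \<and>
    (\<forall>(k, R)\<in>atom_rels A. invariant G k R)" and "\<And>\<alpha>. \<alpha> \<in> G \<Longrightarrow> inj \<alpha>"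
  shows "invariant G n (expr_val snd \<phi>)"
  unfolding invariant_def
proof (intro ballI allI impI)
  fix \<alpha> and a :: "'a list" assume \<alpha>: "\<alpha> \<in> G" and a: "length a = n"
  have "atom_val snd (map \<alpha> a) A = atom_val snd a A" if A: "A \<in> set \<phi>" for A
  proof (cases A)
    case (Rel R vs)
    obtain k S where R: "R = (k, S)" by (cases R)
    have inv: "invariant G k S" "length vs = k" "set vs \<subseteq> {..<n}" using assms(1)[OF A] Rel R by auto
    then have eq: "map ((!) (map \<alpha> a)) vs = map \<alpha> (map ((!) a) vs)" using a by auto
    have "S (map ((!) (map \<alpha> a)) vs) = S (map ((!) a) vs)"
      unfolding eq using inv \<alpha> by (auto simp: invariant_def simp del: map_map)
    then show ?thesis by (simp only: Rel R atom_val.simps snd_conv)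
  next
    case (Equal i j)
    then show ?thesis using assms(1)[OF A] a assms(2)[OF \<alpha>] by (auto dest: injD)
  qed auto
  then show "expr_val snd \<phi> (map \<alpha> a) = expr_val snd \<phi> a"
    unfolding expr_val_def by (auto intro!: arg_cong[of _ _ sum_list])
qed

text \<open>A bijection of the domain permutes the tuples over which the infimum ranges.\<close>

lemma invariant_project:
  assumes "invariant G (k + n) R" "\<And>\<alpha>. \<alpha> \<in> G \<Longrightarrow> bij \<alpha>"
  shows "invariant G k (\<lambda>a. INF b\<in>tuples n. R (a @ b))"
  unfolding invariant_def
proof (intro ballI allI impI)
  fix \<alpha> and a :: "'a list" assume \<alpha>: "\<alpha> \<in> G" and a: "length a = k"
  have "b \<in> map \<alpha> ` tuples n" if "length b = n" for b
  proof -
    have "\<alpha> \<circ> inv \<alpha> = id"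
      using bij_is_surj[OF assms(2)[OF \<alpha>]] surj_iff by blast
    with that show ?thesis by (intro image_eqI[of _ _ "map (inv \<alpha>) b"]) auto
  qed
  then have t: "tuples n = map \<alpha> ` tuples n" by auto
  have "(INF b\<in>tuples n. R (map \<alpha> a @ b)) = (INF b\<in>tuples n. R (map \<alpha> (a @ b)))"
    by (subst t) (simp add: image_image)
  also have "\<dots> = (INF b\<in>tuples n. R (a @ b))"
    using assms(1) \<alpha> a by (intro INF_cong) (auto simp: invariant_def simp del: map_append)
  finally show "(INF b\<in>tuples n. R (map \<alpha> a @ b)) = (INF b\<in>tuples n. R (a @ b))" .
qed

text \<open>Invariance accompanies the induction because it yields a finite range, on which attained
  infima and the bounds \<open>C\<close> rest.\<close>

theorem approximable_wclone:
  assumes vs: "valued_structure \<Gamma>" and olig: "oligomorphic (Aut \<Gamma>)" and "(k, R) \<in> wclone \<Gamma>"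
  shows "invariant (Aut \<Gamma>) k R \<and> approximable \<Gamma> k R"
proof -
  have id: "id \<in> Aut \<Gamma>" by (simp add: Aut_def)
  have bij: "bij \<alpha>" "inj \<alpha>" if "\<alpha> \<in> Aut \<Gamma>" for \<alpha> using that by (auto simp: Aut_def bij_def)
  note fin = finite_invariant[OF olig id]
  let ?P = "\<lambda>(k, R). invariant (Aut \<Gamma>) k R \<and> approximable \<Gamma> k R"
  have "?P (k, R)" using assms(3)
  proof (induction rule: wclone.induct)
    case (base r)
    have inv: "invariant (Aut \<Gamma>) (arity \<Gamma> r) (cost \<Gamma> r)"
      using base by (auto simp: invariant_def Aut_def)
    have "cost \<Gamma> r ` tuples (arity \<Gamma> r) \<subseteq> rat_inf"
      using vs base by (auto simp: valued_structure_def valued_relations_def)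
    from common_denominator[OF fin[OF inv] this] obtain s where "s > 0" and
      "\<And>a. length a = arity \<Gamma> r \<Longrightarrow> cost \<Gamma> r a \<noteq> \<infinity> \<Longrightarrow> \<exists>j::int. cost \<Gamma> r a = ereal (of_int j / real s)"
      by auto
    from approximableI[OF approx_base[OF base this]] inv show ?case by simp
  next
    case (sum \<phi> n)
    have 1: "atom_arity_ok fst A \<and> atom_vars A \<subseteq> {..<n} \<and> (\<forall>(k, R)\<in>atom_rels A. invariant (Aut \<Gamma>) k R)"
      "atom_arity_ok fst A \<and> atom_vars A \<subseteq> {..<n} \<and>
        (\<forall>(k, R)\<in>atom_rels A. approximable \<Gamma> k R \<and> finite (R ` tuples k))" if "A \<in> set \<phi>" for A
      using sum.IH that fin by (auto simp: split_beta)
    have "invariant (Aut \<Gamma>) n (expr_val snd \<phi>)" by (rule invariant_expr) (use 1 bij in auto)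
    moreover have "approximable \<Gamma> n (expr_val snd \<phi>)" using approximable_expr[of \<phi> n \<Gamma>] 1 by blast
    ultimately show ?case by (auto simp: invariant_def elim: approximable_cong)
  next
    case (project k n R R')
    then have inv: "invariant (Aut \<Gamma>) (k + n) R" by auto
    from bounded_by_finite[OF fin[OF inv]] obtain C where "bounded_by (k + n) C R" ..
    moreover from project.IH obtain l ts s h B where "approx \<Gamma> (k + n) R l ts s h B"
      by (auto simp: approximable_def)
    ultimately have "approximable \<Gamma> k R'"
      using approx_project[of \<Gamma> k n R l ts s h B R'] fin[OF inv] project.hyps unfolding approximable_def
      by (metis (mono_tags, lifting) mem_Collect_eq restrict_apply')
    moreover have "invariant (Aut \<Gamma>) k R'"
      using invariant_project[OF inv bij(1)] project.hyps by (auto simp: invariant_def)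
    ultimately show ?case by simp
  next
    case (scale k R q)
    from scale.IH obtain l ts s h B where ap: "approx \<Gamma> k R l ts s h B" by (auto simp: approximable_def)
    obtain i d where d: "quotient_of q = (i, d)" by (cases "quotient_of q")
    then have d0: "d > 0" by (rule quotient_of_denom_pos)
    have q: "q = of_int i / of_int d" by (rule quotient_of_div[OF d])
    have inv: "invariant (Aut \<Gamma>) k (\<lambda>a\<in>tuples k. ereal (of_rat q) * R a)"
      using scale.IH by (auto simp: invariant_def)
    show ?case
    proof (cases "q = 0")
      \<comment> \<open>By the convention that 0 times infinity is 0, scaling by 0 makes every tuple
        feasible, so the old gadget is of no use.\<close>
      case True
      have "approximable \<Gamma> k (\<lambda>_. 0)" by (rule approximableI[OF approx_zero])
      then have "approximable \<Gamma> k (\<lambda>a\<in>tuples k. ereal (of_rat q) * R a)"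
        by (rule approximable_cong) (use True in \<open>auto simp flip: zero_ereal_def\<close>)
      with inv show ?thesis by simp
    next
      case False
      with scale.hyps have "q > 0" by simp
      with q d0 have i0: "i > 0" by (simp add: zero_less_divide_iff)
      have "real_of_rat q = real (nat i) / real (nat d)" using q i0 d0 by (simp add: of_rat_divide of_nat_nat)
      then have "approximable \<Gamma> k (\<lambda>a. ereal (of_rat q) * R a)"
        using approximableI[OF approx_scale[OF ap, of "nat i" "nat d"]] i0 d0 by simp
      then have "approximable \<Gamma> k (\<lambda>a\<in>tuples k. ereal (of_rat q) * R a)"
        by (rule approximable_cong) auto
      with inv show ?thesis by simp
    qed
  next
    case (shift k R q)
    from shift.IH obtain l ts s h B where ap: "approx \<Gamma> k R l ts s h B" by (auto simp: approximable_def)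
    obtain i d where d: "quotient_of q = (i, d)" by (cases "quotient_of q")
    then have d0: "d > 0" by (rule quotient_of_denom_pos)
    have s0: "s > 0" using approxD(1)[OF ap] .
    have "real_of_rat q = of_int (int s * i) / real (s * nat d)"
      using quotient_of_div[OF d] d0 s0 by (simp add: of_rat_divide of_nat_nat)
    \<comment> \<open>Refining the scale by the denominator \<open>d\<close> of the shift makes the
      shift an integral number of units.\<close>
    moreover have "approx \<Gamma> k R l (repeat (nat d) ts) (s * nat d) h (nat d * B)"
      using approx_repeat[OF ap] d0 by simp
    note approximableI[OF approx_add_const[OF this, of "int s * i"]]
    ultimately have "approximable \<Gamma> k (\<lambda>a. R a + ereal (of_rat q))" by simp
    then have "approximable \<Gamma> k (\<lambda>a\<in>tuples k. R a + ereal (of_rat q))"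
      by (rule approximable_cong) auto
    with shift.IH show ?case by (auto simp: invariant_def)
  next
    case (feas k R)
    then have inv: "invariant (Aut \<Gamma>) k R" by auto
    from feas.IH obtain l ts s h B where ap: "approx \<Gamma> k R l ts s h B" by (auto simp: approximable_def)
    from bounded_by_finite[OF fin[OF inv]] obtain C where "bounded_by k C R" ..
    then have "approximable \<Gamma> k (crisp k (Feas k R))"
      by (rule approximableI[OF approx_feas[OF ap]]) (auto simp: crisp_def Feas_def)
    moreover have "invariant (Aut \<Gamma>) k (crisp k (Feas k R))"
      using inv by (auto simp: invariant_def crisp_def Feas_def)
    ultimately show ?case by simp
  next
    case (opt k R)
    then have inv: "invariant (Aut \<Gamma>) k R" by auto
    from opt.IH obtain l ts s h B where ap: "approx \<Gamma> k R l ts s h B" by (auto simp: approximable_def)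
    have "approximable \<Gamma> k (crisp k (Opt k R))"
    proof (cases "Opt k R = {}")
      \<comment> \<open>Without an optimal tuple there is no value to subtract; the relation is
        constantly infinite.\<close>
      case True
      have "approximable \<Gamma> k (\<lambda>_. \<infinity>)" by (rule approximableI[OF approx_infinity])
      then show ?thesis by (rule approximable_cong) (use True in \<open>auto simp: crisp_def\<close>)
    next
      case False
      then obtain a0 where a0: "length a0 = k" "R a0 \<noteq> \<infinity>" "\<And>a. length a = k \<Longrightarrow> R a0 \<le> R a"
        by (auto simp: Opt_def Feas_def)
      with approxD(4)[OF ap] obtain j :: int where j: "R a0 = ereal (of_int j / real s)" by blast
      have "crisp k (Opt k R) a = (if R a = R a0 then 0 else \<infinity>)" if "length a = k" for a
        using that a0 by (fastforce simp: crisp_def Opt_def Feas_def less_top[symmetric] top_ereal_def)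
      from approx_opt[OF ap a0(1) j a0(3) this] show ?thesis unfolding approximable_def by blast
    qed
    moreover have "invariant (Aut \<Gamma>) k (crisp k (Opt k R))"
      using inv by (auto simp: invariant_def crisp_def Opt_def Feas_def)
    ultimately show ?case by simp
  qed
  then show ?thesis by simp
qed

section \<open>The reduction\<close>

lemma expr_val_Nil [simp]: "expr_val I [] a = 0"
  by (simp add: expr_val_def)

lemma expr_val_Cons: "expr_val I (A # \<phi>) a = atom_val I a A + expr_val I \<phi> a"
  by (simp add: expr_val_def)

lemma expr_val_append: "expr_val I (\<phi> @ \<psi>) a = expr_val I \<phi> a + expr_val I \<psi> a"
  by (simp add: expr_val_def)

lemma expr_val_replicate:
  "expr_val I (concat (replicate m \<phi>)) a = ereal (real m) * expr_val I \<phi> a"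
proof (induction m)
  case (Suc m)
  have "ereal (real (Suc m)) = 1 + ereal (real m)" by simp
  then have "ereal (real (Suc m)) * expr_val I \<phi> a = expr_val I \<phi> a + ereal (real m) * expr_val I \<phi> a"
    by (simp only:) (subst ereal_left_distrib, auto)
  with Suc show ?case by (simp add: expr_val_append)
qed simp

lemma add_minus_split:
  "a + b + ereal (- of_int (x + y)) = (a + ereal (- of_int x)) + (b + ereal (- of_int y))"
  by (cases a; cases b) auto

text \<open>For an atom with arguments \<open>vs\<close>, the parameters of the gadget become the
  arguments, and its auxiliary variables are numbered from \<open>f\<close> on.\<close>

definition place :: "nat \<Rightarrow> nat list \<Rightarrow> nat \<Rightarrow> nat" where
  "place f vs i = (if i < length vs then vs ! i else f + (i - length vs))"

text \<open>Apart from the clamping, this is the floor of \<open>s * u\<close>, plus 1. For negative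
  \<open>u\<close> it is written with a quotient of non-negative integers, which is what the program
  computes.\<close>

definition clamp :: "nat \<Rightarrow> nat \<Rightarrow> rat \<Rightarrow> int" where
  "clamp s N u = (case quotient_of u of (p, q) \<Rightarrow>
     if p < 0 then - min (int N) ((int s * \<bar>p\<bar> - 1) div q) else min (int N) (int s * p div q) + 1)"

lemma le_zdiv_iff:
  fixes m n q :: int
  assumes "q > 0"
  shows "m \<le> n div q \<longleftrightarrow> m * q \<le> n"
proof
  assume "m \<le> n div q"
  then have "m * q \<le> n div q * q" using assms by simp
  also have "\<dots> \<le> n" using assms by (simp add: minus_mod_eq_div_mult[symmetric])
  finally show "m * q \<le> n" .
next
  assume "m * q \<le> n"
  from zdiv_mono1[OF this assms] assms show "m \<le> n div q" by simp
qed

text \<open>An integer is at most \<open>s * u\<close> iff it is less than the floor of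
  \<open>s * u\<close> plus 1, and clamping at distance \<open>N\<close> from 0 is invisible to
  integers below \<open>N\<close> in absolute value.\<close>

lemma clamp:
  assumes "s > 0" "\<bar>j\<bar> < int N"
  shows "j < clamp s N u \<longleftrightarrow> of_int j / real s \<le> of_rat u"
proof -
  obtain p q where u: "quotient_of u = (p, q)" by (cases "quotient_of u")
  have q: "q > 0" using quotient_of_denom_pos[OF u] .
  have "real_of_rat u = of_int p / of_int q" using quotient_of_div[OF u] by (simp add: of_rat_divide)
  then have "of_int j / real s \<le> of_rat u \<longleftrightarrow> of_int j / real s \<le> of_int p / real_of_int q"
    by (simp only:)
  also have "\<dots> \<longleftrightarrow> real_of_int j * of_int q \<le> of_int p * real s"
    using assms(1) q by (simp add: pos_divide_le_eq pos_le_divide_eq)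
  also have "\<dots> \<longleftrightarrow> j * q \<le> p * int s"
    by (metis of_int_le_iff of_int_mult of_int_of_nat_eq)
  finally have 1: "of_int j / real s \<le> of_rat u \<longleftrightarrow> j * q \<le> int s * p" by (simp add: mult.commute)
  show ?thesis
  proof (cases "p < 0")
    case True
    have "j < clamp s N u \<longleftrightarrow> min (int N) ((int s * \<bar>p\<bar> - 1) div q) < - j"
      unfolding clamp_def u using True by auto
    also have "\<dots> \<longleftrightarrow> (int s * \<bar>p\<bar> - 1) div q < - j" using assms(2) by auto
    also have "\<dots> \<longleftrightarrow> int s * \<bar>p\<bar> - 1 < - j * q"
      using q le_zdiv_iff[of q "- j" "int s * \<bar>p\<bar> - 1"] by linarith
    also have "\<dots> \<longleftrightarrow> j * q \<le> int s * p" using True by auto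
    finally show ?thesis using 1 by simp
  next
    case False
    have "j < clamp s N u \<longleftrightarrow> j \<le> int s * p div q"
      unfolding clamp_def u using False assms(2) by auto
    also have "\<dots> \<longleftrightarrow> j * q \<le> int s * p" using q by (rule le_zdiv_iff)
    finally show ?thesis using 1 by simp
  qed
qed

lemma clamp_le: "s > 0 \<Longrightarrow> clamp s N u \<le> int N + 1"
proof -
  assume s: "s > 0"
  obtain p q where u: "quotient_of u = (p, q)" by (cases "quotient_of u")
  have q: "q > 0" using quotient_of_denom_pos[OF u] .
  show ?thesis
  proof (cases "p < 0")
    case True
    then have "int s * \<bar>p\<bar> > 0" using s by (intro mult_pos_pos) auto
    then have "0 \<le> (int s * \<bar>p\<bar> - 1) div q" using q by (simp add: pos_imp_zdiv_nonneg_iff del: abs_of_neg)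
    with True show ?thesis by (auto simp: clamp_def u)
  qed (auto simp: clamp_def u)
qed

section \<open>Translation of instances\<close>

locale gadget_family =
  fixes l :: "nat \<Rightarrow> nat" and g :: "nat \<Rightarrow> gadget" and s H :: nat
begin

fun aux :: "nat atom \<Rightarrow> nat" where
  "aux (Rel r vs) = l r"
| "aux _ = 0"

definition copies :: "nat \<Rightarrow> (nat \<Rightarrow> nat) \<Rightarrow> gadget \<Rightarrow> nat atom list" where
  "copies N \<sigma> ts = concat (map (\<lambda>(p, e, z). concat (replicate (N ^ p) (map (rename_atom \<sigma>) e))) ts)"

text \<open>Equality and empty atoms only take the values 0 and infinity, which positive weights do
  not change; one copy is enough.\<close>

fun emit :: "nat \<Rightarrow> nat \<Rightarrow> nat atom \<Rightarrow> nat atom list" where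
  "emit N f (Rel r vs) = copies N (place f vs) (g r)"
| "emit N f A = [A]"

fun emits :: "nat \<Rightarrow> nat \<Rightarrow> nat atom list \<Rightarrow> nat atom list" where
  "emits N f [] = []"
| "emits N f (A # \<phi>) = emit N f A @ emits N (f + aux A) \<phi>"

definition offset_of :: "nat \<Rightarrow> gadget \<Rightarrow> int" where
  "offset_of N ts = (\<Sum>(p, e, z)\<leftarrow>ts. int N ^ p * z)"

fun atom_offset :: "nat \<Rightarrow> nat atom \<Rightarrow> int" where
  "atom_offset N (Rel r vs) = offset_of N (g r)"
| "atom_offset N _ = 0"

definition fresh :: "nat \<Rightarrow> nat atom list \<Rightarrow> nat" where
  "fresh f \<phi> = f + (\<Sum>A\<leftarrow>\<phi>. aux A)"

text \<open>The comparison \<open>j < clamp s N u\<close> is strict while a threshold may be met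
  with equality; hence the \<open>- 1\<close>.\<close>

definition threshold :: "nat \<Rightarrow> nat atom list \<Rightarrow> rat \<Rightarrow> int" where
  "threshold N \<phi> u = (\<Sum>A\<leftarrow>\<phi>. atom_offset N A) + int N ^ H * clamp s N u - 1"

fun reduce :: "nat \<Rightarrow> vcsp_instance \<Rightarrow> vcsp_instance" where
  "reduce N (n, \<phi>, u) = (fresh n \<phi>, emits N n \<phi>, of_int (threshold N \<phi> u))"

end

lemma gval_copies:
  "expr_val (cost \<Gamma>) (gadget_family.copies N \<sigma> ts) c + ereal (- of_int (gadget_family.offset_of N ts))
    = gval \<Gamma> (rename \<sigma> ts) N c"
proof (induction ts)
  case Nil
  then show ?case
    by (simp add: gadget_family.copies_def gadget_family.offset_of_def rename_def flip: zero_ereal_def)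
next
  case (Cons t ts)
  obtain p e z where t: "t = (p, e, z)" by (cases t)
  let ?x = "expr_val (cost \<Gamma>) (map (rename_atom \<sigma>) e) c"
  have "expr_val (cost \<Gamma>) (gadget_family.copies N \<sigma> (t # ts)) c + ereal (- of_int (gadget_family.offset_of N (t # ts)))
    = (ereal (real (N ^ p)) * ?x + ereal (- of_int (int N ^ p * z))) +
     (expr_val (cost \<Gamma>) (gadget_family.copies N \<sigma> ts) c + ereal (- of_int (gadget_family.offset_of N ts)))"
    unfolding t gadget_family.copies_def gadget_family.offset_of_def list.map concat.simps prod.case
      expr_val_append expr_val_replicate sum_list.Cons
    by (rule add_minus_split)
  also have "ereal (real (N ^ p)) * ?x + ereal (- of_int (int N ^ p * z))
      = ereal (real N ^ p) * ?x + ereal (- (real N ^ p * of_int z))" by simp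
  also have "ereal (real N ^ p) * ?x + ereal (- (real N ^ p * of_int z)) = ereal (real N ^ p) * (?x + ereal (- of_int z))"
    by (subst ereal_pos_distrib) auto
  finally show ?case unfolding Cons.IH t by (simp add: rename_def gval_Cons)
qed

text \<open>All gadgets \<open>ts r\<close> share scale, exponent and constant, and their squares
  are emitted. Effectively they run at \<open>N ^ 2\<close>, which can exceed a loss that is
  quadratic in the number of atoms although \<open>N\<close> is only linear. The costs then have
  exponent \<open>2 * h + 2\<close>.\<close>

locale reduction = gadget_family l g s "2 * h + 2"
  for \<Gamma> \<Delta> :: "'c vstruct" and l g s h +
  fixes ts :: "nat \<Rightarrow> gadget" and B C :: nat
  assumes approx: "\<And>r. r \<in> symbols \<Delta> \<Longrightarrow> approx \<Gamma> (arity \<Delta> r) (cost \<Delta> r) (l r) (ts r) s h B"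
    and g: "\<And>r. r \<in> symbols \<Delta> \<Longrightarrow> g r = square (ts r)"
    and bound: "\<And>r. r \<in> symbols \<Delta> \<Longrightarrow> bounded_by (arity \<Delta> r) C (cost \<Delta> r)"
    and sB: "s > 0" "B > 0"
begin

definition excess :: "nat \<Rightarrow> nat \<Rightarrow> nat atom \<Rightarrow> 'c list \<Rightarrow> ereal" where
  "excess N f A c = expr_val (cost \<Gamma>) (emit N f A) c + ereal (- of_int (atom_offset N A))"

definition total_excess :: "nat \<Rightarrow> nat \<Rightarrow> nat atom list \<Rightarrow> 'c list \<Rightarrow> ereal" where
  "total_excess N f \<phi> c = expr_val (cost \<Gamma>) (emits N f \<phi>) c + ereal (- of_int (\<Sum>A\<leftarrow>\<phi>. atom_offset N A))"

lemma total_excess_Nil [simp]: "total_excess N f [] c = 0"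
  by (simp add: total_excess_def flip: zero_ereal_def)

lemma total_excess_Cons:
  "total_excess N f (A # \<phi>) c = excess N f A c + total_excess N (f + aux A) \<phi> c"
  unfolding total_excess_def excess_def emits.simps expr_val_append list.map sum_list.Cons
  by (rule add_minus_split)

lemma gadget_wf:
  assumes "wf_atom \<Delta> n (Rel r vs)"
  shows "r \<in> symbols \<Delta>" "length vs = arity \<Delta> r" "wf_gadget \<Gamma> (length vs + l r) (g r)" "set vs \<subseteq> {..<n}"
  using assms approxD(3)[OF approx[of r]] g[of r] by (auto simp: wf_atom_def)

text \<open>The first \<open>n\<close> entries of \<open>c\<close> are the original variables, and
  this atom owns the block of \<open>l r\<close> entries from position \<open>f\<close> on.\<close>

lemma excess_Rel:
  assumes wf: "wf_atom \<Delta> n (Rel r vs)" and n: "n \<le> f" and c: "length c \<ge> f + l r"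
  shows "excess N f (Rel r vs) c = gval \<Gamma> (ts r) (N ^ 2) (map ((!) (take n c)) vs @ take (l r) (drop f c))"
proof -
  note w = gadget_wf[OF wf]
  have vs: "vs ! i < n" if "i < length vs" for i using w(4) that by (meson lessThan_iff nth_mem subsetD)
  have "excess N f (Rel r vs) c = gval \<Gamma> (rename (place f vs) (g r)) N c"
    unfolding excess_def by (simp add: gval_copies)
  also have "\<dots> = gval \<Gamma> (g r) N (map ((!) (take n c)) vs @ take (l r) (drop f c))"
    by (rule gval_rename[OF w(3)]) (use c n vs in \<open>auto simp: place_def nth_append\<close>)
  also have "\<dots> = gval \<Gamma> (ts r) (N ^ 2) (map ((!) (take n c)) vs @ take (l r) (drop f c))"
    using g[OF w(1)] by simp
  finally show ?thesis .
qed

lemma excess_lower: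
  assumes wf: "wf_atom \<Delta> n A" and n: "n \<le> f" and c: "length c \<ge> f + aux A" and N: "N ^ 2 \<ge> B"
  shows "ereal (lower s h B (N ^ 2) (atom_val (cost \<Delta>) (take n c) A)) \<le> excess N f A c"
proof (cases A)
  case (Rel r vs)
  note wf' = wf[unfolded Rel] and c' = c[unfolded Rel, simplified]
  show ?thesis unfolding Rel excess_Rel[OF wf' n c']
    using approxD(5)[OF approx[OF gadget_wf(1)[OF wf']] N, of "map ((!) (take n c)) vs" "take (l r) (drop f c)"]
      gadget_wf(2)[OF wf'] c' by simp
next
  case (Equal i j)
  then show ?thesis using wf n c
    by (auto simp: excess_def wf_atom_def lower_def expr_val_Cons simp flip: zero_ereal_def)
next
  case (Empty i)
  then show ?thesis by (simp add: excess_def expr_val_Cons)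
qed

text \<open>The block \<open>b\<close> is good whatever follows it, hence the arbitrary
  \<open>y\<close>; so the blocks of successive atoms can be chosen one after the other.\<close>

lemma excess_upper:
  assumes wf: "wf_atom \<Delta> n A" and n: "n \<le> f" and a: "length a = f" and N: "N ^ 2 \<ge> B"
    and fin: "atom_val (cost \<Delta>) (take n a) A \<noteq> \<infinity>"
  shows "\<exists>b. length b = aux A \<and> (\<forall>y. excess N f A (a @ b @ y)
    \<le> ereal (lower s h B (N ^ 2) (atom_val (cost \<Delta>) (take n a) A) + real B * real (N ^ 2) ^ h))"
proof (cases A)
  case (Rel r vs)
  note wf' = wf[unfolded Rel] and fin' = fin[unfolded Rel, simplified]
  from approxD(6)[OF approx[OF gadget_wf(1)[OF wf']] N _ fin'] gadget_wf(2)[OF wf']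
  obtain b where b: "length b = l r"
    "gval \<Gamma> (ts r) (N ^ 2) (map ((!) (take n a)) vs @ b)
      \<le> ereal (lower s h B (N ^ 2) (cost \<Delta> r (map ((!) (take n a)) vs)) + real B * real (N ^ 2) ^ h)" by auto
  then show ?thesis unfolding Rel using excess_Rel[OF wf' n, of "a @ b @ y" N for y] a n
    by (intro exI[of _ b]) auto
next
  case (Equal i j)
  then show ?thesis using wf n a fin
    by (intro exI[of _ "[]"])
      (auto simp: excess_def wf_atom_def lower_def expr_val_Cons nth_append split: if_splits simp flip: zero_ereal_def)
next
  case (Empty i)
  with fin show ?thesis by simp
qed

lemma atom_val_bound:
  assumes "wf_atom \<Delta> n A" "length a = n"
  shows "atom_val (cost \<Delta>) a A \<noteq> -\<infinity>"
    "atom_val (cost \<Delta>) a A \<noteq> \<infinity> \<Longrightarrow> \<bar>real_of_ereal (atom_val (cost \<Delta>) a A)\<bar> \<le> real C"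
    "atom_val (cost \<Delta>) a A \<noteq> \<infinity> \<Longrightarrow> \<exists>j::int. atom_val (cost \<Delta>) a A = ereal (of_int j / real s)"
proof -
  have *: "atom_val (cost \<Delta>) a A \<noteq> -\<infinity> \<and>
    (atom_val (cost \<Delta>) a A \<noteq> \<infinity> \<longrightarrow> \<bar>real_of_ereal (atom_val (cost \<Delta>) a A)\<bar> \<le> real C \<and>
      (\<exists>j::int. atom_val (cost \<Delta>) a A = ereal (of_int j / real s)))"
  proof (cases A)
    case (Rel r vs)
    note w = gadget_wf[OF assms(1)[unfolded Rel]]
    have len: "length (map ((!) a) vs) = arity \<Delta> r" using w(2) by simp
    note approx_not_MInf[OF approx[OF w(1)] len] approxD(4)[OF approx[OF w(1)] len]
      bound[OF w(1), unfolded bounded_by_def, rule_format, OF len]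
    then show ?thesis unfolding Rel atom_val.simps by blast
  next
    case (Equal i j)
    then show ?thesis by (auto intro: exI[of _ 0])
  qed auto
  then show "atom_val (cost \<Delta>) a A \<noteq> -\<infinity>"
    "atom_val (cost \<Delta>) a A \<noteq> \<infinity> \<Longrightarrow> \<bar>real_of_ereal (atom_val (cost \<Delta>) a A)\<bar> \<le> real C"
    "atom_val (cost \<Delta>) a A \<noteq> \<infinity> \<Longrightarrow> \<exists>j::int. atom_val (cost \<Delta>) a A = ereal (of_int j / real s)" by blast+
qed

lemma expr_val_bound:
  assumes "\<forall>A\<in>set \<phi>. wf_atom \<Delta> n A" "length a = n"
  shows "expr_val (cost \<Delta>) \<phi> a \<noteq> -\<infinity> \<and> (expr_val (cost \<Delta>) \<phi> a \<noteq> \<infinity> \<longrightarrow>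
    \<bar>real_of_ereal (expr_val (cost \<Delta>) \<phi> a)\<bar> \<le> real (length \<phi> * C) \<and>
    (\<exists>j::int. expr_val (cost \<Delta>) \<phi> a = ereal (of_int j / real s)))"
  using assms(1)
proof (induction \<phi>)
  case Nil
  then show ?case by (auto intro: exI[of _ 0])
next
  case (Cons A \<phi>)
  let ?x = "atom_val (cost \<Delta>) a A" and ?y = "expr_val (cost \<Delta>) \<phi> a"
  note A = atom_val_bound[OF _ assms(2), of A] and IH = Cons.IH
  show ?case
  proof (cases "?x = \<infinity> \<or> ?y = \<infinity>")
    case True
    then have "expr_val (cost \<Delta>) (A # \<phi>) a = \<infinity>" by (auto simp: expr_val_Cons)
    then show ?thesis by simp
  next
    case False
    with A IH Cons.prems obtain i j :: int where ij: "?x = ereal (of_int i / real s)" "?y = ereal (of_int j / real s)"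
      by (meson list.set_intros)
    with A IH Cons.prems False have "\<bar>of_int i / real s\<bar> \<le> real C" "\<bar>of_int j / real s\<bar> \<le> real (length \<phi> * C)"
      by auto
    then have "\<bar>of_int i / real s + of_int j / real s\<bar> \<le> real C + real (length \<phi> * C)"
      by (meson abs_triangle_ineq add_mono order_trans)
    moreover have sum: "of_int i / real s + of_int j / real s = of_int (i + j) / real s"
      by (simp add: add_divide_distrib)
    moreover from ij sum have "expr_val (cost \<Delta>) (A # \<phi>) a = ereal (of_int (i + j) / real s)"
      by (simp add: expr_val_Cons)
    moreover from this have "\<exists>j::int. expr_val (cost \<Delta>) (A # \<phi>) a = ereal (of_int j / real s)" by blast
    ultimately show ?thesis by (simp add: algebra_simps)
  qed
qed

text \<open>By \<open>lower_add\<close>, a further atom in front of \<open>m\<close> others enlarges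
  the constant by \<open>B + s * C + s * (m * C)\<close>. Summing up gives a quadratic
  bound.\<close>

lemma total_excess_lower:
  assumes "\<forall>A\<in>set \<phi>. wf_atom \<Delta> n A" "n \<le> f" "length c \<ge> fresh f \<phi>" "N ^ 2 \<ge> B" "N \<ge> 1"
  shows "ereal (lower s h (length \<phi> * B + s * C * length \<phi> * length \<phi>) (N ^ 2) (expr_val (cost \<Delta>) \<phi> (take n c)))
    \<le> total_excess N f \<phi> c"
  using assms(1-3)
proof (induction \<phi> arbitrary: f)
  case Nil
  then show ?case by (simp add: lower_def)
next
  case (Cons A \<phi>)
  let ?m = "length \<phi>" and ?x = "atom_val (cost \<Delta>) (take n c) A" and ?y = "expr_val (cost \<Delta>) \<phi> (take n c)"
  let ?B = "?m * B + s * C * ?m * ?m"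
  have len: "length (take n c) = n" using Cons.prems by (simp add: fresh_def)
  have 1: "ereal (lower s h B (N ^ 2) ?x) \<le> excess N f A c"
    by (rule excess_lower) (use Cons.prems assms(4) in \<open>auto simp: fresh_def\<close>)
  have 2: "ereal (lower s h ?B (N ^ 2) ?y) \<le> total_excess N (f + aux A) \<phi> c"
    by (rule Cons.IH) (use Cons.prems in \<open>auto simp: fresh_def\<close>)
  have "lower s h (length (A # \<phi>) * B + s * C * length (A # \<phi>) * length (A # \<phi>)) (N ^ 2) (?x + ?y)
      \<le> lower s h (B + ?B + s * C + s * (?m * C)) (N ^ 2) (?x + ?y)"
    by (rule lower_mono) (simp add: algebra_simps)
  also have "\<dots> \<le> lower s h B (N ^ 2) ?x + lower s h ?B (N ^ 2) ?y"
    by (rule lower_add) (use Cons.prems(1) atom_val_bound[of n A "take n c"] expr_val_bound[OF _ len, of \<phi>] assms(5) len in auto)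
  finally show ?case unfolding expr_val_Cons total_excess_Cons
    using add_mono[OF 1 2] by (auto elim!: order_trans[rotated])
qed

lemma total_excess_upper:
  assumes "\<forall>A\<in>set \<phi>. wf_atom \<Delta> n A" "n \<le> f" "length a = f" "N ^ 2 \<ge> B"
    "expr_val (cost \<Delta>) \<phi> (take n a) = ereal v"
  shows "\<exists>y. length (a @ y) = fresh f \<phi> \<and> total_excess N f \<phi> (a @ y)
    \<le> ereal (real s * real (N ^ 2) ^ (h + 1) * v + real (length \<phi> * B) * real (N ^ 2) ^ h)"
  using assms(1-3,5)
proof (induction \<phi> arbitrary: f a v)
  case Nil
  then show ?case by (auto simp: fresh_def)
next
  case (Cons A \<phi>)
  let ?x = "atom_val (cost \<Delta>) (take n a) A" and ?y = "expr_val (cost \<Delta>) \<phi> (take n a)"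
  from Cons.prems(4) obtain x y where xy: "?x = ereal x" "?y = ereal y" "v = x + y"
    by (cases ?x; cases ?y) (auto simp: expr_val_Cons)
  have "?x \<noteq> \<infinity>" using xy by simp
  from excess_upper[OF _ Cons.prems(2,3) assms(4) this] Cons.prems(1)
  obtain b where b: "length b = aux A" "\<And>y. excess N f A (a @ b @ y)
    \<le> ereal (lower s h B (N ^ 2) ?x + real B * real (N ^ 2) ^ h)" by auto
  have "take n (a @ b) = take n a" using Cons.prems by simp
  with xy(2) have "expr_val (cost \<Delta>) \<phi> (take n (a @ b)) = ereal y" by (simp only:)
  from Cons.IH[OF _ _ _ this, of "f + aux A"] Cons.prems b
  obtain z where z: "length ((a @ b) @ z) = fresh (f + aux A) \<phi>" "total_excess N (f + aux A) \<phi> ((a @ b) @ z)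
    \<le> ereal (real s * real (N ^ 2) ^ (h + 1) * y + real (length \<phi> * B) * real (N ^ 2) ^ h)" by auto
  from add_mono[OF b(2)[of z] z(2)[unfolded append_assoc]]
  have "total_excess N f (A # \<phi>) (a @ b @ z)
    \<le> ereal (real s * real (N ^ 2) ^ (h + 1) * v + real (length (A # \<phi>) * B) * real (N ^ 2) ^ h)"
    unfolding total_excess_Cons xy by (simp add: algebra_simps)
  with z(1) show ?case by (intro exI[of _ "b @ z"]) (simp add: fresh_def)
qed

lemma wf_emit:
  assumes "wf_atom \<Delta> n A" "n \<le> f" "f + aux A \<le> n'" "A' \<in> set (emit N f A)"
  shows "wf_atom \<Gamma> n' A'"
proof (cases A)
  case (Rel r vs)
  note w = gadget_wf[OF assms(1)[unfolded Rel]]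
  from assms(4) Rel obtain p e z A0 where A0: "(p, e, z) \<in> set (g r)" "A0 \<in> set e" "A' = rename_atom (place f vs) A0"
    by (auto simp: copies_def split: if_splits)
  have "wf_atom \<Gamma> (length vs + l r) A0" using w(3) A0 by (auto simp: wf_gadget_def)
  moreover have "place f vs i < n'" if "i < length vs + l r" for i
    using that w(4) assms(2,3) Rel nth_mem[of i vs] by (fastforce simp: place_def)
  ultimately show ?thesis unfolding A0(3) by (rule wf_rename_atom)
qed (use assms in \<open>auto simp: wf_atom_def\<close>)

lemma wf_emits:
  assumes "\<forall>A\<in>set \<phi>. wf_atom \<Delta> n A" "n \<le> f" "fresh f \<phi> \<le> n'" "A' \<in> set (emits N f \<phi>)"
  shows "wf_atom \<Gamma> n' A'"
  using assms
proof (induction \<phi> arbitrary: f)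
  case (Cons A \<phi>)
  from Cons.prems(4) consider "A' \<in> set (emit N f A)" | "A' \<in> set (emits N (f + aux A) \<phi>)" by auto
  then show ?case
  proof cases
    case 1
    then show ?thesis using Cons.prems wf_emit[of n A f n' A' N] by (auto simp: fresh_def)
  next
    case 2
    then show ?thesis using Cons.prems Cons.IH[of "f + aux A"] by (auto simp: fresh_def)
  qed
qed simp

lemma vcsp_instances_wf: "(n, \<phi>, u) \<in> vcsp_instances \<Theta> \<longleftrightarrow> (\<forall>A\<in>set \<phi>. wf_atom \<Theta> n A)"
  by (auto simp: vcsp_instances_def wf_atom_def)

theorem reduce_correct:
  assumes inst: "(n, \<phi>, u) \<in> vcsp_instances \<Delta>" and N: "N \<ge> (length \<phi> + 1) * (B + s * C + 2)"
  shows "reduce N (n, \<phi>, u) \<in> vcsp_instances \<Gamma> \<and>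
    ((n, \<phi>, u) \<in> vcsp_yes \<Delta> \<longleftrightarrow> reduce N (n, \<phi>, u) \<in> vcsp_yes \<Gamma>)"
proof -
  let ?m = "length \<phi>" and ?c = "clamp s N u" and ?off = "\<Sum>A\<leftarrow>\<phi>. atom_offset N A"
  let ?D = "?m * B + s * C * ?m * ?m"
  have wf: "\<forall>A\<in>set \<phi>. wf_atom \<Delta> n A" using inst by (simp add: vcsp_instances_wf)
  have N1: "N \<ge> 1" "N \<ge> B" "N > ?m * s * C" using N by (auto simp: algebra_simps)
  have NB: "N ^ 2 \<ge> B" using N1 by (meson le_trans power2_nat_le_imp_le self_le_power zero_less_numeral)
  \<comment> \<open>An infeasible tuple has excess at least
    \<open>(N ^ 2 - ?D) * N ^ (2 * h + 2)\<close>, whereas the clamped factor of the threshold is at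
    most \<open>N + 1\<close>. This inequality keeps infeasible tuples above the threshold.\<close>
  have N2: "N ^ 2 \<ge> ?D + N + 1"
  proof -
    have "((?m + 1) * (B + s * C + 2)) * N \<le> N * N" by (rule mult_le_mono1[OF N])
    then have "(?m + 1) * (B + s * C + 1) * N + ?m * N + N \<le> N * N" by (simp add: algebra_simps)
    moreover have "(?m + 1) * (B + s * C + 1) * ((?m + 1) * (B + s * C + 2)) \<le> (?m + 1) * (B + s * C + 1) * N"
      by (rule mult_le_mono2[OF N])
    moreover have "?D + 1 \<le> (?m + 1) * (B + s * C + 1) * ((?m + 1) * (B + s * C + 2))"
      by (simp add: algebra_simps)
    ultimately show ?thesis by (simp add: power2_eq_square)
  qed
  have pw: "real (N ^ 2) ^ h = real N ^ (2 * h)" "real (N ^ 2) ^ (h + 1) = real N ^ (2 * h + 2)"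
    unfolding of_nat_square_power by (rule arg_cong[of _ _ "(^) (real N)"], simp)+
  have wf': "\<forall>A\<in>set (emits N n \<phi>). wf_atom \<Gamma> (fresh n \<phi>) A" using wf_emits[OF wf] by blast
  then have inst': "reduce N (n, \<phi>, u) \<in> vcsp_instances \<Gamma>" unfolding reduce.simps vcsp_instances_wf .
  have thr: "ereal (of_rat (of_int (threshold N \<phi> u))) = ereal (of_int ?off + (real N ^ (2 * h + 2) * of_int ?c - 1))"
    unfolding threshold_def of_rat_of_int_eq by simp
  have le_thr: "expr_val (cost \<Gamma>) (emits N n \<phi>) c \<le> ereal (of_rat (of_int (threshold N \<phi> u))) \<longleftrightarrow>
    total_excess N n \<phi> c \<le> ereal (real N ^ (2 * h + 2) * of_int ?c - 1)" for c
    unfolding thr total_excess_def by (cases "expr_val (cost \<Gamma>) (emits N n \<phi>) c") auto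
  \<comment> \<open>A finite sum of \<open>m\<close> costs is at most \<open>m * C\<close> in
    absolute value, so \<open>N > m * s * C\<close> puts \<open>j\<close> into the range where
    clamping is exact.\<close>
  have small: "\<bar>j\<bar> < int N" if j: "expr_val (cost \<Delta>) \<phi> a = ereal (of_int j / real s)" "length a = n" for a j
  proof -
    from expr_val_bound[OF wf j(2)] j(1) have "\<bar>of_int j / real s\<bar> \<le> real (?m * C)" by auto
    then have "real_of_int \<bar>j\<bar> \<le> real (?m * C) * real s" using sB by (simp add: field_simps)
    also have "\<dots> < real N" using N1(3) by (metis mult.assoc mult.commute of_nat_less_iff of_nat_mult)
    finally show ?thesis by linarith
  qed
  have yes: "(\<exists>a\<in>tuples n. expr_val (cost \<Delta>) \<phi> a \<le> ereal (of_rat u)) \<longleftrightarrow>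
    (\<exists>c\<in>tuples (fresh n \<phi>). expr_val (cost \<Gamma>) (emits N n \<phi>) c \<le> ereal (of_rat (of_int (threshold N \<phi> u))))"
    unfolding le_thr
  proof
    assume "\<exists>a\<in>tuples n. expr_val (cost \<Delta>) \<phi> a \<le> ereal (of_rat u)"
    then obtain a where a: "length a = n" "expr_val (cost \<Delta>) \<phi> a \<le> ereal (of_rat u)" by auto
    then have "expr_val (cost \<Delta>) \<phi> a \<noteq> \<infinity>" by auto
    with expr_val_bound[OF wf a(1)] obtain j :: int where j: "expr_val (cost \<Delta>) \<phi> a = ereal (of_int j / real s)" by auto
    with a have "j < ?c" using clamp[OF sB(1) small[OF j a(1)]] by simp
    then have "j + 1 \<le> ?c" by simp
    then have "real N ^ (2 * h + 2) * (of_int j + 1) \<le> real N ^ (2 * h + 2) * of_int ?c"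
      by (intro mult_left_mono) auto
    \<comment> \<open>The accumulated error and the final 1 fit into a single unit
      \<open>N ^ (2 * h + 2)\<close>.\<close>
    moreover have "1 \<le> real N ^ (2 * h) * (real N ^ 2 - real (?m * B))"
    proof -
      have "1 + ?m * B \<le> N ^ 2" using N2 by simp
      then have "real (1 + ?m * B) \<le> real (N ^ 2)" by (simp only: of_nat_le_iff)
      then have "1 \<le> real N ^ 2 - real (?m * B)" by simp
      moreover have "1 \<le> real N ^ (2 * h)" using N1 by simp
      ultimately show ?thesis using mult_mono[of 1 "real N ^ (2 * h)" 1 "real N ^ 2 - real (?m * B)"] by simp
    qed
    then have "1 \<le> real N ^ (2 * h + 2) - real (?m * B) * real N ^ (2 * h)"
      by (simp add: algebra_simps power_add power2_eq_square)
    ultimately have "real N ^ (2 * h + 2) * of_int j + real (?m * B) * real N ^ (2 * h) \<le> real N ^ (2 * h + 2) * of_int ?c - 1"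
      by (simp add: algebra_simps)
    moreover from total_excess_upper[OF wf order_refl a(1) NB, of "of_int j / real s"] a j
    obtain y where y: "length (a @ y) = fresh n \<phi>" "total_excess N n \<phi> (a @ y)
      \<le> ereal (real s * real N ^ (2 * h + 2) * (of_int j / real s) + real (?m * B) * real N ^ (2 * h))"
      unfolding pw by auto
    have "real s * real N ^ (2 * h + 2) * (of_int j / real s) = real N ^ (2 * h + 2) * of_int j"
      using sB by simp
    ultimately have "total_excess N n \<phi> (a @ y) \<le> ereal (real N ^ (2 * h + 2) * of_int ?c - 1)"
      using y(2) by (auto elim!: order_trans)
    with y(1) show "\<exists>c\<in>tuples (fresh n \<phi>). total_excess N n \<phi> c \<le> ereal (real N ^ (2 * h + 2) * of_int ?c - 1)"
      by blast
  next
    assume "\<exists>c\<in>tuples (fresh n \<phi>). total_excess N n \<phi> c \<le> ereal (real N ^ (2 * h + 2) * of_int ?c - 1)"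
    then obtain c where c: "length c = fresh n \<phi>" "total_excess N n \<phi> c \<le> ereal (real N ^ (2 * h + 2) * of_int ?c - 1)"
      by auto
    let ?a = "take n c"
    have a: "length ?a = n" using c(1) by (simp add: fresh_def)
    have "ereal (lower s h ?D (N ^ 2) (expr_val (cost \<Delta>) \<phi> ?a)) \<le> total_excess N n \<phi> c"
      by (rule total_excess_lower) (use wf c NB N1 in auto)
    with c(2) have "ereal (lower s h ?D (N ^ 2) (expr_val (cost \<Delta>) \<phi> ?a)) \<le> ereal (real N ^ (2 * h + 2) * of_int ?c - 1)"
      by (rule order_trans[rotated])
    then have low: "lower s h ?D (N ^ 2) (expr_val (cost \<Delta>) \<phi> ?a) \<le> real N ^ (2 * h + 2) * of_int ?c - 1"
      by simp
    have "expr_val (cost \<Delta>) \<phi> ?a \<noteq> \<infinity>"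
    proof
      assume "expr_val (cost \<Delta>) \<phi> ?a = \<infinity>"
      then have "lower s h ?D (N ^ 2) (expr_val (cost \<Delta>) \<phi> ?a) = real (N ^ 2) ^ (h + 1) * (real (N ^ 2) - real ?D)"
        by (simp add: lower_inf algebra_simps)
      with low have "real N ^ (2 * h + 2) * (real (N ^ 2) - real ?D) < real N ^ (2 * h + 2) * of_int ?c"
        unfolding pw by simp
      then have "real (N ^ 2) - real ?D < of_int ?c" using N1 by (simp add: mult_less_cancel_left)
      moreover have "?c \<le> int N + 1" using clamp_le sB by blast
      then have "real_of_int ?c \<le> real N + 1" by linarith
      moreover have "real (?D + N + 1) \<le> real (N ^ 2)" using N2 by (simp only: of_nat_le_iff)
      then have "real ?D + real N + 1 \<le> real (N ^ 2)" by (simp only: of_nat_add of_nat_1)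
      ultimately show False by linarith
    qed
    with expr_val_bound[OF wf a] obtain j :: int where j: "expr_val (cost \<Delta>) \<phi> ?a = ereal (of_int j / real s)" by auto
    with low have "real N ^ (2 * h + 2) * of_int j < real N ^ (2 * h + 2) * of_int ?c"
      unfolding j lower_fin pw using sB by simp
    then have "j < ?c" using N1 by (simp add: mult_less_cancel_left)
    with clamp[OF sB(1) small[OF j a]] j have "expr_val (cost \<Delta>) \<phi> ?a \<le> ereal (of_rat u)" by simp
    with a show "\<exists>a\<in>tuples n. expr_val (cost \<Delta>) \<phi> a \<le> ereal (of_rat u)" by blast
  qed
  show ?thesis using inst inst' yes unfolding vcsp_yes_def reduce.simps by blast
qed

end

section \<open>The program that computes the reduction\<close>

text \<open>
  \<open>RI\<close> holds the rest of the input, \<open>RO\<close> the atoms of the output, written backwards, and \<open>RF\<close> the next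
  fresh variable.  \<open>RV i\<close> is the name of the \<open>i\<close>-th variable of the current gadget, \<open>RA i\<close> and \<open>RB i\<close> are the
  counters of the \<open>i\<close>-th nested loop, and the threshold is the difference of the unary numbers \<open>RPos\<close>
  and \<open>RNeg\<close>, later converted in \<open>RBin\<close>.  \<open>RP\<close> and \<open>RQ\<close> are the absolute numerator and the denominator
  of the given threshold, \<open>RS\<close> is its sign, \<open>RAcc\<close> an accumulator and \<open>RC\<close> its carry; \<open>RX\<close>, \<open>RY\<close> and
  \<open>RAcc2\<close> are scratch registers.
\<close>

datatype reg = RI | RO | RX | RY | RF | RV nat | RA nat | RB nat | RPos | RNeg
  | RP | RQ | RAcc | RAcc2 | RC | RS | RFlag | RBin

instance reg :: countable
  by countable_datatype

section \<open>Moving, copying and incrementing numbers\<close>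

lemma execI: "exec c s t s' \<Longrightarrow> s' = s'' \<Longrightarrow> t \<le> t' \<Longrightarrow> exec c s t' s''"
  by (auto intro: exec_mono)

lemma exec_Pop': "s r = a # w \<Longrightarrow> exec (Pop r) s 1 (s(r := w))"
  using exec_Pop[of s r] by simp

lemma exec_Cpy': "r \<noteq> q \<Longrightarrow> s r = a # w \<Longrightarrow> exec (Cpy r q) s 1 (s(q := a # s q))"
  using exec_Cpy[of r q s] by simp

text \<open>A move reverses the word, so moves come in pairs unless the reversal is wanted. The set
  \<open>S\<close> determines where the move stops.\<close>

definition mv :: "'r \<Rightarrow> 'r \<Rightarrow> nat set \<Rightarrow> 'r com" where
  "mv r q S = While r S (Cpy r q ;; Pop r)"

lemma exec_mv:
  assumes "r \<noteq> q" "s r = xs @ ys" "set xs \<subseteq> S" "head0 ys \<notin> S"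
  shows "exec (mv r q S) s (4 * length xs + 1) (s(r := ys, q := rev xs @ s q))"
  using assms
proof (induction xs arbitrary: s)
  case Nil
  then show ?case unfolding mv_def
    by (intro execI[OF exec_WhileF]) (auto simp: fun_eq_iff)
next
  case (Cons a xs)
  let ?s = "s(q := a # s q, r := xs @ ys)"
  have "exec (Cpy r q ;; Pop r) s (1 + 1) ?s"
    by (rule execI[OF exec_Seq[OF exec_Cpy'[of r q s a "xs @ ys"] exec_Pop'[of _ r a "xs @ ys"]]])
      (use Cons.prems in auto)
  moreover have "exec (mv r q S) ?s (4 * length xs + 1) (?s(r := ys, q := rev xs @ ?s q))"
    by (rule Cons.IH) (use Cons.prems in auto)
  ultimately have "exec (mv r q S) s (1 + 1 + (4 * length xs + 1) + 2) (?s(r := ys, q := rev xs @ ?s q))"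
    unfolding mv_def by (intro exec_WhileT) (use Cons.prems in auto)
  then show ?case by (rule execI) (use Cons.prems(1) in \<open>auto simp: fun_eq_iff\<close>)
qed

lemma exec_mv_all:
  assumes "r \<noteq> q" "set (s r) \<subseteq> S" "0 \<notin> S"
  shows "exec (mv r q S) s (4 * length (s r) + 1) (s(r := [], q := rev (s r) @ s q))"
  by (rule exec_mv) (use assms in auto)

text \<open>The original is restored from \<open>RX\<close>. The copy comes out reversed, which is
  the right order for \<open>RO\<close>, as that register is written backwards.\<close>

definition dup :: "reg \<Rightarrow> reg \<Rightarrow> reg com" where
  "dup r q = While r {1, 2} (Cpy r q ;; Cpy r RX ;; Pop r) ;; mv RX r {1, 2}"

lemma exec_dup:
  assumes "r \<noteq> q" "r \<noteq> RX" "q \<noteq> RX" "set (s r) \<subseteq> {1, 2}" "s RX = []"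
  shows "exec (dup r q) s (9 * length (s r) + 2) (s(q := rev (s r) @ s q))"
proof -
  have loop: "exec (While r {1, 2} (Cpy r q ;; Cpy r RX ;; Pop r)) s (5 * length xs + 1)
      (s(r := [], RX := rev xs @ s RX, q := rev xs @ s q))"
    if "s r = xs" "set xs \<subseteq> {1, 2}" for s xs
    using that
  proof (induction xs arbitrary: s)
    case Nil
    then show ?case by (intro execI[OF exec_WhileF]) (auto simp: fun_eq_iff)
  next
    case (Cons a xs)
    let ?s = "s(q := a # s q, RX := a # s RX, r := xs)"
    have "exec (Cpy r q ;; Cpy r RX ;; Pop r) s (1 + (1 + 1)) ?s"
      by (rule execI[OF exec_Seq[OF exec_Cpy'[of r q s a xs]
              exec_Seq[OF exec_Cpy'[of r RX _ a xs] exec_Pop'[of _ r a xs]]]])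
        (use Cons.prems assms in auto)
    moreover have "exec (While r {1, 2} (Cpy r q ;; Cpy r RX ;; Pop r)) ?s (5 * length xs + 1)
        (?s(r := [], RX := rev xs @ ?s RX, q := rev xs @ ?s q))"
      by (rule Cons.IH) (use Cons.prems in auto)
    ultimately have "exec (While r {1, 2} (Cpy r q ;; Cpy r RX ;; Pop r)) s
        (1 + (1 + 1) + (5 * length xs + 1) + 2) (?s(r := [], RX := rev xs @ ?s RX, q := rev xs @ ?s q))"
      by (intro exec_WhileT) (use Cons.prems in auto)
    then show ?case by (rule execI) (use assms in \<open>auto simp: fun_eq_iff\<close>)
  qed
  let ?s = "s(r := [], RX := rev (s r) @ s RX, q := rev (s r) @ s q)"
  have "exec (mv RX r {1, 2}) ?s (4 * length (?s RX) + 1) (?s(RX := [], r := rev (?s RX) @ ?s r))"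
    by (rule exec_mv_all) (use assms in auto)
  from exec_Seq[OF loop[of s "s r", OF refl assms(4)] this] show ?thesis
    unfolding dup_def by (rule execI) (use assms in \<open>auto simp: fun_eq_iff\<close>)
qed

definition copyF :: "reg \<Rightarrow> reg com" where
  "copyF r = dup RF RY ;; mv RY r {1, 2}"

lemma exec_copyF:
  assumes "r \<notin> {RF, RX, RY}" "set (s RF) \<subseteq> {1, 2}" "s RX = []" "s RY = []" "s r = []"
  shows "exec (copyF r) s (13 * length (s RF) + 3) (s(r := s RF))"
proof -
  let ?s = "s(RY := rev (s RF))"
  have "exec (dup RF RY) s (9 * length (s RF) + 2) ?s"
    by (rule execI[OF exec_dup]) (use assms in auto)
  moreover have "exec (mv RY r {1, 2}) ?s (4 * length (?s RY) + 1) (?s(RY := [], r := rev (?s RY) @ ?s r))"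
    by (rule exec_mv_all) (use assms in auto)
  ultimately show ?thesis unfolding copyF_def
    by (rule execI[OF exec_Seq]) (use assms in \<open>auto simp: fun_eq_iff\<close>)
qed

definition readnum :: "reg \<Rightarrow> reg com" where
  "readnum r = mv RI RX {1, 2} ;; mv RX r {1, 2}"

lemma exec_readnum:
  assumes "r \<notin> {RI, RX}" "s RI = w @ v" "set w \<subseteq> {1, 2}" "head0 v \<notin> {1, 2}" "s RX = []" "s r = []"
  shows "exec (readnum r) s (8 * length w + 2) (s(RI := v, r := w))"
proof -
  let ?s = "s(RI := v, RX := rev w @ s RX)"
  have "exec (mv RI RX {1, 2}) s (4 * length w + 1) ?s"
    by (rule exec_mv) (use assms in auto)
  moreover have "exec (mv RX r {1, 2}) ?s (4 * length (?s RX) + 1) (?s(RX := [], r := rev (?s RX) @ ?s r))"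
    by (rule exec_mv_all) (use assms in auto)
  ultimately show ?thesis unfolding readnum_def
    by (rule execI[OF exec_Seq]) (use assms in \<open>auto simp: fun_eq_iff\<close>)
qed

fun incw :: "word \<Rightarrow> word" where
  "incw [] = [2]"
| "incw (d # w) = (if d = 2 then 1 # incw w else 2 # w)"

lemma bin_0 [simp]: "bin 0 = []"
  by (simp add: bin.simps)

lemma incw_bin: "incw (bin n) = bin (Suc n)"
proof (induction n rule: bin.induct)
  case (1 n)
  show ?case
  proof (cases "n = 0")
    case True
    then show ?thesis by (simp add: bin.simps[of "Suc 0"])
  next
    case False
    then have b: "bin n = (1 + n mod 2) # bin (n div 2)" by (simp add: bin.simps[of n])
    have b': "bin (Suc n) = (1 + Suc n mod 2) # bin (Suc n div 2)" by (simp add: bin.simps[of "Suc n"])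
    show ?thesis
    proof (cases "even n")
      case True
      then show ?thesis unfolding b b' by (simp add: mod_Suc even_iff_mod_2_eq_zero)
    next
      case odd: False
      then have "n mod 2 = 1" "Suc n div 2 = Suc (n div 2)" "Suc n mod 2 = 0" by presburger+
      then show ?thesis unfolding b b' using 1 False by simp
    qed
  qed
qed

lemma set_bin: "set (bin n) \<subseteq> {1, 2}"
proof (induction n rule: bin.induct)
  case (1 n)
  then show ?case by (subst bin.simps) auto
qed

lemma length_bin_le: "n < 2 ^ M \<Longrightarrow> length (bin n) \<le> M"
proof (induction M arbitrary: n)
  case (Suc M)
  then have "length (bin (n div 2)) \<le> M" by simp
  then show ?case by (subst bin.simps) simp
qed simp

lemma less_power_bin: "n < 2 ^ length (bin n)"
proof (induction n rule: bin.induct)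
  case (1 n)
  show ?case
  proof (cases "n = 0")
    case False
    with 1 have "n div 2 < 2 ^ length (bin (n div 2))" by simp
    then have "n < 2 * 2 ^ length (bin (n div 2))" by linarith
    also have "\<dots> = 2 ^ length (bin n)" using False by (subst (2) bin.simps) simp
    finally show ?thesis .
  qed simp
qed

text \<open>The letters 1 and 2 are the digits 0 and 1. The initial block of letters 2 overflows to
  letters 1, which wait in \<open>RX\<close>; the next digit, a 0 or a missing one, becomes
  1.\<close>

definition inc :: "reg \<Rightarrow> reg com" where
  "inc r = While r {2} (Pop r ;; Push RX 1) ;; Cond r {1} (Pop r) Skip ;; Push r 2 ;; mv RX r {1}"

lemma exec_inc:
  assumes "r \<noteq> RX" "set (s r) \<subseteq> {1, 2}" "s RX = []"
  shows "exec (inc r) s (8 * length (s r) + 6) (s(r := incw (s r)))"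
proof -
  have loop: "\<exists>j ys. j \<le> length (s r) \<and> exec (While r {2} (Pop r ;; Push RX 1)) s (4 * j + 1)
      (s(r := ys, RX := replicate j 1 @ s RX)) \<and> head0 ys \<noteq> 2 \<and> set ys \<subseteq> {1, 2} \<and>
      incw (s r) = replicate j 1 @ 2 # tl ys" if "set (s r) \<subseteq> {1, 2}" for s
    using that
  proof (induction "s r" arbitrary: s)
    case Nil
    then have "exec (While r {2} (Pop r ;; Push RX 1)) s (4 * 0 + 1) (s(r := [], RX := replicate 0 1 @ s RX))"
      by (intro execI[OF exec_WhileF]) (auto simp: fun_eq_iff)
    then show ?case
      by (intro exI[of _ 0] exI[of _ "[]"] conjI, simp, assumption) (use Nil in simp_all)
  next
    case (Cons a xs)
    have sr: "s r = a # xs" and sub: "set (a # xs) \<subseteq> {1, 2}" using Cons(2,3) by simp_all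
    show ?case
    proof (cases "a = 2")
      case True
      let ?s = "s(r := xs, RX := 1 # s RX)"
      have "exec (Pop r ;; Push RX 1) s (1 + 1) (s(r := xs, RX := 1 # (s(r := xs)) RX))"
        by (rule exec_Seq[OF exec_Pop'[of s r a xs] exec_Push]) (rule sr)
      then have 1: "exec (Pop r ;; Push RX 1) s (1 + 1) ?s" using assms by simp
      have "\<exists>j ys. j \<le> length (?s r) \<and> exec (While r {2} (Pop r ;; Push RX 1)) ?s (4 * j + 1)
        (?s(r := ys, RX := replicate j 1 @ ?s RX)) \<and> head0 ys \<noteq> 2 \<and> set ys \<subseteq> {1, 2} \<and>
        incw (?s r) = replicate j 1 @ 2 # tl ys"
        by (rule Cons(1)) (use sub assms in auto)
      then obtain j ys where j: "j \<le> length xs" "exec (While r {2} (Pop r ;; Push RX 1)) ?s (4 * j + 1)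
        (?s(r := ys, RX := replicate j 1 @ ?s RX))" "head0 ys \<noteq> 2" "set ys \<subseteq> {1, 2}"
        "incw xs = replicate j 1 @ 2 # tl ys" using assms by auto
      have "exec (While r {2} (Pop r ;; Push RX 1)) s (1 + 1 + (4 * j + 1) + 2)
        (?s(r := ys, RX := replicate j 1 @ ?s RX))"
        by (rule exec_WhileT[OF _ 1 j(2)]) (use True sr in auto)
      then have "exec (While r {2} (Pop r ;; Push RX 1)) s (4 * Suc j + 1)
        (s(r := ys, RX := replicate (Suc j) 1 @ s RX))"
        by (rule execI) (use assms in \<open>auto simp: fun_eq_iff replicate_app_Cons_same\<close>)
      then show ?thesis
        by (intro exI[of _ "Suc j"] exI[of _ ys] conjI, use j(1) sr in simp, assumption)
          (use j True sr in auto)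
    next
      case False
      then have "exec (While r {2} (Pop r ;; Push RX 1)) s (4 * 0 + 1)
          (s(r := a # xs, RX := replicate 0 1 @ s RX))"
        using Cons(2) by (intro execI[OF exec_WhileF]) (auto simp: fun_eq_iff simp: sr)
      then show ?thesis
        by (intro exI[of _ 0] exI[of _ "a # xs"] conjI, simp, assumption)
          (use sub False sr in auto)
    qed
  qed
  from loop[of s, OF assms(2)] obtain j ys where j: "j \<le> length (s r)"
    "exec (While r {2} (Pop r ;; Push RX 1)) s (4 * j + 1) (s(r := ys, RX := replicate j 1 @ s RX))"
    "head0 ys \<noteq> 2" "set ys \<subseteq> {1, 2}" "incw (s r) = replicate j 1 @ 2 # tl ys" by blast
  let ?s1 = "s(r := ys, RX := replicate j 1)" and ?s2 = "s(r := tl ys, RX := replicate j 1)"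
  let ?s3 = "s(r := 2 # tl ys, RX := replicate j 1)"
  have 1: "exec (While r {2} (Pop r ;; Push RX 1)) s (4 * j + 1) ?s1"
    using j(2) assms(3) by simp
  have 2: "exec (Cond r {1} (Pop r) Skip) ?s1 3 ?s2"
  proof (cases ys)
    case Nil
    then show ?thesis using assms(1)
      by (intro execI[OF exec_CondF[OF _ exec_Skip]]) (auto simp: fun_eq_iff)
  next
    case (Cons a zs)
    with j have a: "a = 1" by auto
    have "exec (Pop r) ?s1 1 (?s1(r := zs))" by (rule exec_Pop') (use Cons assms in auto)
    then show ?thesis using Cons a assms(1)
      by (intro execI[OF exec_CondT]) (auto simp: fun_eq_iff)
  qed
  have 3: "exec (Push r 2) ?s2 1 ?s3"
    by (rule execI[OF exec_Push]) (use assms in \<open>auto simp: fun_eq_iff\<close>)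
  have 4: "exec (mv RX r {1}) ?s3 (4 * j + 1) (s(r := incw (s r)))"
    by (rule execI[OF exec_mv_all]) (use assms j(5) in \<open>auto simp: fun_eq_iff\<close>)
  show ?thesis unfolding inc_def
    by (rule execI[OF exec_Seq[OF 1 exec_Seq[OF 2 exec_Seq[OF 3 4]]]]) (use j(1) in auto)
qed

lemma exec_inc_bin:
  assumes "r \<noteq> RX" "s r = bin n" "s RX = []"
  shows "exec (inc r) s (8 * length (bin n) + 6) (s(r := bin (Suc n)))"
  using exec_inc[of r s] assms set_bin[of n] by (simp add: incw_bin)

definition push_word :: "reg \<Rightarrow> word \<Rightarrow> reg com" where
  "push_word r w = foldr (\<lambda>a c. Push r a ;; c) w Skip"

section \<open>Writing gadgets to the output\<close>

lemma exec_push_word: "exec (push_word r w) s (length w) (s(r := rev w @ s r))"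
proof (induction w arbitrary: s)
  case Nil
  then show ?case using exec_Skip by (auto simp: push_word_def)
next
  case (Cons a w)
  from exec_Seq[OF exec_Push[of r a s] Cons.IH] show ?case
    unfolding push_word_def foldr.simps comp_apply
    by (rule execI) auto
qed

definition seqs :: "('a \<Rightarrow> reg com) \<Rightarrow> 'a list \<Rightarrow> reg com" where
  "seqs f xs = foldr (\<lambda>x c. f x ;; c) xs Skip"

lemma seqs_Nil [simp]: "seqs f [] = Skip"
  and seqs_Cons [simp]: "seqs f (x # xs) = f x ;; seqs f xs"
  by (auto simp: seqs_def)

text \<open>The net effect of emitting code: letters on the backward output, and units on the two
  sides of the threshold. Such effects compose by concatenation and addition, which makes repeated
  emission easy to describe.\<close>

definition emits_to :: "word \<Rightarrow> nat \<Rightarrow> nat \<Rightarrow> reg store \<Rightarrow> reg store" where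
  "emits_to w a b s = s(RO := rev w @ s RO, RPos := replicate a 1 @ s RPos, RNeg := replicate b 1 @ s RNeg)"

lemma emits_to_other [simp]: "r \<notin> {RO, RPos, RNeg} \<Longrightarrow> emits_to w a b s r = s r"
  by (auto simp: emits_to_def)

lemma emits_to_0 [simp]: "emits_to [] 0 0 s = s"
  by (simp add: emits_to_def)

lemma emits_to_emits_to [simp]:
  "emits_to w' a' b' (emits_to w a b s) = emits_to (w @ w') (a + a') (b + b') s"
  by (auto simp: emits_to_def fun_eq_iff add.commute replicate_add[symmetric] simp flip: append_assoc)

lemma emits_to_upd: "r \<notin> {RO, RPos, RNeg} \<Longrightarrow> emits_to w a b (s(r := x)) = (emits_to w a b s)(r := x)"
  by (auto simp: emits_to_def fun_eq_iff)

fun emit_atom :: "nat atom \<Rightarrow> reg com" where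
  "emit_atom (Rel r vs) = push_word RO (4 # bin r) ;; seqs (\<lambda>v. Push RO 3 ;; dup (RV v) RO) vs"
| "emit_atom (Equal i j) = Push RO 5 ;; dup (RV i) RO ;; Push RO 3 ;; dup (RV j) RO"
| "emit_atom (Empty i) = Push RO 6 ;; dup (RV i) RO"

fun time_atom :: "nat \<Rightarrow> nat atom \<Rightarrow> nat" where
  "time_atom M (Rel r vs) = 1 + length (bin r) + length vs * (9 * M + 3)"
| "time_atom M _ = 2 * (9 * M + 3)"

definition vars_ok :: "nat \<Rightarrow> nat set \<Rightarrow> (nat \<Rightarrow> nat) \<Rightarrow> reg store \<Rightarrow> bool" where
  "vars_ok M V \<sigma> s \<longleftrightarrow> s RX = [] \<and> (\<forall>i\<in>V. s (RV i) = bin (\<sigma> i) \<and> length (bin (\<sigma> i)) \<le> M)"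

lemma vars_ok_emits_to [simp]: "vars_ok M V \<sigma> (emits_to w a b s) \<longleftrightarrow> vars_ok M V \<sigma> s"
  by (simp add: vars_ok_def)

lemma exec_emit_var:
  assumes "vars_ok M V \<sigma> s" "i \<in> V"
  shows "exec (dup (RV i) RO) s (9 * M + 2) (emits_to (bin (\<sigma> i)) 0 0 s)"
  by (rule execI[OF exec_dup]) (use assms set_bin in \<open>auto simp: vars_ok_def emits_to_def\<close>)

lemma exec_emit_letter: "exec (Push RO a) s 1 (emits_to [a] 0 0 s)"
  by (rule execI[OF exec_Push]) (auto simp: emits_to_def)

lemma exec_emit_vars:
  assumes "vars_ok M V \<sigma> s" "set vs \<subseteq> V"
  shows "exec (seqs (\<lambda>v. Push RO 3 ;; dup (RV v) RO) vs) s (length vs * (9 * M + 3))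
    (emits_to (concat (map (\<lambda>i. 3 # bin (\<sigma> i)) vs)) 0 0 s)"
  using assms
proof (induction vs arbitrary: s)
  case Nil
  then show ?case using exec_Skip by simp
next
  case (Cons v vs)
  let ?s = "emits_to [3] 0 0 s" and ?s' = "emits_to (3 # bin (\<sigma> v)) 0 0 s"
  have "exec (dup (RV v) RO) ?s (9 * M + 2) (emits_to (bin (\<sigma> v)) 0 0 ?s)"
    using Cons.prems by (intro exec_emit_var) auto
  from exec_Seq[OF exec_emit_letter this]
  have 1: "exec (Push RO 3 ;; dup (RV v) RO) s (1 + (9 * M + 2)) ?s'" by simp
  have "exec (seqs (\<lambda>v. Push RO 3 ;; dup (RV v) RO) vs) ?s' (length vs * (9 * M + 3))
    (emits_to (concat (map (\<lambda>i. 3 # bin (\<sigma> i)) vs)) 0 0 ?s')"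
    using Cons.prems by (intro Cons.IH) auto
  from exec_Seq[OF 1 this] show ?case unfolding seqs_Cons by (rule execI) auto
qed

lemma exec_emit_atom:
  assumes ok: "vars_ok M V \<sigma> s" and V: "atom_vars A \<subseteq> V"
  shows "exec (emit_atom A) s (time_atom M A) (emits_to (enc_atom (rename_atom \<sigma> A)) 0 0 s)"
proof (cases A)
  case (Rel r vs)
  have 1: "exec (push_word RO (4 # bin r)) s (length (4 # bin r)) (emits_to (4 # bin r) 0 0 s)"
    by (rule execI[OF exec_push_word]) (auto simp: emits_to_def)
  have 2: "exec (seqs (\<lambda>v. Push RO 3 ;; dup (RV v) RO) vs) (emits_to (4 # bin r) 0 0 s) (length vs * (9 * M + 3))
    (emits_to (concat (map (\<lambda>i. 3 # bin (\<sigma> i)) vs)) 0 0 (emits_to (4 # bin r) 0 0 s))"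
    using ok V Rel by (intro exec_emit_vars) auto
  from exec_Seq[OF 1 2] show ?thesis unfolding Rel emit_atom.simps
    by (rule execI) (auto simp: comp_def)
next
  case (Equal i j)
  let ?s1 = "emits_to [5] 0 0 s"
  let ?s2 = "emits_to (bin (\<sigma> i)) 0 0 ?s1"
  let ?s3 = "emits_to [3] 0 0 ?s2"
  have 1: "exec (dup (RV i) RO) ?s1 (9 * M + 2) ?s2"
    by (rule exec_emit_var[of M V]) (use ok V Equal in auto)
  have 2: "exec (dup (RV j) RO) ?s3 (9 * M + 2) (emits_to (bin (\<sigma> j)) 0 0 ?s3)"
    by (rule exec_emit_var[of M V]) (use ok V Equal in auto)
  show ?thesis unfolding Equal emit_atom.simps
    by (rule execI[OF exec_Seq[OF exec_emit_letter exec_Seq[OF 1 exec_Seq[OF exec_emit_letter 2]]]]) auto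
next
  case (Empty i)
  have 1: "exec (dup (RV i) RO) (emits_to [6] 0 0 s) (9 * M + 2) (emits_to (bin (\<sigma> i)) 0 0 (emits_to [6] 0 0 s))"
    by (rule exec_emit_var[of M V]) (use ok V Empty in auto)
  show ?thesis unfolding Empty emit_atom.simps
    by (rule execI[OF exec_Seq[OF exec_emit_letter 1]]) auto
qed

lemma exec_emit_expr:
  assumes "vars_ok M V \<sigma> s" "\<forall>A\<in>set e. atom_vars A \<subseteq> V"
  shows "exec (seqs emit_atom e) s (\<Sum>A\<leftarrow>e. time_atom M A)
    (emits_to (concat (map enc_atom (map (rename_atom \<sigma>) e))) 0 0 s)"
  using assms
proof (induction e arbitrary: s)
  case Nil
  then show ?case using exec_Skip by simp
next
  case (Cons A e)
  let ?s = "emits_to (enc_atom (rename_atom \<sigma> A)) 0 0 s"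
  have "exec (seqs emit_atom e) ?s (\<Sum>A\<leftarrow>e. time_atom M A)
    (emits_to (concat (map enc_atom (map (rename_atom \<sigma>) e))) 0 0 ?s)"
    using Cons.prems by (intro Cons.IH) auto
  with exec_emit_atom[OF Cons.prems(1), of A] Cons.prems(2) show ?case
    unfolding seqs_Cons by (intro execI[OF exec_Seq]) auto
qed

definition add_unary :: "int \<Rightarrow> reg com" where
  "add_unary z = push_word RPos (replicate (nat z) 1) ;; push_word RNeg (replicate (nat (- z)) 1)"

lemma exec_add_unary: "exec (add_unary z) s (nat \<bar>z\<bar>) (emits_to [] (nat z) (nat (- z)) s)"
  unfolding add_unary_def
  by (rule execI[OF exec_Seq[OF exec_push_word exec_push_word]]) (auto simp: emits_to_def)

text \<open>\<open>RA i\<close> holds a unary number, which the loop moves to \<open>RB i\<close> and back.\<close>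

definition loop :: "nat \<Rightarrow> reg com \<Rightarrow> reg com" where
  "loop i c = While (RA i) {1} (Pop (RA i) ;; Push (RB i) 1 ;; c) ;; mv (RB i) (RA i) {1}"

text \<open>\<open>F j\<close> is the store after \<open>j\<close> rounds. The body must work for
  all contents of the two counter registers, since these change from round to round.\<close>

lemma exec_loop:
  assumes body: "\<And>j x y. j < N \<Longrightarrow>
      exec c ((F j)(RA i := x, RB i := y)) t ((F (Suc j))(RA i := x, RB i := y))"
  shows "exec (loop i c) ((F 0)(RA i := replicate N 1, RB i := [])) (N * (t + 8) + 2)
    ((F N)(RA i := replicate N 1, RB i := []))"
proof -
  let ?c = "Pop (RA i) ;; Push (RB i) 1 ;; c"
  have "exec (While (RA i) {1} ?c) ((F j)(RA i := replicate (N - j) 1, RB i := replicate j 1))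
      ((N - j) * (t + 4) + 1) ((F N)(RA i := [], RB i := replicate N 1))" if "j \<le> N" for j
    using that
  proof (induction "N - j" arbitrary: j)
    case 0
    then have "j = N" by simp
    then show ?case by (intro execI[OF exec_WhileF]) (auto simp: fun_eq_iff)
  next
    case (Suc m)
    then have j: "j < N" "N - j = Suc (N - Suc j)" by auto
    let ?s = "(F j)(RA i := replicate (N - j) 1, RB i := replicate j 1)"
    let ?s1 = "(F j)(RA i := replicate (N - Suc j) 1, RB i := replicate j 1)"
    let ?s2 = "(F j)(RA i := replicate (N - Suc j) 1, RB i := replicate (Suc j) 1)"
    let ?s3 = "(F (Suc j))(RA i := replicate (N - Suc j) 1, RB i := replicate (Suc j) 1)"
    have "exec (Pop (RA i)) ?s 1 ?s1"
      by (rule execI[OF exec_Pop']) (use j in \<open>auto simp: fun_eq_iff\<close>)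
    moreover have "exec (Push (RB i) 1) ?s1 1 ?s2"
      by (rule execI[OF exec_Push]) auto
    ultimately have 1: "exec ?c ?s (1 + (1 + t)) ?s3"
      using body[OF j(1)] by (intro exec_Seq)
    have 2: "exec (While (RA i) {1} ?c) ?s3 ((N - Suc j) * (t + 4) + 1) ((F N)(RA i := [], RB i := replicate N 1))"
      by (rule Suc(1)) (use Suc j in auto)
    show ?case by (rule execI[OF exec_WhileT[OF _ 1 2]]) (use j in auto)
  qed
  from this[of 0] have 1: "exec (While (RA i) {1} ?c) ((F 0)(RA i := replicate N 1, RB i := []))
      (N * (t + 4) + 1) ((F N)(RA i := [], RB i := replicate N 1))" by simp
  have 2: "exec (mv (RB i) (RA i) {1}) ((F N)(RA i := [], RB i := replicate N 1)) (4 * N + 1)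
    ((F N)(RA i := replicate N 1, RB i := []))"
    by (rule execI[OF exec_mv_all]) (auto simp: fun_eq_iff)
  show ?thesis unfolding loop_def by (rule execI[OF exec_Seq[OF 1 2]]) (auto simp: algebra_simps)
qed

text \<open>Runs \<open>c\<close> exactly \<open>N ^ p\<close> times by \<open>p\<close> nested
  loops, each with its own counters that hold the unary \<open>N\<close>.\<close>

fun rep :: "nat \<Rightarrow> reg com \<Rightarrow> reg com" where
  "rep 0 c = c"
| "rep (Suc p) c = loop p (rep p c)"

fun time_rep :: "nat \<Rightarrow> nat \<Rightarrow> nat \<Rightarrow> nat" where
  "time_rep N 0 t = t"
| "time_rep N (Suc p) t = N * (time_rep N p t + 8) + 2"

definition counters :: "nat \<Rightarrow> nat \<Rightarrow> reg store \<Rightarrow> bool" where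
  "counters N p s \<longleftrightarrow> (\<forall>i<p. s (RA i) = replicate N 1 \<and> s (RB i) = [])"

lemma counters_mono: "counters N p s \<Longrightarrow> p' \<le> p \<Longrightarrow> counters N p' s"
  by (auto simp: counters_def)

lemma exec_loop':
  assumes "counters N p s" "i < p" "F 0 = s" "F N = s'" "s' (RA i) = s (RA i)" "s' (RB i) = s (RB i)"
    and "\<And>j x y. j < N \<Longrightarrow> exec c ((F j)(RA i := x, RB i := y)) t ((F (Suc j))(RA i := x, RB i := y))"
  shows "exec (loop i c) s (N * (t + 8) + 2) s'"
proof -
  have "s(RA i := replicate N 1, RB i := []) = s" "s'(RA i := replicate N 1, RB i := []) = s'"
    using assms by (auto simp: counters_def fun_eq_iff)
  with exec_loop[of N c F i t, OF assms(7)] assms(3,4) show ?thesis by simp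
qed

lemma exec_rep:
  assumes body: "\<And>s. P s \<Longrightarrow> exec c s t (emits_to w a b s)"
    and P: "\<And>s i x. P s \<Longrightarrow> P (s(RA i := x))" "\<And>s i x. P s \<Longrightarrow> P (s(RB i := x))"
      "\<And>s w a b. P s \<Longrightarrow> P (emits_to w a b s)"
    and "P s" "counters N p s"
  shows "exec (rep p c) s (time_rep N p t) (emits_to (concat (replicate (N ^ p) w)) (N ^ p * a) (N ^ p * b) s)"
  using assms(5,6)
proof (induction p arbitrary: s)
  case 0
  then show ?case using body by simp
next
  case (Suc p)
  let ?F = "\<lambda>j. emits_to (concat (replicate (j * N ^ p) w)) (j * N ^ p * a) (j * N ^ p * b) s"
  show ?case unfolding rep.simps time_rep.simps
  proof (rule exec_loop'[where F = ?F, OF Suc.prems(2)])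
    fix j x y
    let ?s = "(?F j)(RA p := x, RB p := y)"
    have "P ?s" using Suc.prems(1) P by simp
    moreover have "counters N p ?s" using Suc.prems(2) by (auto simp: counters_def)
    ultimately have "exec (rep p c) ?s (time_rep N p t)
        (emits_to (concat (replicate (N ^ p) w)) (N ^ p * a) (N ^ p * b) ?s)" by (rule Suc.IH)
    moreover have "replicate (Suc j * N ^ p) w = replicate (j * N ^ p) w @ replicate (N ^ p) w"
      by (simp add: replicate_add[symmetric] add.commute)
    ultimately show "exec (rep p c) ?s (time_rep N p t) ((?F (Suc j))(RA p := x, RB p := y))"
      by (elim execI) (simp_all add: emits_to_upd algebra_simps)
  qed auto
qed

definition emit_term :: "nat \<times> nat atom list \<times> int \<Rightarrow> reg com" where
  "emit_term = (\<lambda>(p, e, z). rep p (seqs emit_atom e ;; add_unary z))"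

definition time_term :: "nat \<Rightarrow> nat \<Rightarrow> nat \<times> nat atom list \<times> int \<Rightarrow> nat" where
  "time_term M N = (\<lambda>(p, e, z). time_rep N p ((\<Sum>A\<leftarrow>e. time_atom M A) + nat \<bar>z\<bar>))"

text \<open>Unary registers cannot hold negative numbers, so the two signs are collected
  apart.\<close>

definition pos_part :: "nat \<Rightarrow> gadget \<Rightarrow> nat" where
  "pos_part N ts = (\<Sum>(p, e, z)\<leftarrow>ts. N ^ p * nat z)"

definition neg_part :: "nat \<Rightarrow> gadget \<Rightarrow> nat" where
  "neg_part N ts = (\<Sum>(p, e, z)\<leftarrow>ts. N ^ p * nat (- z))"

lemma pos_neg_part: "int (pos_part N ts) - int (neg_part N ts) = gadget_family.offset_of N ts"
  unfolding pos_part_def neg_part_def gadget_family.offset_of_def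
proof (induction ts)
  case (Cons t ts)
  obtain p e z where t: "t = (p, e, z)" by (cases t)
  have "int (N ^ p * nat z) - int (N ^ p * nat (- z)) = int N ^ p * z"
    by (cases "z \<ge> 0") auto
  with Cons show ?case unfolding t by simp
qed simp

lemma exec_emit_gadget:
  assumes "vars_ok M V \<sigma> s" "\<forall>(p, e, z)\<in>set ts. p \<le> Lv \<and> (\<forall>A\<in>set e. atom_vars A \<subseteq> V)" "counters N Lv s"
  shows "exec (seqs emit_term ts) s (\<Sum>x\<leftarrow>ts. time_term M N x)
    (emits_to (concat (map enc_atom (gadget_family.copies N \<sigma> ts))) (pos_part N ts) (neg_part N ts) s)"
  using assms
proof (induction ts arbitrary: s)
  case Nil
  then show ?case using exec_Skip by (simp add: gadget_family.copies_def pos_part_def neg_part_def)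
next
  case (Cons x ts)
  obtain p e z where x: "x = (p, e, z)" by (cases x)
  let ?w = "concat (map enc_atom (map (rename_atom \<sigma>) e))"
  have "exec (rep p (seqs emit_atom e ;; add_unary z)) s (time_rep N p ((\<Sum>A\<leftarrow>e. time_atom M A) + nat \<bar>z\<bar>))
      (emits_to (concat (replicate (N ^ p) ?w)) (N ^ p * nat z) (N ^ p * nat (- z)) s)"
  proof (rule exec_rep[of "vars_ok M V \<sigma>"])
    fix s assume "vars_ok M V \<sigma> s"
    then have 1: "exec (seqs emit_atom e) s (\<Sum>A\<leftarrow>e. time_atom M A) (emits_to ?w 0 0 s)"
      using Cons.prems x by (intro exec_emit_expr) auto
    show "exec (seqs emit_atom e ;; add_unary z) s ((\<Sum>A\<leftarrow>e. time_atom M A) + nat \<bar>z\<bar>) (emits_to ?w (nat z) (nat (- z)) s)"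
      by (rule execI[OF exec_Seq[OF 1 exec_add_unary]]) auto
  next
    show "counters N p s" by (rule counters_mono[OF Cons.prems(3)]) (use Cons.prems(2) x in auto)
  qed (use Cons.prems in \<open>auto simp: vars_ok_def\<close>)
  then have 1: "exec (emit_term x) s (time_term M N x)
      (emits_to (concat (replicate (N ^ p) ?w)) (N ^ p * nat z) (N ^ p * nat (- z)) s)" (is "exec _ _ _ ?s")
    by (simp add: x emit_term_def time_term_def)
  have 2: "exec (seqs emit_term ts) ?s (\<Sum>x\<leftarrow>ts. time_term M N x)
    (emits_to (concat (map enc_atom (gadget_family.copies N \<sigma> ts))) (pos_part N ts) (neg_part N ts) ?s)"
    by (rule Cons.IH) (use Cons.prems in \<open>auto simp: counters_def\<close>)
  have "concat (map enc_atom (concat (replicate m (map (rename_atom \<sigma>) e)))) = concat (replicate m ?w)" for m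
    by (induction m) auto
  then show ?case unfolding seqs_Cons
    by (intro execI[OF exec_Seq[OF 1 2]]) (auto simp: x gadget_family.copies_def pos_part_def neg_part_def)
qed

section \<open>Processing a single relational atom\<close>

fun putV :: "nat \<Rightarrow> word list \<Rightarrow> reg store \<Rightarrow> reg store" where
  "putV j [] s = s"
| "putV j (w # ws) s = putV (Suc j) ws (s(RV j := w))"

lemma exec_Skip_eq: "s = s' \<Longrightarrow> exec Skip s t s'"
  by (auto intro: exec_Skip execI)

lemma putV_apply: "putV j ws s r = (case r of
    RV i \<Rightarrow> if j \<le> i \<and> i < j + length ws then ws ! (i - j) else s r | _ \<Rightarrow> s r)"
proof (induction ws arbitrary: j s r)
  case Nil
  then show ?case by (cases r) auto
next
  case (Cons w ws)
  show ?case
  proof (cases r)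
    case (RV i)
    then show ?thesis unfolding putV.simps Cons.IH by (cases "i = j") (auto simp: nth_Cons' Suc_diff_le)
  qed (auto simp: Cons.IH)
qed

lemma putV_other [simp]: "(\<And>i. r \<noteq> RV i) \<Longrightarrow> putV j ws s r = s r"
  by (cases r) (auto simp: putV_apply)

lemma putV_RV: "putV j ws s (RV i) = (if j \<le> i \<and> i < j + length ws then ws ! (i - j) else s (RV i))"
  by (simp add: putV_apply)

definition readvars :: "nat \<Rightarrow> nat \<Rightarrow> reg com" where
  "readvars j k = seqs (\<lambda>j. Pop RI ;; readnum (RV j)) [j..<j + k]"

lemma exec_readvars:
  assumes "s RI = concat (map (\<lambda>i. 3 # bin i) vs) @ v" "v = [] \<or> hd v > 3" "s RX = []"
    "\<And>i. s (RV i) = [] \<or> i < j" "\<And>i. i \<in> set vs \<Longrightarrow> i < 2 ^ M"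
  shows "exec (readvars j (length vs)) s (length vs * (8 * M + 3)) (putV j (map bin vs) (s(RI := v)))"
  using assms(1,3-5) unfolding readvars_def
proof (induction vs arbitrary: j s)
  case Nil
  then show ?case by (auto intro!: exec_Skip_eq simp: fun_eq_iff)
next
  case (Cons x vs)
  let ?v = "concat (map (\<lambda>i. 3 # bin i) vs) @ v"
  let ?s1 = "s(RI := bin x @ ?v)"
  let ?s2 = "s(RI := ?v, RV j := bin x)"
  have "exec (Pop RI) s 1 ?s1" by (rule exec_Pop') (use Cons.prems in auto)
  moreover have "exec (readnum (RV j)) ?s1 (8 * M + 2) ?s2"
  proof (rule execI[OF exec_readnum[of _ _ "bin x" ?v]])
    show "head0 ?v \<notin> {1, 2}"
      using assms(2) by (cases vs; cases v) auto
    show "8 * length (bin x) + 2 \<le> 8 * M + 2" using Cons.prems(4) length_bin_le by simp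
    show "?s1 (RV j) = []" using Cons.prems(3)[of j] by simp
    show "?s1(RI := ?v, RV j := bin x) = ?s2" by (simp add: fun_eq_iff)
  qed (use Cons.prems set_bin in auto)
  ultimately have 1: "exec (Pop RI ;; readnum (RV j)) s (1 + (8 * M + 2)) ?s2" by (rule exec_Seq)
  have 2: "exec (seqs (\<lambda>j. Pop RI ;; readnum (RV j)) [Suc j..<Suc j + length vs]) ?s2 (length vs * (8 * M + 3))
      (putV (Suc j) (map bin vs) (?s2(RI := v)))"
    using Cons.prems by (intro Cons.IH) (auto simp: less_Suc_eq)
  have "[j..<j + length (x # vs)] = j # [Suc j..<Suc j + length vs]"
    by (simp add: upt_conv_Cons del: upt_Suc)
  have eq: "?s2(RI := v) = s(RI := v, RV j := bin x)" by (auto simp: fun_eq_iff)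
  show ?case unfolding \<open>[j..<j + length (x # vs)] = _\<close> seqs_Cons list.map putV.simps
    by (rule execI[OF exec_Seq[OF 1 2[unfolded eq]] refl]) simp
qed

definition freshvars :: "nat \<Rightarrow> nat \<Rightarrow> reg com" where
  "freshvars k n = seqs (\<lambda>j. copyF (RV j) ;; inc RF) [k..<k + n]"

lemma exec_freshvars:
  assumes "s RF = bin f" "s RX = []" "s RY = []" "\<And>i. s (RV i) = [] \<or> i < k" "f + n < 2 ^ M"
  shows "exec (freshvars k n) s (n * (21 * M + 9)) (putV k (map bin [f..<f + n]) (s(RF := bin (f + n))))"
  using assms unfolding freshvars_def
proof (induction n arbitrary: k f s)
  case 0
  then show ?case by (auto intro!: exec_Skip_eq simp: fun_eq_iff)
next
  case (Suc n)
  have len: "length (bin f) \<le> M" by (rule length_bin_le) (use Suc.prems in simp)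
  let ?s1 = "s(RV k := bin f)" and ?s2 = "s(RV k := bin f, RF := bin (Suc f))"
  have "exec (copyF (RV k)) s (13 * M + 3) ?s1"
    by (rule execI[OF exec_copyF]) (use Suc.prems(1-3) Suc.prems(4)[of k] set_bin len in auto)
  moreover have "exec (inc RF) ?s1 (8 * M + 6) ?s2"
    by (rule execI[OF exec_inc_bin[of _ _ f]]) (use Suc.prems(1-3) len in auto)
  ultimately have 1: "exec (copyF (RV k) ;; inc RF) s (13 * M + 3 + (8 * M + 6)) ?s2" by (rule exec_Seq)
  have 2: "exec (seqs (\<lambda>j. copyF (RV j) ;; inc RF) [Suc k..<Suc k + n]) ?s2 (n * (21 * M + 9))
      (putV (Suc k) (map bin [Suc f..<Suc f + n]) (?s2(RF := bin (Suc f + n))))"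
    by (rule Suc.IH) (use Suc.prems in \<open>auto simp: less_Suc_eq\<close>)
  have "[k..<k + Suc n] = k # [Suc k..<Suc k + n]" "[f..<f + Suc n] = f # [Suc f..<Suc f + n]"
    by (simp_all add: upt_conv_Cons del: upt_Suc)
  have eq: "?s2(RF := bin (Suc f + n)) = s(RF := bin (f + Suc n), RV k := bin f)" by (auto simp: fun_eq_iff)
  show ?case unfolding \<open>[k..<k + Suc n] = _\<close> \<open>[f..<f + Suc n] = _\<close> seqs_Cons list.map putV.simps
    by (rule execI[OF exec_Seq[OF 1 2[unfolded eq]] refl]) simp
qed

lemma exec_clear:
  assumes "set (s r) \<subseteq> S" "0 \<notin> S"
  shows "exec (While r S (Pop r)) s (3 * length (s r) + 1) (s(r := []))"
  using assms(1)
proof (induction "s r" arbitrary: s)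
  case Nil
  then show ?case using assms(2) by (intro execI[OF exec_WhileF]) (auto simp: fun_eq_iff simp flip: Nil(1))
next
  case (Cons a w)
  have sr: "s r = a # w" using Cons(2) by simp
  have "exec (While r S (Pop r)) (s(r := w)) (3 * length ((s(r := w)) r) + 1) ((s(r := w))(r := []))"
    by (rule Cons(1)) (use Cons(3) sr in auto)
  then have 1: "exec (While r S (Pop r)) (s(r := w)) (3 * length w + 1) (s(r := []))" by simp
  show ?case by (rule execI[OF exec_WhileT[OF _ exec_Pop' 1]]) (use sr Cons(3) in auto)
qed

definition clearvars :: "nat \<Rightarrow> nat \<Rightarrow> reg com" where
  "clearvars j n = seqs (\<lambda>j. While (RV j) {1, 2} (Pop (RV j))) [j..<j + n]"

lemma exec_clearvars:
  assumes "\<And>i. j \<le> i \<Longrightarrow> i < j + n \<Longrightarrow> set (s (RV i)) \<subseteq> {1, 2} \<and> length (s (RV i)) \<le> M"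
  shows "exec (clearvars j n) s (n * (3 * M + 1)) (putV j (replicate n []) s)"
  using assms unfolding clearvars_def
proof (induction n arbitrary: j s)
  case 0
  then show ?case by (auto intro!: exec_Skip_eq simp: fun_eq_iff)
next
  case (Suc n)
  let ?s1 = "s(RV j := [])"
  have 1: "exec (While (RV j) {1, 2} (Pop (RV j))) s (3 * M + 1) ?s1"
    by (rule execI[OF exec_clear]) (use Suc.prems[of j] in auto)
  have 2: "exec (seqs (\<lambda>j. While (RV j) {1, 2} (Pop (RV j))) [Suc j..<Suc j + n]) ?s1 (n * (3 * M + 1))
      (putV (Suc j) (replicate n []) ?s1)"
    by (rule Suc.IH) (use Suc.prems in auto)
  have "[j..<j + Suc n] = j # [Suc j..<Suc j + n]"
    by (simp add: upt_conv_Cons del: upt_Suc)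
  then show ?case unfolding \<open>[j..<j + Suc n] = _\<close> seqs_Cons
    by (intro execI[OF exec_Seq[OF 1 2]]) auto
qed

definition process :: "nat \<Rightarrow> nat \<Rightarrow> gadget \<Rightarrow> reg com" where
  "process k n ts = readvars 0 k ;; freshvars k n ;; seqs emit_term ts ;; clearvars 0 (k + n)"

definition time_process :: "nat \<Rightarrow> nat \<Rightarrow> nat \<Rightarrow> nat \<Rightarrow> gadget \<Rightarrow> nat" where
  "time_process M N k n ts = k * (8 * M + 3) + (n * (21 * M + 9) + ((\<Sum>x\<leftarrow>ts. time_term M N x) + (k + n) * (3 * M + 1)))"

lemma exec_process:
  assumes "s RI = concat (map (\<lambda>i. 3 # bin i) vs) @ v" "v = [] \<or> hd v > 3" "s RX = []" "s RY = []"
    "\<And>i. s (RV i) = []" "\<And>i. i \<in> set vs \<Longrightarrow> i < 2 ^ M" "s RF = bin f" "f + n < 2 ^ M"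
    and gadget: "\<forall>(p, e, z)\<in>set ts. p \<le> Lv \<and> (\<forall>A\<in>set e. atom_vars A \<subseteq> {..<length vs + n})" "counters N Lv s"
  shows "exec (process (length vs) n ts) s (time_process M N (length vs) n ts)
    (emits_to (concat (map enc_atom (gadget_family.copies N (place f vs) ts))) (pos_part N ts) (neg_part N ts)
      (s(RI := v, RF := bin (f + n))))"
proof -
  let ?k = "length vs" and ?w = "concat (map enc_atom (gadget_family.copies N (place f vs) ts))"
  let ?s1 = "putV 0 (map bin vs) (s(RI := v))"
  let ?s2 = "putV ?k (map bin [f..<f + n]) (?s1(RF := bin (f + n)))"
  let ?s3 = "emits_to ?w (pos_part N ts) (neg_part N ts) ?s2"
  let ?s4 = "putV 0 (replicate (?k + n) []) ?s3"
  have small: "place f vs i < 2 ^ M" if "i < ?k + n" for i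
    using that assms(6,8) nth_mem[of i vs] by (auto simp: place_def)
  have var: "?s2 (RV i) = bin (place f vs i)" if "i < ?k + n" for i
    using that by (auto simp: putV_RV place_def)
  have 1: "exec (readvars 0 ?k) s (?k * (8 * M + 3)) ?s1"
    by (rule exec_readvars) (use assms in auto)
  have 2: "exec (freshvars ?k n) ?s1 (n * (21 * M + 9)) ?s2"
    by (rule exec_freshvars) (use assms in \<open>auto simp: putV_RV\<close>)
  have 3: "exec (seqs emit_term ts) ?s2 (\<Sum>x\<leftarrow>ts. time_term M N x) ?s3"
  proof (rule exec_emit_gadget[OF _ gadget(1)])
    show "vars_ok M {..<?k + n} (place f vs) ?s2"
      using var small assms(3) length_bin_le by (simp add: vars_ok_def)
    show "counters N Lv ?s2" using gadget(2) by (simp add: counters_def)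
  qed
  have 4: "exec (clearvars 0 (?k + n)) ?s3 ((?k + n) * (3 * M + 1)) ?s4"
    by (rule exec_clearvars) (use var small length_bin_le set_bin in simp)
  have "?s4 = emits_to ?w (pos_part N ts) (neg_part N ts) (s(RI := v, RF := bin (f + n)))"
  proof
    fix r
    show "?s4 r = emits_to ?w (pos_part N ts) (neg_part N ts) (s(RI := v, RF := bin (f + n))) r"
      using assms(5) by (cases r) (auto simp: putV_apply emits_to_def)
  qed
  with exec_Seq[OF 1 exec_Seq[OF 2 exec_Seq[OF 3 4]]] show ?thesis
    by (simp only: process_def time_process_def)
qed

text \<open>The symbol is read into the control, not into a register: a decision tree of depth
  \<open>d\<close>, where \<open>w\<close> is the word read so far, gives each symbol its own gadget
  code.\<close>

fun parse :: "nat \<Rightarrow> word \<Rightarrow> (word \<Rightarrow> reg com) \<Rightarrow> reg com" where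
  "parse 0 w act = act w"
| "parse (Suc d) w act = Cond RI {1} (Pop RI ;; parse d (w @ [1]) act)
    (Cond RI {2} (Pop RI ;; parse d (w @ [2]) act) (act w))"

lemma exec_parse:
  assumes "s RI = w @ v" "set w \<subseteq> {1, 2}" "head0 v \<notin> {1, 2}" "length w \<le> d"
    "exec (act (w' @ w)) (s(RI := v)) t s'"
  shows "exec (parse d w' act) s (t + 5 * d) s'"
  using assms
proof (induction d arbitrary: w w' s)
  case 0
  then have "s(RI := v) = s" by auto
  with 0 show ?case by simp
next
  case (Suc d)
  show ?case
  proof (cases w)
    case Nil
    then have s: "s(RI := v) = s" using Suc.prems by auto
    have "exec (act w') s t s'" using Suc.prems(5) Nil unfolding s by simp
    then show ?thesis unfolding parse.simps
      by (intro execI[OF exec_CondF[OF _ exec_CondF]]) (use Suc.prems Nil in auto)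
  next
    case (Cons a x)
    have act: "exec (act ((w' @ [a]) @ x)) (s(RI := x @ v, RI := v)) t s'"
      using Suc.prems(5) unfolding Cons by (simp only: fun_upd_upd append_assoc append.simps)
    have IH: "exec (parse d (w' @ [a]) act) (s(RI := x @ v)) (t + 5 * d) s'"
      by (rule Suc.IH[OF _ _ _ _ act]) (use Suc.prems(1-4) Cons in auto)
    have P: "exec (Pop RI) s 1 (s(RI := x @ v))" by (rule exec_Pop') (use Suc.prems Cons in auto)
    from Suc.prems(2) Cons consider "a = 1" | "a = 2" by auto
    then show ?thesis
    proof cases
      case 1
      then show ?thesis unfolding parse.simps
        by (intro execI[OF exec_CondT[OF _ exec_Seq[OF P]]]) (use IH Suc.prems Cons in auto)
    next
      case 2
      then show ?thesis unfolding parse.simps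
        by (intro execI[OF exec_CondF[OF _ exec_CondT[OF _ exec_Seq[OF P]]]]) (use IH Suc.prems Cons in auto)
    qed
  qed
qed

text \<open>The loops that copy expressions use the counters below \<open>Lv\<close>. The counter
  \<open>Lv\<close> drives the outer loop of the division, which has such loops inside; hence
  \<open>Suc Lv\<close> counters in \<open>clean\<close>.\<close>

locale program = gadget_family l g s H for l g s H +
  fixes ar :: "nat \<Rightarrow> nat" and S :: "nat set" and Lv D :: nat
  assumes finite_S: "finite S"
    and D: "\<And>r. r \<in> S \<Longrightarrow> length (bin r) \<le> D"
    and g_ok: "\<And>r. r \<in> S \<Longrightarrow> \<forall>(p, e, z)\<in>set (g r). p \<le> Lv \<and> (\<forall>A\<in>set e. atom_vars A \<subseteq> {..<ar r + l r})"
    and H: "H \<le> Lv" and s0: "s > 0"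
begin

text \<open>At a word that is not of the form \<open>bin r\<close> the gadget is arbitrary; an
  instance never leads there.\<close>

definition symbol :: "word \<Rightarrow> reg com" where
  "symbol w = (let r = inv bin w in process (ar r) (l r) (g r))"

definition translate :: "reg com" where
  "translate = Cond RI {4} (Pop RI ;; parse D [] symbol) (Cpy RI RO ;; Pop RI ;; mv RI RO {1, 2, 3})"

definition translate_all :: "reg com" where
  "translate_all = While RI {4, 5, 6} translate"

definition time_translate :: "nat \<Rightarrow> nat \<Rightarrow> nat" where
  "time_translate M N = (\<Sum>r\<in>S. time_process M N (ar r) (l r) (g r)) + 5 * D + 8 * M + 10"

fun atom_pos :: "nat \<Rightarrow> nat atom \<Rightarrow> nat" where
  "atom_pos N (Rel r vs) = pos_part N (g r)"
| "atom_pos N _ = 0"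

fun atom_neg :: "nat \<Rightarrow> nat atom \<Rightarrow> nat" where
  "atom_neg N (Rel r vs) = neg_part N (g r)"
| "atom_neg N _ = 0"

lemma atom_pos_neg: "int (atom_pos N A) - int (atom_neg N A) = atom_offset N A"
  by (cases A) (auto simp: pos_neg_part)

fun ok_atom :: "nat \<Rightarrow> nat atom \<Rightarrow> bool" where
  "ok_atom M (Rel r vs) \<longleftrightarrow> r \<in> S \<and> length vs = ar r \<and> (\<forall>i\<in>set vs. i < 2 ^ M)"
| "ok_atom M (Equal i j) \<longleftrightarrow> i < 2 ^ M \<and> j < 2 ^ M"
| "ok_atom M (Empty i) \<longleftrightarrow> i < 2 ^ M"

definition clean :: "nat \<Rightarrow> reg store \<Rightarrow> bool" where
  "clean N st \<longleftrightarrow> st RX = [] \<and> st RY = [] \<and> (\<forall>i. st (RV i) = []) \<and> counters N (Suc Lv) st"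

lemma exec_copy_atom:
  assumes "st RI = a # w @ v" "a \<noteq> 4" "set w \<subseteq> {1, 2, 3}" "v = [] \<or> hd v > 3"
  shows "exec translate st (4 * length w + 5) (emits_to (a # w) 0 0 (st(RI := v)))"
proof -
  let ?s1 = "st(RO := a # st RO)" and ?s2 = "st(RO := a # st RO, RI := w @ v)"
  have 1: "exec (Cpy RI RO) st 1 ?s1" by (rule exec_Cpy') (use assms in auto)
  have 2: "exec (Pop RI) ?s1 1 ?s2" by (rule exec_Pop') (use assms in auto)
  have 3: "exec (mv RI RO {1, 2, 3}) ?s2 (4 * length w + 1) (?s2(RI := v, RO := rev w @ ?s2 RO))"
    by (rule exec_mv) (use assms in \<open>auto simp: head0_def\<close>)
  show ?thesis unfolding translate_def
    by (rule execI[OF exec_CondF[OF _ exec_Seq[OF 1 exec_Seq[OF 2 3]]]])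
      (use assms in \<open>auto simp: emits_to_def fun_eq_iff\<close>)
qed

lemma inv_bin: "inv bin (bin n) = n"
  using bin_inj by (meson injI inv_f_f)

lemma exec_translate:
  assumes "st RI = enc_atom A @ v" "v = [] \<or> hd v > 3" "ok_atom M A" "st RF = bin f" "f + aux A < 2 ^ M"
    "clean N st"
  shows "exec translate st (time_translate M N)
    (emits_to (concat (map enc_atom (emit N f A))) (atom_pos N A) (atom_neg N A) (st(RI := v, RF := bin (f + aux A))))"
proof (cases A)
  case (Rel r vs)
  let ?v = "concat (map (\<lambda>i. 3 # bin i) vs) @ v" and ?t = "time_process M N (ar r) (l r) (g r)"
  let ?s' = "emits_to (concat (map enc_atom (emit N f A))) (atom_pos N A) (atom_neg N A) (st(RI := v, RF := bin (f + aux A)))"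
  have r: "r \<in> S" "length vs = ar r" using assms(3) Rel by auto
  have "exec (process (length vs) (l r) (g r)) (st(RI := ?v)) (time_process M N (length vs) (l r) (g r))
    (emits_to (concat (map enc_atom (gadget_family.copies N (place f vs) (g r)))) (pos_part N (g r)) (neg_part N (g r))
      ((st(RI := ?v))(RI := v, RF := bin (f + l r))))"
    by (rule exec_process[where Lv = Lv])
      (use assms Rel g_ok[OF r(1)] r in \<open>auto simp: clean_def counters_def\<close>)
  then have "exec (symbol ([] @ bin r)) ((st(RI := bin r @ ?v))(RI := ?v)) ?t ?s'"
    using r Rel by (simp add: symbol_def inv_bin Let_def)
  then have 1: "exec (parse D [] symbol) (st(RI := bin r @ ?v)) (?t + 5 * D) ?s'"
  proof (rule exec_parse[rotated -1])
    show "head0 ?v \<notin> {1, 2}" using assms(2) by (cases vs; cases v) auto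
    show "length (bin r) \<le> D" by (rule D[OF r(1)])
  qed (use set_bin in auto)
  have 2: "exec (Pop RI) st 1 (st(RI := bin r @ ?v))"
    by (rule exec_Pop'[of _ _ 4]) (use assms Rel in auto)
  have "?t \<le> (\<Sum>r\<in>S. time_process M N (ar r) (l r) (g r))"
    by (rule member_le_sum) (use r finite_S in auto)
  then show ?thesis unfolding translate_def
    by (intro execI[OF exec_CondT[OF _ exec_Seq[OF 2 1]]]) (use assms Rel in \<open>auto simp: time_translate_def\<close>)
next
  case (Equal i j)
  have "length (bin i) \<le> M" "length (bin j) \<le> M" using assms Equal length_bin_le by auto
  moreover have "exec translate st (4 * length (bin i @ 3 # bin j) + 5) (emits_to (5 # bin i @ 3 # bin j) 0 0 (st(RI := v)))"
    by (rule exec_copy_atom) (use assms Equal set_bin in auto)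
  ultimately show ?thesis using assms Equal
    by (elim execI) (auto simp: time_translate_def emits_to_def fun_eq_iff)
next
  case (Empty i)
  have "length (bin i) \<le> M" using assms Empty length_bin_le by auto
  moreover have "exec translate st (4 * length (bin i) + 5) (emits_to (6 # bin i) 0 0 (st(RI := v)))"
    by (rule exec_copy_atom) (use assms Empty set_bin in auto)
  ultimately show ?thesis using assms Empty
    by (elim execI) (auto simp: time_translate_def emits_to_def fun_eq_iff)
qed

lemma head_atom: "head0 (enc_atom A @ v) \<in> {4, 5, 6}"
  by (cases A) auto

lemma exec_translate_all:
  assumes "st RI = concat (map enc_atom \<phi>) @ 7 # v" "\<forall>A\<in>set \<phi>. ok_atom M A" "st RF = bin f"
    "fresh f \<phi> < 2 ^ M" "clean N st"
  shows "exec translate_all st (length \<phi> * (time_translate M N + 2) + 1)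
    (emits_to (concat (map enc_atom (emits N f \<phi>))) (\<Sum>A\<leftarrow>\<phi>. atom_pos N A) (\<Sum>A\<leftarrow>\<phi>. atom_neg N A)
      (st(RI := 7 # v, RF := bin (fresh f \<phi>))))"
  using assms unfolding translate_all_def
proof (induction \<phi> arbitrary: st f)
  case Nil
  then show ?case by (intro execI[OF exec_WhileF]) (auto simp: fun_eq_iff fresh_def)
next
  case (Cons A \<phi>)
  let ?v = "concat (map enc_atom \<phi>) @ 7 # v"
  let ?s = "emits_to (concat (map enc_atom (emit N f A))) (atom_pos N A) (atom_neg N A) (st(RI := ?v, RF := bin (f + aux A)))"
  have 1: "exec translate st (time_translate M N) ?s"
    by (rule exec_translate) (use Cons.prems hd_atoms in \<open>auto simp: fresh_def\<close>)
  have 2: "exec (While RI {4, 5, 6} translate) ?s (length \<phi> * (time_translate M N + 2) + 1)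
    (emits_to (concat (map enc_atom (emits N (f + aux A) \<phi>))) (\<Sum>A\<leftarrow>\<phi>. atom_pos N A) (\<Sum>A\<leftarrow>\<phi>. atom_neg N A)
      (?s(RI := 7 # v, RF := bin (fresh (f + aux A) \<phi>))))"
    by (rule Cons.IH) (use Cons.prems in \<open>auto simp: fresh_def clean_def counters_def\<close>)
  have hd: "head0 (st RI) \<in> {4, 5, 6}" using Cons.prems(1) head_atom by simp
  have eq: "?s(RI := 7 # v, RF := y) = emits_to (concat (map enc_atom (emit N f A))) (atom_pos N A) (atom_neg N A)
      (st(RI := 7 # v, RF := y))" for y
    by (auto simp: emits_to_def fun_eq_iff)
  have f: "fresh (f + aux A) \<phi> = fresh f (A # \<phi>)" by (simp add: fresh_def)
  show ?case by (rule execI[OF exec_WhileT[OF hd 1 2[unfolded eq emits_to_emits_to f]]],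
        simp only: emits.simps map_append concat_append list.map sum_list.Cons, simp)
qed

end

section \<open>Binary addition and subtraction\<close>

fun val :: "word \<Rightarrow> nat" where
  "val [] = 0"
| "val (d # w) = of_bool (d = 2) + 2 * val w"

lemma val_bin [simp]: "val (bin n) = n"
proof (induction n rule: bin.induct)
  case (1 n)
  show ?case
  proof (cases "n = 0")
    case False
    with 1 show ?thesis by (subst bin.simps) (auto simp: mod_2_eq_odd)
  qed simp
qed

lemma val_less: "val w < 2 ^ length w"
  by (induction w) auto

lemma val_replicate [simp]: "val (replicate n (Suc 0)) = 0"
  by (induction n) auto

fun ripple :: "(bool \<Rightarrow> bool \<Rightarrow> bool \<Rightarrow> bool) \<Rightarrow> word \<Rightarrow> word \<Rightarrow> bool \<Rightarrow> word \<times> bool" where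
  "ripple cf [] ys c = ([], c)"
| "ripple cf (x # xs) ys c = (let a = (x = 2); b = (head0 ys = 2); (zs, c') = ripple cf xs (tl ys) (cf a b c) in
     ((if (a \<noteq> b) \<noteq> c then 2 else 1) # zs, c'))"

definition carry :: "bool \<Rightarrow> bool \<Rightarrow> bool \<Rightarrow> bool" where
  "carry a b c \<longleftrightarrow> a \<and> b \<or> a \<and> c \<or> b \<and> c"

definition borrow :: "bool \<Rightarrow> bool \<Rightarrow> bool \<Rightarrow> bool" where
  "borrow a b c \<longleftrightarrow> \<not> a \<and> b \<or> \<not> a \<and> c \<or> b \<and> c"

lemma ripple_digits:
  "ripple cf xs ys c = (zs, c') \<Longrightarrow> length zs = length xs \<and> set zs \<subseteq> {1, 2}"
proof (induction xs arbitrary: ys c zs c')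
  case (Cons x xs)
  obtain zs' where "ripple cf xs (tl ys) (cf (x = 2) (head0 ys = 2) c) = (zs', c')"
    and "zs = (if ((x = 2) \<noteq> (head0 ys = 2)) \<noteq> c then 2 else 1) # zs'"
    using Cons.prems by (auto simp: Let_def split: prod.splits)
  with Cons.IH show ?case by auto
qed auto

lemma val_split: "val ys = of_bool (head0 ys = 2) + 2 * val (tl ys)"
  by (cases ys) auto

lemma ripple_carry:
  assumes "ripple carry xs ys c = (zs, c')" "length ys \<le> length xs"
  shows "val zs + 2 ^ length xs * of_bool c' = val xs + val ys + of_bool c"
  using assms
proof (induction xs arbitrary: ys c zs c')
  case (Cons x xs)
  obtain zs' where 1: "ripple carry xs (tl ys) (carry (x = 2) (head0 ys = 2) c) = (zs', c')"
    and zs: "zs = (if ((x = 2) \<noteq> (head0 ys = 2)) \<noteq> c then 2 else 1) # zs'"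
    using Cons.prems(1) by (auto simp: Let_def split: prod.splits)
  from Cons.IH[OF 1] Cons.prems(2)
  have "val zs' + 2 ^ length xs * of_bool c' = val xs + val (tl ys) + of_bool (carry (x = 2) (head0 ys = 2) c)"
    by simp
  then show ?case unfolding zs val_split[of ys]
    by (cases "x = 2"; cases "head0 ys = 2"; cases c) (auto simp: carry_def)
qed auto

text \<open>As a word of this length has value below \<open>2 ^ length xs\<close>, the final borrow
  tells whether too much was subtracted. Division uses it as its comparison.\<close>

lemma ripple_borrow:
  assumes "ripple borrow xs ys c = (zs, c')" "length ys \<le> length xs"
  shows "val zs + val ys + of_bool c = val xs + 2 ^ length xs * of_bool c'"
  using assms
proof (induction xs arbitrary: ys c zs c')
  case (Cons x xs)
  obtain zs' where 1: "ripple borrow xs (tl ys) (borrow (x = 2) (head0 ys = 2) c) = (zs', c')"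
    and zs: "zs = (if ((x = 2) \<noteq> (head0 ys = 2)) \<noteq> c then 2 else 1) # zs'"
    using Cons.prems(1) by (auto simp: Let_def split: prod.splits)
  from Cons.IH[OF 1] Cons.prems(2)
  have "val zs' + val (tl ys) + of_bool (borrow (x = 2) (head0 ys = 2) c) = val xs + 2 ^ length xs * of_bool c'"
    by simp
  then show ?case unfolding zs val_split[of ys]
    by (cases "x = 2"; cases "head0 ys = 2"; cases c) (auto simp: borrow_def)
qed auto

definition flag :: "bool \<Rightarrow> word" where
  "flag c = (if c then [1] else [])"

text \<open>The current digits and the carry are parameters of the program text: the control
  remembers them, and every combination has its own code.\<close>

definition rip_out :: "(bool \<Rightarrow> bool \<Rightarrow> bool \<Rightarrow> bool) \<Rightarrow> bool \<Rightarrow> bool \<Rightarrow> bool \<Rightarrow> reg com" where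
  "rip_out cf a b c = Push RAcc2 (if (a \<noteq> b) \<noteq> c then 2 else 1) ;; push_word RC (flag (cf a b c))"

definition rip_carry :: "(bool \<Rightarrow> bool \<Rightarrow> bool \<Rightarrow> bool) \<Rightarrow> bool \<Rightarrow> bool \<Rightarrow> reg com" where
  "rip_carry cf a b = Cond RC {1} (Pop RC ;; rip_out cf a b True) (rip_out cf a b False)"

definition rip_second :: "(bool \<Rightarrow> bool \<Rightarrow> bool \<Rightarrow> bool) \<Rightarrow> reg \<Rightarrow> bool \<Rightarrow> reg com" where
  "rip_second cf y a = Cond y {1, 2}
     (Cpy y RY ;; Cond y {2} (Pop y ;; rip_carry cf a True) (Pop y ;; rip_carry cf a False))
     (rip_carry cf a False)"

definition rip_digit :: "(bool \<Rightarrow> bool \<Rightarrow> bool \<Rightarrow> bool) \<Rightarrow> reg \<Rightarrow> reg com" where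
  "rip_digit cf y = Cond RAcc {2} (Pop RAcc ;; rip_second cf y True) (Pop RAcc ;; rip_second cf y False)"

text \<open>The second operand survives, as its digits wait in \<open>RY\<close> and are moved back
  at the end.\<close>

definition rip :: "(bool \<Rightarrow> bool \<Rightarrow> bool \<Rightarrow> bool) \<Rightarrow> reg \<Rightarrow> reg com" where
  "rip cf y = While RAcc {1, 2} (rip_digit cf y) ;; mv RAcc2 RAcc {1, 2} ;; mv RY y {1, 2}"

lemma exec_rip_out:
  assumes "s RC = []"
  shows "exec (rip_out cf a b c) s 2 (s(RAcc2 := (if (a \<noteq> b) \<noteq> c then 2 else 1) # s RAcc2, RC := flag (cf a b c)))"
  unfolding rip_out_def
  by (rule execI[OF exec_Seq[OF exec_Push exec_push_word]]) (use assms in \<open>auto simp: flag_def\<close>)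

lemma exec_rip_carry:
  assumes "s RC = flag c"
  shows "exec (rip_carry cf a b) s 5 (s(RAcc2 := (if (a \<noteq> b) \<noteq> c then 2 else 1) # s RAcc2, RC := flag (cf a b c)))"
proof (cases c)
  case True
  with assms have c: "s RC = [1]" by (simp add: flag_def)
  show ?thesis unfolding rip_carry_def
    by (rule execI[OF exec_CondT[OF _ exec_Seq[OF exec_Pop'[of s RC 1 "[]"] exec_rip_out]]])
      (use c True in \<open>auto simp: fun_eq_iff\<close>)
next
  case False
  with assms have c: "s RC = []" by (simp add: flag_def)
  show ?thesis unfolding rip_carry_def
    by (rule execI[OF exec_CondF[OF _ exec_rip_out]]) (use c False in \<open>auto simp: fun_eq_iff\<close>)
qed

lemma exec_rip_second:
  assumes "s RC = flag c" "set (s y) \<subseteq> {1, 2}" "y \<notin> {RC, RAcc2, RY, RAcc}"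
  shows "exec (rip_second cf y a) s 11 (s(RAcc2 := (if (a \<noteq> (head0 (s y) = 2)) \<noteq> c then 2 else 1) # s RAcc2,
    RC := flag (cf a (head0 (s y) = 2) c), RY := take 1 (s y) @ s RY, y := tl (s y)))"
proof (cases "s y")
  case Nil
  show ?thesis unfolding rip_second_def
    by (rule execI[OF exec_CondF[OF _ exec_rip_carry]]) (use assms Nil in \<open>auto simp: fun_eq_iff\<close>)
next
  case (Cons d w)
  let ?s1 = "s(RY := d # s RY)" and ?s2 = "s(RY := d # s RY, y := w)"
  have hd: "head0 (s y) \<in> {1, 2}" using assms Cons by auto
  have 1: "exec (Cpy y RY) s 1 ?s1" by (rule exec_Cpy') (use assms Cons in auto)
  have 2: "exec (Pop y) ?s1 1 ?s2" by (rule exec_Pop') (use assms Cons in auto)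
  have c: "?s2 RC = flag c" using assms by auto
  note 3 = exec_rip_carry[of ?s2 c cf a, OF c]
  have hd1: "head0 (?s1 y) = d" using Cons assms(3) by auto
  show ?thesis
  proof (cases "d = 2")
    case True
    show ?thesis unfolding rip_second_def
      by (rule execI[OF exec_CondT[OF hd exec_Seq[OF 1 exec_CondT[OF _ exec_Seq[OF 2 3]]]]])
        (use assms Cons True hd1 in \<open>auto simp: fun_eq_iff\<close>)
  next
    case False
    show ?thesis unfolding rip_second_def
      by (rule execI[OF exec_CondT[OF hd exec_Seq[OF 1 exec_CondF[OF _ exec_Seq[OF 2 3]]]]])
        (use assms Cons False hd1 in \<open>auto simp: fun_eq_iff\<close>)
  qed
qed

lemma exec_rip_digit:
  assumes "s RAcc = x # xs" "s RC = flag c" "set (s y) \<subseteq> {1, 2}" "y \<notin> {RC, RAcc2, RY, RAcc}"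
  shows "exec (rip_digit cf y) s 14 (s(RAcc := xs,
    RAcc2 := (if ((x = 2) \<noteq> (head0 (s y) = 2)) \<noteq> c then 2 else 1) # s RAcc2,
    RC := flag (cf (x = 2) (head0 (s y) = 2) c), RY := take 1 (s y) @ s RY, y := tl (s y)))"
proof -
  let ?s1 = "s(RAcc := xs)"
  have 1: "exec (Pop RAcc) s 1 ?s1" by (rule exec_Pop'[of s, OF assms(1)])
  have "?s1 RC = flag c" "set (?s1 y) \<subseteq> {1, 2}" using assms by auto
  note 2 = exec_rip_second[of ?s1 c y cf, OF this assms(4)]
  show ?thesis
  proof (cases "x = 2")
    case True
    show ?thesis unfolding rip_digit_def
      by (rule execI[OF exec_CondT[OF _ exec_Seq[OF 1 2]]]) (use assms True in \<open>auto simp: fun_eq_iff\<close>)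
  next
    case False
    show ?thesis unfolding rip_digit_def
      by (rule execI[OF exec_CondF[OF _ exec_Seq[OF 1 2]]]) (use assms False in \<open>auto simp: fun_eq_iff\<close>)
  qed
qed

lemma exec_rip_loop:
  assumes "s RAcc = xs" "s y = ys" "s RC = flag c" "set xs \<subseteq> {1, 2}" "set ys \<subseteq> {1, 2}"
    "y \<notin> {RC, RAcc2, RY, RAcc}" "ripple cf xs ys c = (zs, c')"
  shows "exec (While RAcc {1, 2} (rip_digit cf y)) s (16 * length xs + 1)
    (s(RAcc := [], RAcc2 := rev zs @ s RAcc2, RC := flag c',
      RY := rev (take (length xs) ys) @ s RY, y := drop (length xs) ys))"
  using assms
proof (induction xs arbitrary: s ys c zs)
  case Nil
  then show ?case by (intro execI[OF exec_WhileF]) (auto simp: fun_eq_iff)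
next
  case (Cons x xs)
  let ?cf = "cf (x = 2) (head0 ys = 2) c"
  obtain zs' where 1: "ripple cf xs (tl ys) ?cf = (zs', c')"
    and zs: "zs = (if ((x = 2) \<noteq> (head0 ys = 2)) \<noteq> c then 2 else 1) # zs'"
    using Cons.prems(7) by (auto simp: Let_def split: prod.splits)
  let ?s = "s(RAcc := xs, RAcc2 := (if ((x = 2) \<noteq> (head0 ys = 2)) \<noteq> c then 2 else 1) # s RAcc2,
    RC := flag ?cf, RY := take 1 ys @ s RY, y := tl ys)"
  have 2: "exec (rip_digit cf y) s 14 ?s"
    using exec_rip_digit[of s x xs c y cf, OF Cons.prems(1,3) _ Cons.prems(6), unfolded Cons.prems(2), OF Cons.prems(5)] .
  have tl: "set (tl ys) \<subseteq> {1, 2}" using Cons.prems(5) by (cases ys) auto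
  have 3: "exec (While RAcc {1, 2} (rip_digit cf y)) ?s (16 * length xs + 1)
    (?s(RAcc := [], RAcc2 := rev zs' @ ?s RAcc2, RC := flag c',
      RY := rev (take (length xs) (tl ys)) @ ?s RY, y := drop (length xs) (tl ys)))"
    by (rule Cons.IH[OF _ _ _ _ _ _ 1]) (use tl Cons.prems(4,6) in auto)
  show ?case
  proof (rule execI[OF exec_WhileT[OF _ 2 3]])
    show "head0 (s RAcc) \<in> {1, 2}" using Cons.prems by auto
    show "?s(RAcc := [], RAcc2 := rev zs' @ ?s RAcc2, RC := flag c',
      RY := rev (take (length xs) (tl ys)) @ ?s RY, y := drop (length xs) (tl ys))
      = s(RAcc := [], RAcc2 := rev zs @ s RAcc2, RC := flag c',
      RY := rev (take (length (x # xs)) ys) @ s RY, y := drop (length (x # xs)) ys)"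
      using Cons.prems(6) zs by (cases ys) (auto simp: fun_eq_iff)
  qed auto
qed

lemma exec_rip:
  assumes "set (s RAcc) \<subseteq> {1, 2}" "set (s y) \<subseteq> {1, 2}" "s RC = flag c" "s RAcc2 = []" "s RY = []"
    "y \<notin> {RC, RAcc2, RY, RAcc}" "ripple cf (s RAcc) (s y) c = (zs, c')"
  shows "exec (rip cf y) s (24 * length (s RAcc) + 3) (s(RAcc := zs, RC := flag c'))"
proof -
  let ?n = "length (s RAcc)"
  let ?s1 = "s(RAcc := [], RAcc2 := rev zs @ s RAcc2, RC := flag c',
      RY := rev (take ?n (s y)) @ s RY, y := drop ?n (s y))"
  let ?s2 = "?s1(RAcc2 := [], RAcc := zs)"
  have zs: "length zs = ?n" "set zs \<subseteq> {1, 2}" using ripple_digits[OF assms(7)] by auto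
  have 1: "exec (While RAcc {1, 2} (rip_digit cf y)) s (16 * ?n + 1) ?s1"
    by (rule exec_rip_loop) (use assms in auto)
  have 2: "exec (mv RAcc2 RAcc {1, 2}) ?s1 (4 * ?n + 1) ?s2"
    by (rule execI[OF exec_mv_all]) (use assms zs in \<open>auto simp: fun_eq_iff\<close>)
  have "set (take ?n (s y)) \<subseteq> {1, 2}" using assms(2) set_take_subset by fast
  then have 3: "exec (mv RY y {1, 2}) ?s2 (4 * ?n + 1) (s(RAcc := zs, RC := flag c'))"
    by (intro execI[OF exec_mv_all]) (use assms zs in \<open>auto simp: fun_eq_iff\<close>)
  show ?thesis unfolding rip_def by (rule execI[OF exec_Seq[OF 1 exec_Seq[OF 2 3]]]) auto
qed

section \<open>Computation of the threshold\<close>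

context program
begin

text \<open>Tries \<open>N\<close> times to subtract the divisor; \<open>RFlag\<close> records the
  first failure, which spoils the accumulator. Every success adds \<open>N ^ H\<close> units, so the
  quotient appears with its weight, and the limit of \<open>N\<close> rounds is the
  clamping.\<close>

definition divide_prog :: "bool \<Rightarrow> reg com" where
  "divide_prog up = loop Lv (Cond RFlag {1} Skip (rip borrow RQ ;;
     Cond RC {1} (Pop RC ;; Push RFlag 1) (rep H (Push (if up then RPos else RNeg) 1))))"

definition time_divide :: "nat \<Rightarrow> nat" where
  "time_divide N = N * (24 * N + 3 + (time_rep N H 1 + 4) + 2 + 8) + 2"

lemma exec_push_sign: "exec (Push (if up then RPos else RNeg) 1) st 1 (emits_to [] (of_bool up) (of_bool (\<not> up)) st)"
  by (rule execI[OF exec_Push]) (auto simp: emits_to_def)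

lemma concat_replicate_Nil: "concat (replicate n []) = []"
  by (induction n) auto

lemma exec_rep_sign:
  assumes "counters N H st"
  shows "exec (rep H (Push (if up then RPos else RNeg) 1)) st (time_rep N H 1)
    (emits_to [] (N ^ H * of_bool up) (N ^ H * of_bool (\<not> up)) st)"
  using exec_rep[of "\<lambda>_. True" "Push (if up then RPos else RNeg) 1" 1 "[]" "of_bool up" "of_bool (\<not> up)" st N H]
    exec_push_sign assms
  by (simp add: concat_replicate_Nil)

lemma exec_divide:
  assumes acc: "st RAcc = acc" "set acc \<subseteq> {1, 2}" "length acc = N"
    and q: "st RQ = bin q" "q > 0" "length (bin q) \<le> N"
    and st: "st RC = []" "st RFlag = []" "st RAcc2 = []" "st RY = []" "counters N (Suc Lv) st"
  defines "n \<equiv> N ^ H * min N (val acc div q)"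
  shows "\<exists>acc' fl. exec (divide_prog up) st (time_divide N)
    (emits_to [] (n * of_bool up) (n * of_bool (\<not> up)) (st(RAcc := acc', RFlag := fl)))"
proof -
  define k where "k = val acc div q"
  \<comment> \<open>The accumulator after \<open>j\<close> rounds: \<open>k\<close> successful
    subtractions, then the failing one, after which it does not change any more.\<close>
  define accs where "accs = rec_nat acc (\<lambda>j x. if j \<le> k then fst (ripple borrow x (bin q) False) else x)"
  have accs_0: "accs 0 = acc" by (simp add: accs_def)
  have accs_Suc: "accs (Suc j) = (if j \<le> k then fst (ripple borrow (accs j) (bin q) False) else accs j)" for j
    by (simp add: accs_def)
  have digits: "length (accs j) = N \<and> set (accs j) \<subseteq> {1, 2}" for j
  proof (induction j)
    case 0
    then show ?case using acc by (simp add: accs_0)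
  next
    case (Suc j)
    obtain zs c' where z: "ripple borrow (accs j) (bin q) False = (zs, c')" by fastforce
    show ?case using Suc ripple_digits[OF z] by (simp add: accs_Suc z)
  qed
  have step: "val (fst (ripple borrow (accs j) (bin q) False)) + q
      = val (accs j) + 2 ^ N * of_bool (snd (ripple borrow (accs j) (bin q) False))" for j
  proof -
    obtain zs c' where z: "ripple borrow (accs j) (bin q) False = (zs, c')" by fastforce
    show ?thesis using ripple_borrow[OF z] digits[of j] q(3) by (simp add: z)
  qed
  have less: "val (fst (ripple borrow (accs j) (bin q) False)) < 2 ^ N" for j
  proof -
    obtain zs c' where z: "ripple borrow (accs j) (bin q) False = (zs, c')" by fastforce
    show ?thesis using ripple_digits[OF z] digits[of j] val_less[of zs] by (simp add: z)
  qed
  have kq: "k * q \<le> val acc" "val acc < k * q + q"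
    using q(2) unfolding k_def by (auto simp: div_times_less_eq_dividend dividend_less_div_times add.commute)
  have val_accs: "j \<le> k \<Longrightarrow> val (accs j) + j * q = val acc" for j
  proof (induction j)
    case 0
    then show ?case by (simp add: accs_0)
  next
    case (Suc j)
    then have IH: "val (accs j) + j * q = val acc" by simp
    have "Suc j * q \<le> k * q" using Suc.prems by (intro mult_le_mono1)
    with kq IH have "q \<le> val (accs j)" by simp
    \<comment> \<open>A borrow would force a result of at least \<open>2 ^ N\<close>, which does not
      fit into \<open>N\<close> digits.\<close>
    with step[of j] less[of j] have "\<not> snd (ripple borrow (accs j) (bin q) False)"
      by (cases "snd (ripple borrow (accs j) (bin q) False)") auto
    with step[of j] IH Suc.prems show ?case by (simp add: accs_Suc)
  qed
  have borrowed: "snd (ripple borrow (accs j) (bin q) False) \<longleftrightarrow> j = k" if "j \<le> k" for j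
  proof -
    have v: "val (accs j) + j * q = val acc" using val_accs[OF that] .
    show ?thesis
    proof (cases "j = k")
      case True
      with v kq have "val (accs j) < q" by simp
      with step[of j] True show ?thesis by (cases "snd (ripple borrow (accs j) (bin q) False)") auto
    next
      case False
      with that have "Suc j * q \<le> k * q" by (intro mult_le_mono1) simp
      with kq v have "q \<le> val (accs j)" by simp
      with step[of j] less[of j] False show ?thesis
        by (cases "snd (ripple borrow (accs j) (bin q) False)") auto
    qed
  qed
  define F where "F j = emits_to [] (N ^ H * min j k * of_bool up) (N ^ H * min j k * of_bool (\<not> up))
    (st(RAcc := accs j, RFlag := flag (k < j)))" for j
  have "exec (divide_prog up) st (N * (24 * N + 3 + (time_rep N H 1 + 4) + 2 + 8) + 2) (F N)"
    unfolding divide_prog_def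
  proof (rule exec_loop'[where F = F, OF st(5)])
    show "F 0 = st" using st acc by (auto simp: F_def flag_def accs_0 fun_eq_iff)
    fix j x y
    let ?s = "(F j)(RA Lv := x, RB Lv := y)" and ?s' = "(F (Suc j))(RA Lv := x, RB Lv := y)"
    show "exec (Cond RFlag {1} Skip (rip borrow RQ ;;
      Cond RC {1} (Pop RC ;; Push RFlag 1) (rep H (Push (if up then RPos else RNeg) 1)))) ?s
      (24 * N + 3 + (time_rep N H 1 + 4) + 2) ?s'"
    proof (cases "k < j")
      case True
      then have "?s = ?s'" by (auto simp: F_def accs_Suc min_def)
      moreover have "head0 (?s RFlag) \<in> {1}" using True by (simp add: F_def flag_def)
      ultimately show ?thesis by (intro execI[OF exec_CondT[OF _ exec_Skip]]) auto
    next
      case False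
      then have j: "j \<le> k" by simp
      obtain zs c' where z: "ripple borrow (accs j) (bin q) False = (zs, c')" by fastforce
      have zs: "zs = accs (Suc j)" "c' \<longleftrightarrow> j = k" using borrowed[OF j] j by (auto simp: accs_Suc z)
      let ?s1 = "?s(RAcc := zs, RC := flag c')"
      have hd: "head0 (?s RFlag) \<notin> {1}" using False by (simp add: F_def flag_def)
      have 1: "exec (rip borrow RQ) ?s (24 * N + 3) ?s1"
      proof (rule execI[OF exec_rip[where c = False]])
        show "ripple borrow (?s RAcc) (?s RQ) False = (zs, c')" using z q by (simp add: F_def)
      qed (use digits[of j] q st set_bin in \<open>auto simp: F_def flag_def\<close>)
      have 2: "exec (Cond RC {1} (Pop RC ;; Push RFlag 1) (rep H (Push (if up then RPos else RNeg) 1))) ?s1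
        (time_rep N H 1 + 4) ?s'"
      proof (cases "j = k")
        case True
        have hd: "head0 (?s1 RC) \<in> {1}" using zs True by (simp add: flag_def)
        have c: "?s1 RC = 1 # []" using zs True by (simp add: flag_def)
        show ?thesis
          by (rule execI[OF exec_CondT[of ?s1 RC, OF hd exec_Seq[OF exec_Pop'[of ?s1, OF c] exec_Push]]])
            (use zs True st in \<open>auto simp: F_def flag_def fun_eq_iff emits_to_def\<close>)
      next
        case False
        have hd: "head0 (?s1 RC) \<notin> {1}" using zs False by (simp add: flag_def)
        have "counters N H ?s1" using st(5) H by (auto simp: F_def counters_def)
        note 3 = exec_rep_sign[OF this, of up]
        have "F (Suc j) = emits_to [] (N ^ H * of_bool up) (N ^ H * of_bool (\<not> up)) ((F j)(RAcc := zs, RC := []))"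
          using zs False j st(1) by (cases up) (auto simp: F_def flag_def emits_to_def fun_eq_iff replicate_add[symmetric] algebra_simps)
        then show ?thesis
          by (intro execI[OF exec_CondF[of ?s1 RC, OF hd 3]]) (use zs False in \<open>auto simp: flag_def emits_to_def fun_eq_iff\<close>)
      qed
      show ?thesis by (rule execI[OF exec_CondF[of ?s RFlag, OF hd exec_Seq[OF 1 2]]]) auto
    qed
  qed (auto simp: F_def)
  moreover have "F N = emits_to [] (n * of_bool up) (n * of_bool (\<not> up)) (st(RAcc := accs N, RFlag := flag (k < N)))"
    by (simp add: F_def n_def k_def)
  ultimately have "exec (divide_prog up) st (time_divide N)
    (emits_to [] (n * of_bool up) (n * of_bool (\<not> up)) (st(RAcc := accs N, RFlag := flag (k < N))))"
    unfolding time_divide_def by (simp only:)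
  then show ?thesis by blast
qed

text \<open>The scale \<open>s\<close> is a constant of the program, so multiplication by it is an
  unrolled sequence of additions; of the list \<open>xs\<close>, only the length counts.\<close>

lemma exec_multiply:
  assumes "st RAcc = acc" "set acc \<subseteq> {1, 2}" "length acc = N" "st RP = bin p" "length (bin p) \<le> N"
    "st RC = []" "st RAcc2 = []" "st RY = []" "val acc + length xs * p < 2 ^ N"
  shows "\<exists>acc'. set acc' \<subseteq> {1, 2} \<and> length acc' = N \<and> val acc' = val acc + length xs * p \<and>
    exec (seqs (\<lambda>_. rip carry RP) xs) st (length xs * (24 * N + 3)) (st(RAcc := acc'))"
  using assms
proof (induction xs arbitrary: st acc)
  case Nil
  then show ?case by (intro exI[of _ acc]) (auto intro!: exec_Skip_eq simp: fun_eq_iff)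
next
  case (Cons x xs)
  obtain zs c' where z: "ripple carry acc (bin p) False = (zs, c')" by fastforce
  have zs: "set zs \<subseteq> {1, 2}" "length zs = N" using ripple_digits[OF z] Cons.prems by auto
  have v: "val zs + 2 ^ N * of_bool c' = val acc + p" using ripple_carry[OF z] Cons.prems by simp
  have "val acc + p < 2 ^ N" using Cons.prems(9) by simp
  with v have c: "\<not> c'" and vz: "val zs = val acc + p" by (cases c'; simp)+
  have 1: "exec (rip carry RP) st (24 * N + 3) (st(RAcc := zs))"
    by (rule execI[OF exec_rip[where c = False and c' = c' and zs = zs]])
      (use Cons.prems z c set_bin in \<open>auto simp: flag_def fun_eq_iff\<close>)
  have "\<exists>acc'. set acc' \<subseteq> {1, 2} \<and> length acc' = N \<and> val acc' = val zs + length xs * p \<and>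
    exec (seqs (\<lambda>_. rip carry RP) xs) (st(RAcc := zs)) (length xs * (24 * N + 3)) ((st(RAcc := zs))(RAcc := acc'))"
    by (rule Cons.IH) (use Cons.prems zs vz in auto)
  then obtain acc' where a: "set acc' \<subseteq> {1, 2}" "length acc' = N" "val acc' = val zs + length xs * p"
    and 2: "exec (seqs (\<lambda>_. rip carry RP) xs) (st(RAcc := zs)) (length xs * (24 * N + 3)) (st(RAcc := acc'))" by auto
  have "exec (seqs (\<lambda>_. rip carry RP) (x # xs)) st (length (x # xs) * (24 * N + 3)) (st(RAcc := acc'))"
    unfolding seqs_Cons by (rule execI[OF exec_Seq[OF 1 2]]) auto
  with a vz show ?case by (intro exI[of _ acc'] conjI) (assumption | simp)+
qed

text \<open>Follows the cases of \<open>clamp\<close>. For a negative threshold, subtracting the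
  empty register \<open>RFlag\<close> with an initial borrow decrements the accumulator; otherwise
  the final \<open>rep H\<close> supplies the \<open>+ 1\<close>. The last letter pushed is the
  \<open>- 1\<close> of \<open>threshold\<close>.\<close>

definition threshold_prog :: "reg com" where
  "threshold_prog = Cond RI {8} (Pop RI ;; Push RS 1) Skip ;; readnum RP ;; Pop RI ;; readnum RQ ;;
     loop Lv (Push RAcc 1) ;; seqs (\<lambda>_. rip carry RP) [0..<s] ;;
     Cond RS {1} (Push RC 1 ;; rip borrow RFlag ;; divide_prog False)
       (divide_prog True ;; rep H (Push RPos 1)) ;; Push RNeg 1"

definition time_threshold :: "nat \<Rightarrow> nat" where
  "time_threshold N = 4 + (8 * N + 2) + 1 + (8 * N + 2) + (N * 9 + 2) + s * (24 * N + 3) +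
     (24 * N + 4 + time_divide N + time_rep N H 1 + 2) + 1"

lemma exec_threshold_prog:
  assumes "st RI = enc_rat u" "st RX = []" "st RY = []" "st RP = []" "st RQ = []" "st RAcc = []"
    "st RAcc2 = []" "st RC = []" "st RS = []" "st RFlag = []" "counters N (Suc Lv) st"
    and N: "length (enc_rat u) + s \<le> N"
  shows "\<exists>st' a b. exec threshold_prog st (time_threshold N) st' \<and>
    st' RPos = replicate a 1 @ st RPos \<and> st' RNeg = replicate b 1 @ st RNeg \<and>
    int a - int b = int N ^ H * clamp s N u - 1 \<and> a \<le> N ^ H * (N + 1) \<and>
    st' RO = st RO \<and> st' RF = st RF \<and> st' RX = st RX \<and> st' RY = st RY \<and> st' RBin = st RBin"
proof -
  obtain p q where u: "quotient_of u = (p, q)" by (cases "quotient_of u")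
  have q0: "q > 0" by (rule quotient_of_denom_pos[OF u])
  define p' q' where "p' = nat \<bar>p\<bar>" and "q' = nat q"
  have enc: "enc_rat u = (if p < 0 then [8] else []) @ bin p' @ 3 # bin q'"
    by (simp add: enc_rat_def u p'_def q'_def)
  have len: "length (bin p') + s \<le> N" "length (bin q') \<le> N" using N by (auto simp: enc)
  \<comment> \<open>Since \<open>s <= 2 ^ s\<close>, at most \<open>s\<close> more digits are needed
    for the product.\<close>
  have sp: "s * p' < 2 ^ N"
  proof -
    have "s * p' \<le> 2 ^ s * p'" by (intro mult_le_mono1) (simp add: less_imp_le)
    also have "\<dots> < 2 ^ s * 2 ^ length (bin p')" using less_power_bin[of p'] by simp
    also have "\<dots> = 2 ^ (s + length (bin p'))" by (simp add: power_add)
    also have "\<dots> \<le> 2 ^ N" using len by (intro power_increasing) auto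
    finally show ?thesis .
  qed
  let ?f = "flag (p < 0)"
  let ?s1 = "st(RI := bin p' @ 3 # bin q', RS := ?f)"
  let ?s2 = "st(RI := 3 # bin q', RS := ?f, RP := bin p')"
  let ?s3 = "st(RI := bin q', RS := ?f, RP := bin p')"
  let ?s4 = "st(RI := [], RS := ?f, RP := bin p', RQ := bin q')"
  let ?s5 = "st(RI := [], RS := ?f, RP := bin p', RQ := bin q', RAcc := replicate N 1)"
  have 1: "exec (Cond RI {8} (Pop RI ;; Push RS 1) Skip) st 4 ?s1"
  proof (cases "p < 0")
    case True
    have c: "st RI = 8 # bin p' @ 3 # bin q'" using assms(1) enc True by simp
    show ?thesis
      by (rule execI[OF exec_CondT[OF _ exec_Seq[OF exec_Pop'[of st, OF c] exec_Push]]])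
        (use True c assms in \<open>auto simp: flag_def fun_eq_iff\<close>)
  next
    case False
    have c: "st RI = bin p' @ 3 # bin q'" using assms(1) enc False by simp
    have "head0 (st RI) \<notin> {8}" unfolding c using set_bin[of p'] by (cases "bin p'") auto
    then show ?thesis
      by (intro execI[OF exec_CondF[OF _ exec_Skip]]) (use False c assms in \<open>auto simp: flag_def fun_eq_iff\<close>)
  qed
  have 2: "exec (readnum RP) ?s1 (8 * N + 2) ?s2"
    by (rule execI[OF exec_readnum[of _ _ "bin p'" "3 # bin q'"]]) (use assms len set_bin in \<open>auto simp: fun_eq_iff\<close>)
  have 3: "exec (Pop RI) ?s2 1 ?s3"
    by (rule execI[OF exec_Pop'[of _ _ 3 "bin q'"]]) (auto simp: fun_eq_iff)
  have 4: "exec (readnum RQ) ?s3 (8 * N + 2) ?s4"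
    by (rule execI[OF exec_readnum[of _ _ "bin q'" "[]"]]) (use assms len set_bin in \<open>auto simp: fun_eq_iff\<close>)
  \<comment> \<open>The letter 1 is the digit 0, so this prepares the number 0 with \<open>N\<close>
    digits.\<close>
  have 5: "exec (loop Lv (Push RAcc 1)) ?s4 (N * (1 + 8) + 2) ?s5"
  proof (rule exec_loop'[where F = "\<lambda>j. ?s4(RAcc := replicate j 1)" and p = "Suc Lv"])
    show "exec (Push RAcc 1) (?s4(RAcc := replicate j 1, RA Lv := x, RB Lv := y)) 1
      (?s4(RAcc := replicate (Suc j) 1, RA Lv := x, RB Lv := y))" for j x y
      by (rule execI[OF exec_Push]) (auto simp: fun_eq_iff)
  qed (use assms in \<open>auto simp: counters_def fun_eq_iff\<close>)
  have "\<exists>acc'. set acc' \<subseteq> {1, 2} \<and> length acc' = N \<and> val acc' = val (replicate N 1) + length [0..<s] * p' \<and>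
    exec (seqs (\<lambda>_. rip carry RP) [0..<s]) ?s5 (length [0..<s] * (24 * N + 3)) (?s5(RAcc := acc'))"
    by (rule exec_multiply) (use assms sp len in auto)
  then obtain acc where acc: "set acc \<subseteq> {1, 2}" "length acc = N" "val acc = s * p'"
    and "exec (seqs (\<lambda>_. rip carry RP) [0..<s]) ?s5 (s * (24 * N + 3)) (?s5(RAcc := acc))"
    by (auto simp del: val.simps)
  then have 6: "exec (seqs (\<lambda>_. rip carry RP) [0..<s]) ?s5 (s * (24 * N + 3)) (?s4(RAcc := acc))" by simp
  let ?div = "Cond RS {1} (Push RC 1 ;; rip borrow RFlag ;; divide_prog False) (divide_prog True ;; rep H (Push RPos 1))"
  have "\<exists>st'' a b. exec ?div (?s4(RAcc := acc)) (24 * N + 4 + time_divide N + time_rep N H 1 + 2) st'' \<and>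
    st'' RPos = replicate a 1 @ st RPos \<and> st'' RNeg = replicate b 1 @ st RNeg \<and>
    int a - int b = int N ^ H * clamp s N u \<and> a \<le> N ^ H * (N + 1) \<and>
    st'' RO = st RO \<and> st'' RF = st RF \<and> st'' RX = st RX \<and> st'' RY = st RY \<and> st'' RBin = st RBin"
  proof (cases "p < 0")
    case True
    then have p'0: "p' > 0" by (simp add: p'_def)
    let ?s7 = "?s4(RAcc := acc, RC := [1])"
    obtain zs c' where z: "ripple borrow acc [] True = (zs, c')" by fastforce
    have zs: "set zs \<subseteq> {1, 2}" "length zs = N" using ripple_digits[OF z] acc by auto
    have v: "val zs + 1 = val acc + 2 ^ N * of_bool c'" using ripple_borrow[OF z] acc(2) by simp
    have "val acc > 0" using acc(3) p'0 s0 by simp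
    with v val_less[of zs] zs have "\<not> c'" by (cases c') auto
    with v acc(3) have vz: "val zs = s * p' - 1" by simp
    let ?s8 = "?s4(RAcc := zs, RC := [])"
    have a: "exec (Push RC 1) (?s4(RAcc := acc)) 1 ?s7"
      by (rule execI[OF exec_Push]) (use assms in \<open>auto simp: fun_eq_iff\<close>)
    have b: "exec (rip borrow RFlag) ?s7 (24 * N + 3) ?s8"
      by (rule execI[OF exec_rip[where c = True and zs = zs and c' = c']])
        (use acc assms z \<open>\<not> c'\<close> in \<open>auto simp: flag_def fun_eq_iff\<close>)
    let ?n = "N ^ H * min N (val zs div q')"
    have "\<exists>acc' fl. exec (divide_prog False) ?s8 (time_divide N)
      (emits_to [] (?n * of_bool False) (?n * of_bool (\<not> False)) (?s8(RAcc := acc', RFlag := fl)))"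
      by (rule exec_divide) (use zs q0 q'_def assms len in \<open>auto simp: counters_def\<close>)
    then obtain acc' fl where c: "exec (divide_prog False) ?s8 (time_divide N)
      (emits_to [] 0 ?n (?s8(RAcc := acc', RFlag := fl)))" by auto
    have hd: "head0 ((?s4(RAcc := acc)) RS) \<in> {1}" using True by (simp add: flag_def)
    have "1 \<le> s * p'" using p'0 s0 by (simp add: Suc_le_eq)
    then have "int (val zs) = int s * \<bar>p\<bar> - 1" by (simp add: vz of_nat_diff p'_def)
    then have "int (val zs div q') = (int s * \<bar>p\<bar> - 1) div q" using q0 by (simp add: zdiv_int q'_def)
    then have "int (min N (val zs div q')) = min (int N) ((int s * \<bar>p\<bar> - 1) div q)" by (simp add: of_nat_min)
    then have "- int ?n = int N ^ H * clamp s N u"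
      by (simp add: clamp_def u True)
    moreover have "exec ?div (?s4(RAcc := acc)) (24 * N + 4 + time_divide N + time_rep N H 1 + 2)
      (emits_to [] 0 ?n (?s8(RAcc := acc', RFlag := fl)))"
      by (rule execI[OF exec_CondT[of "?s4(RAcc := acc)" RS, OF hd exec_Seq[OF a exec_Seq[OF b c]]]]) auto
    ultimately show ?thesis
      by (intro exI[of _ "emits_to [] 0 ?n (?s8(RAcc := acc', RFlag := fl))"] exI[of _ 0] exI[of _ ?n])
        (auto simp: emits_to_def)
  next
    case False
    let ?s8 = "?s4(RAcc := acc)" and ?n = "N ^ H * min N (val acc div q')"
    have "\<exists>acc' fl. exec (divide_prog True) ?s8 (time_divide N)
      (emits_to [] (?n * of_bool True) (?n * of_bool (\<not> True)) (?s8(RAcc := acc', RFlag := fl)))"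
      by (rule exec_divide) (use acc q0 q'_def assms len in \<open>auto simp: counters_def\<close>)
    then obtain acc' fl where a: "exec (divide_prog True) ?s8 (time_divide N)
      (emits_to [] ?n 0 (?s8(RAcc := acc', RFlag := fl)))" by auto
    have "counters N H (emits_to [] ?n 0 (?s8(RAcc := acc', RFlag := fl)))"
      using assms(11) H by (auto simp: counters_def)
    from exec_rep_sign[OF this, of True]
    have b: "exec (rep H (Push RPos 1)) (emits_to [] ?n 0 (?s8(RAcc := acc', RFlag := fl))) (time_rep N H 1)
      (emits_to [] (?n + N ^ H) 0 (?s8(RAcc := acc', RFlag := fl)))" by simp
    have hd: "head0 (?s8 RS) \<notin> {1}" using False by (simp add: flag_def)
    have "int (min N (val acc div q')) = min (int N) (int s * p div q)"
      using False q0 by (simp add: acc(3) p'_def q'_def zdiv_int of_nat_min)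
    then have "int (?n + N ^ H) = int N ^ H * clamp s N u"
      by (simp add: clamp_def u False algebra_simps)
    moreover have "?n + N ^ H \<le> N ^ H * (N + 1)" by simp
    moreover have "exec ?div ?s8 (24 * N + 4 + time_divide N + time_rep N H 1 + 2)
      (emits_to [] (?n + N ^ H) 0 (?s8(RAcc := acc', RFlag := fl)))"
      by (rule execI[OF exec_CondF[of ?s8 RS, OF hd exec_Seq[OF a b]]]) auto
    ultimately show ?thesis
      by (intro exI[of _ "emits_to [] (?n + N ^ H) 0 (?s8(RAcc := acc', RFlag := fl))"] exI[of _ "?n + N ^ H"] exI[of _ 0])
        (auto simp: emits_to_def)
  qed
  then obtain st'' a b where 7: "exec ?div (?s4(RAcc := acc)) (24 * N + 4 + time_divide N + time_rep N H 1 + 2) st''"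
    and r: "st'' RPos = replicate a 1 @ st RPos" "st'' RNeg = replicate b 1 @ st RNeg"
    "int a - int b = int N ^ H * clamp s N u" "a \<le> N ^ H * (N + 1)"
    "st'' RO = st RO \<and> st'' RF = st RF \<and> st'' RX = st RX \<and> st'' RY = st RY \<and> st'' RBin = st RBin" by blast
  have "exec threshold_prog st (time_threshold N) (st''(RNeg := 1 # st'' RNeg))"
    unfolding threshold_prog_def
    by (rule execI[OF exec_Seq[OF 1 exec_Seq[OF 2 exec_Seq[OF 3 exec_Seq[OF 4 exec_Seq[OF 5 exec_Seq[OF 6
        exec_Seq[OF 7 exec_Push]]]]]]] refl]) (simp add: time_threshold_def)
  then show ?thesis
    by (intro exI[of _ "st''(RNeg := 1 # st'' RNeg)"] exI[of _ a] exI[of _ "Suc b"]) (use r in auto)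
qed

end

text \<open>Units of both signs cancel in pairs and the rest is counted in \<open>RBin\<close>; if
  it comes from \<open>RNeg\<close>, a minus sign is written. The letters 3 and 2 at the end are the
  comma and the denominator 1.\<close>

definition convert :: "reg com" where
  "convert = While RPos {1} (Pop RPos ;; Cond RNeg {1} (Pop RNeg) (inc RBin)) ;; Push RO 7 ;;
     Cond RNeg {1} (Push RO 8) Skip ;; While RNeg {1} (Pop RNeg ;; inc RBin) ;;
     mv RBin RO {1, 2} ;; Push RO 3 ;; Push RO 2"

lemma length_bin_self: "length (bin n) \<le> n"
  by (rule length_bin_le) (rule less_exp)

text \<open>Counting begins only when \<open>RNeg\<close> has run empty; the hypothesis
  \<open>b = 0 \<or> c = 0\<close> is this fact as an invariant of the loop.\<close>

lemma exec_cancel: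
  assumes "st RPos = replicate a 1" "st RNeg = replicate b 1" "st RBin = bin c" "b = 0 \<or> c = 0" "st RX = []"
    "c + a \<le> A"
  shows "exec (While RPos {1} (Pop RPos ;; Cond RNeg {1} (Pop RNeg) (inc RBin))) st (a * (8 * A + 11) + 1)
    (st(RPos := [], RNeg := replicate (b - a) 1, RBin := bin (c + (a - b))))"
  using assms
proof (induction a arbitrary: st b c)
  case 0
  then show ?case by (intro execI[OF exec_WhileF]) (auto simp: fun_eq_iff)
next
  case (Suc a)
  let ?s1 = "st(RPos := replicate a 1)"
  let ?body = "Pop RPos ;; Cond RNeg {1} (Pop RNeg) (inc RBin)"
  have 1: "exec (Pop RPos) st 1 ?s1" by (rule exec_Pop'[of _ _ 1]) (use Suc.prems in auto)
  have hd: "head0 (st RPos) \<in> {1}" using Suc.prems by simp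
  show ?case
  proof (cases b)
    case 0
    let ?s2 = "st(RPos := replicate a 1, RBin := bin (Suc c))"
    have 2: "exec (inc RBin) ?s1 (8 * A + 6) ?s2"
      by (rule execI[OF exec_inc_bin[of _ _ c]]) (use Suc.prems length_bin_self[of c] in \<open>auto simp: fun_eq_iff\<close>)
    have 3: "exec (Cond RNeg {1} (Pop RNeg) (inc RBin)) ?s1 (8 * A + 6 + 2) ?s2"
      by (rule exec_CondF[OF _ 2]) (use Suc.prems 0 in auto)
    have 4: "exec (While RPos {1} ?body) ?s2 (a * (8 * A + 11) + 1)
      (?s2(RPos := [], RNeg := replicate (b - a) 1, RBin := bin (Suc c + (a - b))))"
      by (rule Suc.IH) (use Suc.prems 0 in auto)
    show ?thesis
      by (rule execI[OF exec_WhileT[OF hd exec_Seq[OF 1 3] 4]]) (use 0 in \<open>auto simp: fun_eq_iff\<close>)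
  next
    case (Suc b')
    let ?s2 = "st(RPos := replicate a 1, RNeg := replicate b' 1)"
    have 2: "exec (Pop RNeg) ?s1 1 ?s2" by (rule exec_Pop'[of _ _ 1]) (use Suc.prems Suc in auto)
    have 3: "exec (Cond RNeg {1} (Pop RNeg) (inc RBin)) ?s1 (1 + 2) ?s2"
      by (rule exec_CondT[OF _ 2]) (use Suc.prems Suc in auto)
    have 4: "exec (While RPos {1} ?body) ?s2 (a * (8 * A + 11) + 1)
      (?s2(RPos := [], RNeg := replicate (b' - a) 1, RBin := bin (c + (a - b'))))"
      by (rule Suc.IH) (use Suc.prems Suc in auto)
    show ?thesis
      by (rule execI[OF exec_WhileT[OF hd exec_Seq[OF 1 3] 4]]) (use Suc in \<open>auto simp: fun_eq_iff\<close>)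
  qed
qed

lemma exec_count:
  assumes "st RNeg = replicate b 1" "st RBin = bin c" "st RX = []" "c + b \<le> A"
  shows "exec (While RNeg {1} (Pop RNeg ;; inc RBin)) st (b * (8 * A + 9) + 1)
    (st(RNeg := [], RBin := bin (c + b)))"
  using assms
proof (induction b arbitrary: st c)
  case 0
  then show ?case by (intro execI[OF exec_WhileF]) (auto simp: fun_eq_iff)
next
  case (Suc b)
  let ?s1 = "st(RNeg := replicate b 1)" and ?s2 = "st(RNeg := replicate b 1, RBin := bin (Suc c))"
  have 1: "exec (Pop RNeg) st 1 ?s1" by (rule exec_Pop'[of _ _ 1]) (use Suc.prems in auto)
  have hd: "head0 (st RNeg) \<in> {1}" using Suc.prems by simp
  have 2: "exec (inc RBin) ?s1 (8 * A + 6) ?s2"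
    by (rule execI[OF exec_inc_bin[of _ _ c]]) (use Suc.prems length_bin_self[of c] in \<open>auto simp: fun_eq_iff\<close>)
  have 3: "exec (While RNeg {1} (Pop RNeg ;; inc RBin)) ?s2 (b * (8 * A + 9) + 1)
    (?s2(RNeg := [], RBin := bin (Suc c + b)))"
    by (rule Suc.IH) (use Suc.prems in auto)
  show ?case by (rule execI[OF exec_WhileT[OF hd exec_Seq[OF 1 2] 3]]) (auto simp: fun_eq_iff)
qed

lemma enc_rat_of_int:
  "enc_rat (of_int z) = (if z < 0 then [8] else []) @ bin (nat \<bar>z\<bar>) @ [3, 2]"
  by (simp add: enc_rat_def quotient_of_int bin.simps[of "Suc 0"])

definition time_convert :: "nat \<Rightarrow> nat" where
  "time_convert A = 2 * (A * (8 * A + 11)) + 4 * A + 20"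

lemma exec_convert:
  assumes "st RPos = replicate a 1" "st RNeg = replicate b 1" "st RBin = []" "st RX = []" "a \<le> A" "b \<le> A"
  shows "\<exists>st'. exec convert st (time_convert A) st' \<and> st' RO = rev (7 # enc_rat (of_int (int a - int b))) @ st RO \<and>
    st' RF = st RF \<and> st' RX = [] \<and> st' RY = st RY"
proof -
  let ?e = "if a < b then [8] else []"
  let ?s1 = "st(RPos := [], RNeg := replicate (b - a) 1, RBin := bin (a - b))"
  let ?s2 = "?s1(RO := 7 # st RO)" and ?s3 = "?s1(RO := ?e @ 7 # st RO)"
  let ?s4 = "?s3(RNeg := [], RBin := bin (a - b + (b - a)))"
  let ?s5 = "?s4(RBin := [], RO := rev (bin (a - b + (b - a))) @ ?e @ 7 # st RO)"
  have 1: "exec (While RPos {1} (Pop RPos ;; Cond RNeg {1} (Pop RNeg) (inc RBin))) st (a * (8 * A + 11) + 1) ?s1"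
    by (rule execI[OF exec_cancel[of _ _ b 0]]) (use assms in auto)
  have 2: "exec (Push RO 7) ?s1 1 ?s2" by (rule execI[OF exec_Push]) (auto simp: fun_eq_iff)
  have 3: "exec (Cond RNeg {1} (Push RO 8) Skip) ?s2 3 ?s3"
  proof (cases "a < b")
    case True
    then show ?thesis by (intro execI[OF exec_CondT[OF _ exec_Push]]) (auto simp: fun_eq_iff head0_def hd_replicate)
  next
    case False
    then show ?thesis by (intro execI[OF exec_CondF[OF _ exec_Skip]]) (auto simp: fun_eq_iff)
  qed
  have 4: "exec (While RNeg {1} (Pop RNeg ;; inc RBin)) ?s3 ((b - a) * (8 * A + 9) + 1) ?s4"
    by (rule execI[OF exec_count[of _ _ "a - b"]]) (use assms in \<open>auto simp: fun_eq_iff\<close>)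
  have "length (bin (a - b + (b - a))) \<le> A" using assms length_bin_self[of "a - b + (b - a)"] by simp
  then have 5: "exec (mv RBin RO {1, 2}) ?s4 (4 * A + 1) ?s5"
    by (intro execI[OF exec_mv_all]) (use set_bin in \<open>auto simp: fun_eq_iff\<close>)
  have 6: "exec (Push RO 3 ;; Push RO 2) ?s5 (1 + 1) (?s5(RO := 2 # 3 # ?s5 RO))"
    by (rule execI[OF exec_Seq[OF exec_Push exec_Push]]) auto
  have t: "a * (8 * A + 11) \<le> A * (8 * A + 11)" "(b - a) * (8 * A + 9) \<le> A * (8 * A + 11)"
    using assms by (auto intro!: mult_le_mono)
  have "exec convert st (time_convert A) (?s5(RO := 2 # 3 # ?s5 RO))"
    unfolding convert_def
    by (rule execI[OF exec_Seq[OF 1 exec_Seq[OF 2 exec_Seq[OF 3 exec_Seq[OF 4 exec_Seq[OF 5 6]]]]] refl])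
      (unfold time_convert_def, use t in linarith)
  moreover have "nat \<bar>int a - int b\<bar> = a - b + (b - a)" by auto
  then have "enc_rat (of_int (int a - int b)) = ?e @ bin (a - b + (b - a)) @ [3, 2]"
    unfolding enc_rat_of_int by simp
  ultimately show ?thesis using assms
    by (intro exI[of _ "?s5(RO := 2 # 3 # ?s5 RO)"]) (auto simp del: of_int_diff)
qed


section \<open>Initialisation of the unary counters\<close>

definition add_counters :: "nat \<Rightarrow> nat \<Rightarrow> nat \<Rightarrow> reg store \<Rightarrow> reg store" where
  "add_counters j n m st r = (case r of RA i \<Rightarrow> if j \<le> i \<and> i < j + n then replicate m 1 @ st r else st r | _ \<Rightarrow> st r)"

lemma add_counters_other [simp]: "(\<And>i. r \<noteq> RA i) \<Longrightarrow> add_counters j n m st r = st r"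
  by (cases r) (auto simp: add_counters_def)

definition bump :: "nat \<Rightarrow> nat \<Rightarrow> nat \<Rightarrow> reg com" where
  "bump j n m = seqs (\<lambda>i. push_word (RA i) (replicate m 1)) [j..<j + n]"

lemma exec_bump: "exec (bump j n m) st (n * m) (add_counters j n m st)"
  unfolding bump_def
proof (induction n arbitrary: j st)
  case 0
  then show ?case by (auto intro!: exec_Skip_eq simp: fun_eq_iff add_counters_def split: reg.splits)
next
  case (Suc n)
  have "[j..<j + Suc n] = j # [Suc j..<Suc j + n]" by (simp add: upt_conv_Cons del: upt_Suc)
  then show ?case unfolding \<open>[j..<j + Suc n] = _\<close> seqs_Cons
    by (intro execI[OF exec_Seq[OF exec_push_word Suc.IH]])
      (auto simp: fun_eq_iff add_counters_def split: reg.splits)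
qed

text \<open>Every letter of the input contributes \<open>K\<close> units to each counter, which
  makes \<open>N = K * length w\<close>. The input itself travels to \<open>RX\<close> and
  back.\<close>

definition setup_prog :: "nat \<Rightarrow> nat \<Rightarrow> reg com" where
  "setup_prog n K = While RI {1..8} (Cpy RI RX ;; Pop RI ;; bump 0 n K) ;; mv RX RI {1..8}"

lemma exec_setup_loop:
  assumes "st RI = w" "set w \<subseteq> {1..8}"
  shows "exec (While RI {1..8} (Cpy RI RX ;; Pop RI ;; bump 0 n K)) st (length w * (n * K + 4) + 1)
    (add_counters 0 n (K * length w) (st(RI := [], RX := rev w @ st RX)))"
  using assms
proof (induction w arbitrary: st)
  case Nil
  then show ?case by (intro execI[OF exec_WhileF]) (auto simp: fun_eq_iff add_counters_def split: reg.splits)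
next
  case (Cons a w)
  let ?s1 = "st(RX := a # st RX)" and ?s2 = "st(RX := a # st RX, RI := w)"
  have 1: "exec (Cpy RI RX) st 1 ?s1" by (rule exec_Cpy') (use Cons.prems in auto)
  have 2: "exec (Pop RI) ?s1 1 ?s2" by (rule exec_Pop'[of _ _ a]) (use Cons.prems in auto)
  have hd: "head0 (st RI) \<in> {1..8}" using Cons.prems by auto
  have 3: "exec (While RI {1..8} (Cpy RI RX ;; Pop RI ;; bump 0 n K)) (add_counters 0 n K ?s2) (length w * (n * K + 4) + 1)
    (add_counters 0 n (K * length w) ((add_counters 0 n K ?s2)(RI := [], RX := rev w @ add_counters 0 n K ?s2 RX)))"
    by (rule Cons.IH) (use Cons.prems in auto)
  show ?case
    by (rule execI[OF exec_WhileT[OF hd exec_Seq[OF 1 exec_Seq[OF 2 exec_bump]] 3]])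
      (auto simp: fun_eq_iff add_counters_def replicate_add algebra_simps append_replicate_commute split: reg.splits simp flip: append_assoc)
qed

lemma exec_setup:
  assumes "st RI = w" "set w \<subseteq> {1..8}" "st RX = []"
  shows "exec (setup_prog n K) st (length w * (n * K + 8) + 2) (add_counters 0 n (K * length w) st)"
proof -
  let ?s = "add_counters 0 n (K * length w) (st(RI := [], RX := rev w @ st RX))"
  have "exec (mv RX RI {1..8}) ?s (4 * length w + 1) (add_counters 0 n (K * length w) st)"
    by (rule execI[OF exec_mv_all]) (use assms in \<open>auto simp: fun_eq_iff add_counters_def split: reg.splits\<close>)
  from exec_Seq[OF exec_setup_loop[of st w, OF assms(1,2)] this] show ?thesis
    unfolding setup_prog_def by (rule execI) (auto simp: algebra_simps)
qed

text \<open>A step pushes at most one letter; thus a time bound also bounds the length of the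
  output.\<close>

lemma exec_length: "exec c s t s' \<Longrightarrow> length (s' r) \<le> length (s r) + t"
  by (induction rule: exec.induct) auto

lemma clamp_ge: "- (int N + 1) \<le> clamp s N u"
proof -
  obtain p q where u: "quotient_of u = (p, q)" by (cases "quotient_of u")
  have q: "q > 0" by (rule quotient_of_denom_pos[OF u])
  show ?thesis
  proof (cases "p < 0")
    case False
    then have "0 \<le> int s * p div q" using q by (simp add: pos_imp_zdiv_nonneg_iff)
    with False show ?thesis by (auto simp: clamp_def u)
  qed (auto simp: clamp_def u)
qed

lemma set_enc_atom: "set (enc_atom A) \<subseteq> {1..8}"
proof -
  have b: "set (bin n) \<subseteq> {1..8}" for n using set_bin[of n] by auto
  show ?thesis by (cases A) (use b in auto)
qed

lemma set_enc_rat: "set (enc_rat u) \<subseteq> {1..8}"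
proof -
  have b: "set (bin n) \<subseteq> {1..8}" for n using set_bin[of n] by auto
  show ?thesis using b by (auto simp: enc_rat_def split: prod.split)
qed

lemma set_enc_instance: "set (enc_instance I) \<subseteq> {1..8}"
proof -
  obtain n \<phi> u where I: "I = (n, \<phi>, u)" by (cases I)
  have "set (bin n) \<subseteq> {1..8}" using set_bin[of n] by auto
  moreover have "set (concat (map enc_atom \<phi>)) \<subseteq> {1..8}" using set_enc_atom by auto
  ultimately show ?thesis using set_enc_rat[of u] by (auto simp: I)
qed

lemma length_enc_atoms: "length \<phi> \<le> length (concat (map enc_atom \<phi>))"
proof (induction \<phi>)
  case (Cons A \<phi>)
  have "1 \<le> length (enc_atom A)" by (cases A) auto
  with Cons show ?case by simp
qed simp

section \<open>The whole program and its running time\<close>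

context program
begin

text \<open>The number of variables comes first in an instance but is known only at the end. So the
  output stays reversed in \<open>RO\<close> until the final moves turn it around and put the digits
  of \<open>RF\<close> in front.\<close>

definition main :: "nat \<Rightarrow> reg com" where
  "main K = setup_prog (Suc Lv) K ;; readnum RF ;; translate_all ;; Pop RI ;; threshold_prog ;; convert ;;
     mv RO RX {1..8} ;; mv RF RY {1, 2} ;; mv RY RX {1, 2}"

text \<open>Bounds the length of variable names for an input of length \<open>x\<close>:
  \<open>n\<close> has at most \<open>x\<close> digits, and at most \<open>x\<close> times the sum
  of all \<open>l r\<close> variables are added.\<close>

definition bits :: "nat \<Rightarrow> nat" where
  "bits x = x + (\<Sum>r\<in>S. l r) * x + 1"

text \<open>An upper bound for what a single atom adds to either side of the threshold.\<close>

definition count :: "nat \<Rightarrow> nat" where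
  "count N = (\<Sum>r\<in>S. pos_part N (g r)) + (\<Sum>r\<in>S. neg_part N (g r))"

definition time_main :: "nat \<Rightarrow> nat \<Rightarrow> nat" where
  "time_main K x = (x * (Suc Lv * K + 8) + 2) + (8 * x + 2) + (x * (time_translate (bits x) (K * x) + 2) + 1) + 1 +
     time_threshold (K * x) + time_convert (x * count (K * x) + (K * x) ^ H * (2 * (K * x) + 2) + 2)"

lemma aux_le:
  assumes "ok_atom M A"
  shows "aux A \<le> (\<Sum>r\<in>S. l r)" "atom_pos N A \<le> count N" "atom_neg N A \<le> count N"
proof -
  have "l r \<le> (\<Sum>r\<in>S. l r)" "pos_part N (g r) \<le> (\<Sum>r\<in>S. pos_part N (g r))"
    "neg_part N (g r) \<le> (\<Sum>r\<in>S. neg_part N (g r))" if "r \<in> S" for r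
    using that finite_S by (auto intro: member_le_sum)
  with assms show "aux A \<le> (\<Sum>r\<in>S. l r)" "atom_pos N A \<le> count N" "atom_neg N A \<le> count N"
    by (cases A; force simp: count_def intro: trans_le_add1 trans_le_add2)+
qed

lemma sum_list_le:
  fixes f :: "'x \<Rightarrow> nat"
  shows "(\<And>x. x \<in> set xs \<Longrightarrow> f x \<le> b) \<Longrightarrow> (\<Sum>x\<leftarrow>xs. f x) \<le> length xs * b"
  by (induction xs) (auto intro: add_mono)

lemma atom_offsets:
  "(\<Sum>A\<leftarrow>\<phi>. atom_offset N A) = int (\<Sum>A\<leftarrow>\<phi>. atom_pos N A) - int (\<Sum>A\<leftarrow>\<phi>. atom_neg N A)"
  by (induction \<phi>) (auto simp: atom_pos_neg[symmetric])

lemma ok_atom_mono: "ok_atom M A \<Longrightarrow> M \<le> M' \<Longrightarrow> ok_atom M' A"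
  by (cases A) (auto intro: order_less_le_trans power_increasing)

lemma exec_main:
  assumes w: "w = enc_instance (n, \<phi>, u)" and ok: "\<forall>A\<in>set \<phi>. ok_atom (length (bin n)) A"
    and K: "K \<ge> s + 1"
  shows "\<exists>st'. exec (main K) ((\<lambda>_. [])(RI := w)) (5 * time_main K (length w) + 8 * bits (length w) + 3) st' \<and>
    st' RX = enc_instance (reduce (K * length w) (n, \<phi>, u))"
proof -
  let ?x = "length w"
  let ?N = "K * ?x" and ?M = "bits ?x" and ?s0 = "(\<lambda>_. [])(RI := w) :: reg store"
  let ?v = "concat (map enc_atom \<phi>) @ 7 # enc_rat u"
  have w': "w = bin n @ ?v" using w by simp
  have wset: "set w \<subseteq> {1..8}" unfolding w by (rule set_enc_instance)
  have len: "length (bin n) + length \<phi> + length (enc_rat u) + 1 \<le> ?x"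
    using length_enc_atoms[of \<phi>] by (simp add: w)
  have M: "length (bin n) \<le> ?M" using len by (simp add: bits_def)
  have aux: "(\<Sum>A\<leftarrow>\<phi>. aux A) \<le> length \<phi> * (\<Sum>r\<in>S. l r)"
    by (rule sum_list_le) (use ok aux_le in blast)
  also have "\<dots> \<le> (\<Sum>r\<in>S. l r) * ?x" using len by (simp add: mult.commute)
  also have "\<dots> < 2 ^ ((\<Sum>r\<in>S. l r) * ?x)" by (rule less_exp)
  finally have "(\<Sum>A\<leftarrow>\<phi>. aux A) \<le> 2 ^ ((\<Sum>r\<in>S. l r) * ?x)" by simp
  also have "\<dots> \<le> 2 ^ (?x + (\<Sum>r\<in>S. l r) * ?x)" by (rule power_increasing) auto
  finally have "(\<Sum>A\<leftarrow>\<phi>. aux A) \<le> 2 ^ (?x + (\<Sum>r\<in>S. l r) * ?x)" .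
  moreover have "2 ^ length (bin n) \<le> (2::nat) ^ (?x + (\<Sum>r\<in>S. l r) * ?x)"
    by (rule power_increasing) (use len in auto)
  then have "n < 2 ^ (?x + (\<Sum>r\<in>S. l r) * ?x)" using less_power_bin[of n] by linarith
  ultimately have fr: "fresh n \<phi> < 2 ^ ?M" by (simp add: fresh_def bits_def)
  let ?s1 = "add_counters 0 (Suc Lv) ?N ?s0"
  let ?s2 = "?s1(RI := ?v, RF := bin n)"
  let ?o = "concat (map enc_atom (emits ?N n \<phi>))" and ?a = "\<Sum>A\<leftarrow>\<phi>. atom_pos ?N A" and ?b = "\<Sum>A\<leftarrow>\<phi>. atom_neg ?N A"
  let ?s3 = "emits_to ?o ?a ?b (?s2(RI := 7 # enc_rat u, RF := bin (fresh n \<phi>)))"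
  let ?s4 = "?s3(RI := enc_rat u)"
  have 1: "exec (setup_prog (Suc Lv) K) ?s0 (?x * (Suc Lv * K + 8) + 2) ?s1"
    by (rule exec_setup) (use wset in auto)
  have 2: "exec (readnum RF) ?s1 (8 * ?x + 2) ?s2"
  proof (rule execI[OF exec_readnum[of RF ?s1 "bin n" ?v]])
    show "head0 ?v \<notin> {1, 2}" using hd_atoms[of \<phi> "enc_rat u"] by (simp add: head0_def)
  qed (use w' set_bin len in auto)
  have cl: "clean ?N ?s2"
    by (auto simp: clean_def counters_def add_counters_def)
  have 3: "exec translate_all ?s2 (length \<phi> * (time_translate ?M ?N + 2) + 1) ?s3"
    by (rule execI[OF exec_translate_all[where v = "enc_rat u" and f = n and \<phi> = \<phi> and M = ?M and N = ?N]])
      (use ok M fr cl ok_atom_mono in auto)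
  have 4: "exec (Pop RI) ?s3 1 ?s4"
    by (rule execI[OF exec_Pop'[of _ _ 7 "enc_rat u"]]) auto
  have N: "length (enc_rat u) + s \<le> ?N"
  proof -
    have "length (enc_rat u) + s \<le> ?x + s * ?x" using len by (cases ?x) auto
    also have "\<dots> = (s + 1) * ?x" by simp
    also have "\<dots> \<le> ?N" using K by (rule mult_le_mono1)
    finally show ?thesis .
  qed
  have "\<exists>st' a b. exec threshold_prog ?s4 (time_threshold ?N) st' \<and>
    st' RPos = replicate a 1 @ ?s4 RPos \<and> st' RNeg = replicate b 1 @ ?s4 RNeg \<and>
    int a - int b = int ?N ^ H * clamp s ?N u - 1 \<and> a \<le> ?N ^ H * (?N + 1) \<and>
    st' RO = ?s4 RO \<and> st' RF = ?s4 RF \<and> st' RX = ?s4 RX \<and> st' RY = ?s4 RY \<and> st' RBin = ?s4 RBin"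
    by (rule exec_threshold_prog) (use N cl in \<open>auto simp: counters_def clean_def\<close>)
  then obtain s5 a b where 5: "exec threshold_prog ?s4 (time_threshold ?N) s5"
    and s5: "s5 RPos = replicate a 1 @ ?s4 RPos" "s5 RNeg = replicate b 1 @ ?s4 RNeg"
    "int a - int b = int ?N ^ H * clamp s ?N u - 1" "a \<le> ?N ^ H * (?N + 1)"
    "s5 RO = ?s4 RO" "s5 RF = ?s4 RF" "s5 RX = ?s4 RX" "s5 RY = ?s4 RY" "s5 RBin = ?s4 RBin" by metis
  \<comment> \<open>The threshold program reports only a bound on \<open>a\<close> and the
    difference \<open>a - b\<close>; with the lower bound on \<open>clamp\<close> they also bound
    \<open>b\<close>.\<close>
  have b: "b \<le> ?N ^ H * (2 * ?N + 2) + 1"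
  proof -
    have "- (int ?N + 1) \<le> clamp s ?N u"
      by (rule clamp_ge)
    then have "int ?N ^ H * (- (int ?N + 1)) \<le> int ?N ^ H * clamp s ?N u"
      by (intro mult_left_mono) auto
    moreover have "int a \<le> int (?N ^ H * (?N + 1))" using s5(4) by (simp only: of_nat_le_iff)
    ultimately have "int b \<le> int (?N ^ H * (?N + 1)) + int ?N ^ H * (int ?N + 1) + 1"
      using s5(3) unfolding mult_minus_right by linarith
    also have "\<dots> = int (?N ^ H * (2 * ?N + 2) + 1)" by (simp add: algebra_simps)
    finally show ?thesis by linarith
  qed
  let ?A = "?x * count ?N + ?N ^ H * (2 * ?N + 2) + 2"
  have ab: "?a \<le> ?x * count ?N" "?b \<le> ?x * count ?N"
  proof -
    have "?a \<le> length \<phi> * count ?N" "?b \<le> length \<phi> * count ?N"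
      by (rule sum_list_le, use ok aux_le in blast)+
    moreover have "length \<phi> * count ?N \<le> ?x * count ?N" using len by (intro mult_le_mono1) simp
    ultimately show "?a \<le> ?x * count ?N" "?b \<le> ?x * count ?N" by linarith+
  qed
  have Aa: "a + ?a \<le> ?A"
  proof -
    have "?N ^ H * (?N + 1) \<le> ?N ^ H * (2 * ?N + 2)" by (intro mult_le_mono2) simp
    with ab s5(4) show ?thesis by linarith
  qed
  have "\<exists>st'. exec convert s5 (time_convert ?A) st' \<and>
    st' RO = rev (7 # enc_rat (of_int (int (a + ?a) - int (b + ?b)))) @ s5 RO \<and>
    st' RF = s5 RF \<and> st' RX = [] \<and> st' RY = s5 RY"
    by (rule exec_convert) (use s5 Aa ab b in \<open>auto simp: emits_to_def replicate_add\<close>)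
  then obtain s6 where 6: "exec convert s5 (time_convert ?A) s6"
    and s6: "s6 RO = rev (7 # enc_rat (of_int (int (a + ?a) - int (b + ?b)))) @ s5 RO"
    "s6 RF = s5 RF" "s6 RX = []" "s6 RY = s5 RY" by blast
  have thr: "int (a + ?a) - int (b + ?b) = threshold ?N \<phi> u"
    using s5(3) unfolding threshold_def atom_offsets by simp
  let ?e = "?o @ 7 # enc_rat (of_int (threshold ?N \<phi> u))"
  have O: "s6 RO = rev ?e" using s6(1) s5(5) unfolding thr by (simp add: emits_to_def)
  have F: "s6 RF = bin (fresh n \<phi>)" using s6(2) s5(6) by simp
  let ?s7 = "s6(RO := [], RX := ?e)"
  let ?s8 = "s6(RO := [], RX := ?e, RF := [], RY := rev (bin (fresh n \<phi>)))"
  let ?s9 = "s6(RO := [], RX := bin (fresh n \<phi>) @ ?e, RF := [], RY := [])"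
  have T6: "exec (setup_prog (Suc Lv) K ;; readnum RF ;; translate_all ;; Pop RI ;; threshold_prog ;; convert) ?s0
    (time_main K ?x) s6"
  proof (rule execI[OF exec_Seq[OF 1 exec_Seq[OF 2 exec_Seq[OF 3 exec_Seq[OF 4 exec_Seq[OF 5 6]]]]] refl])
    have "length \<phi> * (time_translate ?M ?N + 2) \<le> ?x * (time_translate ?M ?N + 2)"
      using len by (intro mult_le_mono1) simp
    then show "?x * (Suc Lv * K + 8) + 2 + (8 * ?x + 2 + (length \<phi> * (time_translate ?M ?N + 2) + 1 +
      (1 + (time_threshold ?N + time_convert ?A)))) \<le> time_main K ?x"
      unfolding time_main_def by linarith
  qed
  \<comment> \<open>The output is no longer than the time spent so far. Hence the factor 5: the time
    itself, and four steps per letter for turning the output around.\<close>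
  have lenO: "length (s6 RO) \<le> time_main K ?x"
    using exec_length[OF T6, of RO] by simp
  have lenF: "length (s6 RF) \<le> ?M" unfolding F by (rule length_bin_le[OF fr])
  have "set ?e \<subseteq> set (enc_instance (fresh n \<phi>, emits ?N n \<phi>, of_int (threshold ?N \<phi> u)))" by auto
  then have sete: "set ?e \<subseteq> {1..8}" using set_enc_instance by blast
  have 7: "exec (mv RO RX {1..8}) s6 (4 * time_main K ?x + 1) ?s7"
    by (rule execI[OF exec_mv_all]) (use O s6 sete lenO in auto)
  have 8: "exec (mv RF RY {1, 2}) ?s7 (4 * ?M + 1) ?s8"
    by (rule execI[OF exec_mv_all]) (use F s6 s5 lenF set_bin in auto)
  have 9: "exec (mv RY RX {1, 2}) ?s8 (4 * ?M + 1) ?s9"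
    by (rule execI[OF exec_mv_all]) (use F lenF set_bin in \<open>auto simp: fun_eq_iff\<close>)
  have "exec (main K) ?s0 ((?x * (Suc Lv * K + 8) + 2) + ((8 * ?x + 2) + ((length \<phi> * (time_translate ?M ?N + 2) + 1) +
      (1 + (time_threshold ?N + (time_convert ?A + (4 * time_main K ?x + 1 + (4 * ?M + 1 + (4 * ?M + 1))))))))) ?s9"
    unfolding main_def
    by (rule exec_Seq[OF 1 exec_Seq[OF 2 exec_Seq[OF 3 exec_Seq[OF 4 exec_Seq[OF 5 exec_Seq[OF 6
        exec_Seq[OF 7 exec_Seq[OF 8 9]]]]]]]])
  moreover have "length \<phi> * (time_translate ?M ?N + 2) \<le> ?x * (time_translate ?M ?N + 2)"
    using len by (intro mult_le_mono1) simp
  then have "(?x * (Suc Lv * K + 8) + 2) + ((8 * ?x + 2) + ((length \<phi> * (time_translate ?M ?N + 2) + 1) +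
      (1 + (time_threshold ?N + (time_convert ?A + (4 * time_main K ?x + 1 + (4 * ?M + 1 + (4 * ?M + 1))))))))
      \<le> 5 * time_main K ?x + 8 * ?M + 3"
    using time_main_def[of K ?x] by linarith
  ultimately have "exec (main K) ?s0 (5 * time_main K ?x + 8 * ?M + 3) ?s9" by (rule exec_mono)
  then show ?thesis by (intro exI[of _ ?s9] conjI) (assumption | simp)+
qed

end

section \<open>The program uses only the letters 1 to 8\<close>

lemma letters_seqs [simp]: "letters (seqs f xs) = (\<Union>x\<in>set xs. letters (f x))"
  by (induction xs) auto

lemma letters_push_word [simp]: "letters (push_word r w) = set w"
  by (induction w) (auto simp: push_word_def)

lemma letters_mv [simp]: "letters (mv r q S) = {}"
  by (simp add: mv_def)

lemma letters_rep: "letters (rep p c) \<subseteq> insert 1 (letters c)"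
  by (induction p) (auto simp: loop_def)

lemma letters_parse: "(\<And>w. letters (act w) \<subseteq> L) \<Longrightarrow> letters (parse d w act) \<subseteq> L"
  by (induction d arbitrary: w) auto

lemma letters_emit_atom: "letters (emit_atom A) \<subseteq> {1..8}"
proof -
  have "set (bin r) \<subseteq> {1..8}" for r using set_bin[of r] by auto
  then show ?thesis by (cases A) (auto simp: dup_def)
qed

lemma letters_emit_term: "letters (emit_term t) \<subseteq> {1..8}"
proof -
  obtain p e z where t: "t = (p, e, z)" by (cases t)
  have "letters (seqs emit_atom e ;; add_unary z) \<subseteq> {1..8}"
    using letters_emit_atom by (auto simp: add_unary_def split: if_splits)
  with letters_rep[of p "seqs emit_atom e ;; add_unary z"] show ?thesis
    by (fastforce simp: emit_term_def t)
qed

lemma letters_process: "letters (process k n ts) \<subseteq> {1..8}"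
proof -
  have "(\<Union>x\<in>set ts. letters (emit_term x)) \<subseteq> {1..8}" using letters_emit_term by blast
  then show ?thesis
    by (auto simp: process_def readvars_def readnum_def freshvars_def copyF_def dup_def inc_def clearvars_def)
qed

lemma letters_rip: "letters (rip cf y) \<subseteq> {1, 2}"
  by (auto simp: rip_def rip_digit_def rip_second_def rip_carry_def rip_out_def flag_def split: if_splits)

lemma (in program) letters_main: "letters (main K) \<subseteq> {1..8}"
proof -
  have "letters (parse D [] symbol) \<subseteq> {1..8}"
    by (rule letters_parse) (simp only: symbol_def Let_def letters_process)
  then have 1: "letters translate_all \<subseteq> {1..8}" by (auto simp: translate_all_def translate_def)
  have rep: "letters (rep p (Push r 1)) \<subseteq> {1..8}" for p r
    using letters_rep[of p "Push r 1"] by auto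
  have rip: "letters (rip cf y) \<subseteq> {1..8}" for cf y
    using letters_rip[of cf y] by auto
  have 2: "letters (divide_prog up) \<subseteq> {1..8}" for up
    using rep rip by (auto simp: divide_prog_def loop_def)
  have 3: "letters threshold_prog \<subseteq> {1..8}"
    using 2 rep rip unfolding threshold_prog_def loop_def readnum_def by auto
  have 4: "letters convert \<subseteq> {1..8}" by (auto simp: convert_def inc_def)
  have 5: "letters (setup_prog n K) \<subseteq> {1..8}" for n
    by (auto simp: setup_prog_def bump_def split: if_splits)
  show ?thesis using 1 3 4 5 by (simp add: main_def readnum_def)
qed

section \<open>The running time is polynomial\<close>

lemma poly_bounded_sum_list:
  "(\<And>y. y \<in> set ys \<Longrightarrow> poly_bounded (\<lambda>x. f x y)) \<Longrightarrow> poly_bounded (\<lambda>x. \<Sum>y\<leftarrow>ys. f x y)"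
  by (induction ys) (auto intro: poly_bounded_intros)

lemma poly_bounded_sum:
  "finite Y \<Longrightarrow> (\<And>y. y \<in> Y \<Longrightarrow> poly_bounded (\<lambda>x. f x y)) \<Longrightarrow> poly_bounded (\<lambda>x. \<Sum>y\<in>Y. f x y)"
  by (induction Y rule: finite_induct) (auto intro: poly_bounded_intros)

lemma poly_bounded_time_rep:
  "poly_bounded N \<Longrightarrow> poly_bounded t \<Longrightarrow> poly_bounded (\<lambda>x. time_rep (N x) p (t x))"
proof (induction p)
  case (Suc p)
  then show ?case unfolding time_rep.simps by (intro poly_bounded_intros)
qed simp

lemma poly_bounded_time_atom: "poly_bounded M \<Longrightarrow> poly_bounded (\<lambda>x. time_atom (M x) A)"
  by (cases A; simp only: time_atom.simps; intro poly_bounded_intros)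

lemma poly_bounded_time_term:
  "poly_bounded M \<Longrightarrow> poly_bounded N \<Longrightarrow> poly_bounded (\<lambda>x. time_term (M x) (N x) t)"
  by (cases t) (auto simp: time_term_def
      intro!: poly_bounded_time_rep poly_bounded_add poly_bounded_const poly_bounded_sum_list poly_bounded_time_atom)

lemma poly_bounded_time_process:
  "poly_bounded M \<Longrightarrow> poly_bounded N \<Longrightarrow> poly_bounded (\<lambda>x. time_process (M x) (N x) k n ts)"
  unfolding time_process_def
  by (intro poly_bounded_intros poly_bounded_sum_list poly_bounded_time_term) assumption+

text \<open>Gadgets, exponents and the signature are constants here; the input enters through its
  length \<open>x\<close>, the name length \<open>bits x\<close> and the number
  \<open>K * x\<close>.\<close>

lemma (in program) poly_bounded_time_main: "poly_bounded (\<lambda>x. 5 * time_main K x + 8 * bits x + 3)"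
proof -
  have bits: "poly_bounded bits" unfolding bits_def by (intro poly_bounded_intros)
  have N: "poly_bounded (\<lambda>x. K * x)" by (intro poly_bounded_intros)
  have rep: "poly_bounded (\<lambda>x. time_rep (K * x) p 1)" for p
    by (intro poly_bounded_time_rep N poly_bounded_const)
  have tr: "poly_bounded (\<lambda>x. time_translate (bits x) (K * x))"
    unfolding time_translate_def
    by (intro poly_bounded_intros poly_bounded_sum finite_S poly_bounded_time_process N bits)
  have dv: "poly_bounded (\<lambda>x. time_divide (K * x))"
    unfolding time_divide_def by (intro poly_bounded_intros rep)
  have th: "poly_bounded (\<lambda>x. time_threshold (K * x))"
    unfolding time_threshold_def by (intro poly_bounded_intros rep dv)
  have part: "poly_bounded (\<lambda>x. pos_part (K * x) ts)" "poly_bounded (\<lambda>x. neg_part (K * x) ts)" for ts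
    unfolding pos_part_def neg_part_def case_prod_unfold
    by (intro poly_bounded_sum_list poly_bounded_intros)+
  have ct: "poly_bounded (\<lambda>x. count (K * x))"
    unfolding count_def by (intro poly_bounded_intros poly_bounded_sum finite_S part)
  have cv: "poly_bounded (\<lambda>x. time_convert (x * count (K * x) + (K * x) ^ H * (2 * (K * x) + 2) + 2))"
    unfolding time_convert_def by (intro poly_bounded_intros ct)
  show ?thesis unfolding time_main_def
    by (intro poly_bounded_intros tr th cv bits)
qed

section \<open>One family of gadgets for all cost functions of \<Delta>\<close>

lemma bounded_by_mono: "bounded_by k C R \<Longrightarrow> C \<le> C' \<Longrightarrow> bounded_by k C' R"
  unfolding bounded_by_def
proof (intro allI impI)
  fix a assume "\<forall>a. length a = k \<longrightarrow> R a \<noteq> \<infinity> \<longrightarrow> \<bar>real_of_ereal (R a)\<bar> \<le> real C"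
    and "length a = k" "R a \<noteq> \<infinity>" and le: "C \<le> C'"
  then have "\<bar>real_of_ereal (R a)\<bar> \<le> real C" by blast
  also have "\<dots> \<le> real C'" using le by simp
  finally show "\<bar>real_of_ereal (R a)\<bar> \<le> real C'" .
qed

theorem lemma4p5:
  fixes \<Gamma> \<Delta> :: "'c::countable vstruct"
  assumes "valued_structure \<Gamma>"
    and "oligomorphic (Aut \<Gamma>)"
    and "finite (symbols \<Gamma>)"
    and "valued_structure \<Delta>"
    and "finite (symbols \<Delta>)"
    and "\<forall>r\<in>symbols \<Delta>. (arity \<Delta> r, cost \<Delta> r) \<in> wclone \<Gamma>"
  shows "\<exists>f. poly_time_reduction f (VCSP \<Delta>) (VCSP \<Gamma>)"
proof -
  let ?S = "symbols \<Delta>"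
  note fin = assms(5)
  have id: "id \<in> Aut \<Gamma>" by (simp add: Aut_def)
  have "\<exists>l ts s h B C. approx \<Gamma> (arity \<Delta> r) (cost \<Delta> r) l ts s h B \<and> bounded_by (arity \<Delta> r) C (cost \<Delta> r)"
    if "r \<in> ?S" for r
  proof -
    have "invariant (Aut \<Gamma>) (arity \<Delta> r) (cost \<Delta> r)" "approximable \<Gamma> (arity \<Delta> r) (cost \<Delta> r)"
      using approximable_wclone[OF assms(1,2)] assms(6) that by blast+
    then show ?thesis
      using bounded_by_finite[OF finite_invariant[OF assms(2) id]] unfolding approximable_def by meson
  qed
  then obtain l ts0 s0 h0 B0 C0 where
    ap: "\<And>r. r \<in> ?S \<Longrightarrow> approx \<Gamma> (arity \<Delta> r) (cost \<Delta> r) (l r) (ts0 r) (s0 r) (h0 r) (B0 r)" and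
    bd: "\<And>r. r \<in> ?S \<Longrightarrow> bounded_by (arity \<Delta> r) (C0 r) (cost \<Delta> r)" by metis
  \<comment> \<open>As \<Delta> has finitely many symbols, a product gives a common multiple of the
    scales and sums give common bounds for the other parameters.\<close>
  define s where "s = (\<Prod>r\<in>?S. s0 r)"
  define h where "h = (\<Sum>r\<in>?S. h0 r)"
  define B where "B = (\<Sum>r\<in>?S. s div s0 r * B0 r) + 1"
  define C where "C = (\<Sum>r\<in>?S. C0 r)"
  define ts where "ts r = repeat (s div s0 r) (raise (h - h0 r) (ts0 r))" for r
  define g where "g r = square (ts r)" for r
  have s: "s > 0" unfolding s_def using approxD(1)[OF ap] by (simp add: prod_pos)
  have ap': "approx \<Gamma> (arity \<Delta> r) (cost \<Delta> r) (l r) (ts r) s h B" if r: "r \<in> ?S" for r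
  proof -
    have dvd: "s0 r dvd s" unfolding s_def using fin r by (rule dvd_prodI)
    then have "s div s0 r > 0" using s approxD(1)[OF ap[OF r]] by (simp add: dvd_imp_le div_greater_zero_iff)
    from approx_repeat[OF approx_raise[OF ap[OF r], of "h - h0 r"] this]
    have "approx \<Gamma> (arity \<Delta> r) (cost \<Delta> r) (l r) (ts r) (s0 r * (s div s0 r)) (h0 r + (h - h0 r)) (s div s0 r * B0 r)"
      unfolding ts_def .
    moreover have "h0 r \<le> h"
      unfolding h_def using fin r by (auto intro: member_le_sum)
    moreover have "s div s0 r * B0 r \<le> B"
      unfolding B_def by (intro trans_le_add1 member_le_sum r fin) auto
    ultimately show ?thesis using dvd by (auto intro: approx_mono)
  qed
  define H where "H = 2 * h + 2"
  define Lv where "Lv = H + (\<Sum>r\<in>?S. \<Sum>t\<leftarrow>g r. fst t)"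
  define D where "D = (\<Sum>r\<in>?S. length (bin r))"
  \<comment> \<open>Two demands on \<open>N = K * length w\<close>: \<open>reduce_correct\<close>
    needs the first summand, once more than there are atoms, and \<open>exec_main\<close> needs
    \<open>s + 1\<close>.\<close>
  define K where "K = (B + s * C + 2) + s + 1"
  interpret R: reduction \<Gamma> \<Delta> l g s h ts B C
  proof
    show "bounded_by (arity \<Delta> r) C (cost \<Delta> r)" if "r \<in> ?S" for r
      by (rule bounded_by_mono[OF bd[OF that]]) (use that fin in \<open>auto simp: C_def intro: member_le_sum\<close>)
  qed (use ap' s in \<open>auto simp: g_def B_def\<close>)
  interpret P: program l g s H "arity \<Delta>" ?S Lv D
  proof
    show "length (bin r) \<le> D" if "r \<in> ?S" for r
      unfolding D_def using that fin by (auto intro: member_le_sum)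
    show "\<forall>(p, e, z)\<in>set (g r). p \<le> Lv \<and> (\<forall>A\<in>set e. atom_vars A \<subseteq> {..<arity \<Delta> r + l r})" if r: "r \<in> ?S" for r
    proof -
      have "wf_gadget \<Gamma> (arity \<Delta> r + l r) (g r)" using approxD(3)[OF ap'[OF r]] by (simp add: g_def)
      moreover have "p \<le> Lv" if t: "(p, e, z) \<in> set (g r)" for p e z
      proof -
        have "fst (p, e, z) \<le> (\<Sum>t\<leftarrow>g r. fst t)" by (rule member_le_sum_list, use t in force, simp)
        also have "\<dots> \<le> (\<Sum>r\<in>?S. \<Sum>t\<leftarrow>g r. fst t)" using r fin by (auto intro: member_le_sum)
        finally show ?thesis by (simp add: Lv_def)
      qed
      ultimately show ?thesis by (fastforce simp: wf_gadget_def wf_atom_def)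
    qed
  qed (use s fin in \<open>auto simp: Lv_def\<close>)
  \<comment> \<open>Outside the range of \<open>enc_instance\<close> this is arbitrary; a reduction
    is judged on the words of instances only.\<close>
  define f where "f w = enc_instance (P.reduce (K * length w) (inv enc_instance w))" for w
  have f: "f (enc_instance I) = enc_instance (P.reduce (K * length (enc_instance I)) I)" for I
    by (simp only: f_def inv_f_f[OF inj_enc_instance])
  have "poly_time_computable_on (fst (VCSP \<Delta>)) f"
  proof (rule poly_time_computable_by_com[OF P.letters_main[of K] _ _ P.poly_bounded_time_main])
    fix w assume "w \<in> fst (VCSP \<Delta>)"
    then obtain n \<phi> u where I: "(n, \<phi>, u) \<in> vcsp_instances \<Delta>" and w: "w = enc_instance (n, \<phi>, u)"
      by (auto simp: VCSP_def simp del: enc_instance.simps)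
    have wf: "\<forall>A\<in>set \<phi>. wf_atom \<Delta> n A" using I by (simp only: R.vcsp_instances_wf)
    have small: "i < 2 ^ length (bin n)" if "i < n" for i using that less_power_bin[of n] by linarith
    have "P.ok_atom (length (bin n)) A" if "A \<in> set \<phi>" for A
      using wf[rule_format, OF that] small by (cases A) (auto simp: wf_atom_def)
    then have "\<exists>st'. exec (P.main K) ((\<lambda>_. [])(RI := w)) (5 * P.time_main K (length w) + 8 * P.bits (length w) + 3) st' \<and>
      st' RX = f w"
      using P.exec_main[OF w, of K] unfolding w f by (auto simp: K_def simp del: enc_instance.simps)
    then obtain st' where st': "exec (P.main K) ((\<lambda>_. [])(RI := w)) (5 * P.time_main K (length w) + 8 * P.bits (length w) + 3) st'"
      "st' RX = f w" by blast
    show "length (f w) \<le> 5 * P.time_main K (length w) + 8 * P.bits (length w) + 3"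
      using exec_length[OF st'(1), of RX] st'(2) by simp
    have "set w \<subseteq> {1..8}" "set (f w) \<subseteq> {1..8}" unfolding w f by (rule set_enc_instance)+
    with st' show "set w \<subseteq> {1..8} \<and> set (f w) \<subseteq> {1..8} \<and>
      (\<exists>st'. exec (P.main K) ((\<lambda>_. [])(RI := w)) (5 * P.time_main K (length w) + 8 * P.bits (length w) + 3) st' \<and>
        st' RX = f w)" by blast
  qed
  moreover have "f w \<in> fst (VCSP \<Gamma>) \<and> (w \<in> snd (VCSP \<Delta>) \<longleftrightarrow> f w \<in> snd (VCSP \<Gamma>))"
    if w: "w \<in> fst (VCSP \<Delta>)" for w
  proof -
    from w obtain n \<phi> u where I: "(n, \<phi>, u) \<in> vcsp_instances \<Delta>" and w: "w = enc_instance (n, \<phi>, u)"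
      by (auto simp: VCSP_def simp del: enc_instance.simps)
    have "length \<phi> + 1 \<le> length w" using length_enc_atoms[of \<phi>] by (simp add: w)
    then have "(length \<phi> + 1) * (B + s * C + 2) \<le> length w * K"
      by (intro mult_le_mono) (auto simp: K_def)
    then have "(length \<phi> + 1) * (B + s * C + 2) \<le> K * length w" by (simp only: mult.commute)
    from R.reduce_correct[OF I this]
    have "P.reduce (K * length w) (n, \<phi>, u) \<in> vcsp_instances \<Gamma>"
      "(n, \<phi>, u) \<in> vcsp_yes \<Delta> \<longleftrightarrow> P.reduce (K * length w) (n, \<phi>, u) \<in> vcsp_yes \<Gamma>"
      unfolding H_def by blast+
    moreover have "f w = enc_instance (P.reduce (K * length w) (n, \<phi>, u))" unfolding w f ..
    ultimately show ?thesis
      unfolding VCSP_def fst_conv snd_conv using w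
      by (simp add: inj_image_mem_iff[OF inj_enc_instance] del: enc_instance.simps)
  qed
  ultimately show ?thesis unfolding poly_time_reduction_def by blast
qed

end
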